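(* Let $\mathcal{G}$ be a triangular category over an algebraically closed field $\mathbf{k}$, with a fixed admissible order, and let $\lambda\in\Lambda$ be a weight. (a) $\Delta_\lambda$ is a lowest weight module of lowest weight $\lambda$. (b) Every other lowest weight module with lowest weight $\lambda$ is a quotient of $\Delta_\lambda$. (c) There is a unique simple quotient $L_\lambda$ of $\Delta_\lambda$. (d) Every simple $\mathcal{G}$-module is isomorphic to $L_\mu$ for a unique $\mu\in\Lambda$. (e) The simple constituents of $\Delta_\lambda$, other than $L_\lambda$, have the form $L_\mu$ with $\mu>\lambda$.
   Context: Triangular categories. A subcategory is wide if it contains all objects. Write $|\mathcal{G}|$ for the set of isomorphism classes of objects of $\mathcal{G}$. Given a partial order $\le$ on $|\mathcal G|$, a wide subcategory is upwards (resp. downwards) if existence of a non-zero morphism $x\to y$ in it implies $x\le y$ (resp. $x\ge y$). A triangular category is a $\mathbf{k}$-linear category $\mathcal{G}$ together with a pair $(\mathcal{U},\mathcal{D})$ of wide subcategories such that: (T0) $\mathcal{G}$ is essentially small and all Hom spaces are finite dimensional; (T1) $\mathrm{End}_{\mathcal{U}}(x)=\mathrm{End}_{\mathcal{D}}(x)$ for all objects $x$, and this ring is semi-simple; (T2) there is a partial order $\le$ on $|\mathcal{G}|$ (called an admissible order) such that for every $x$ there are only finitely many $y\le x$, $\mathcal{U}$ is upwards, and $\mathcal{D}$ is downwards; (T3) for all $x,z\in\mathcal{G}$ the map $\bigoplus_{y\in|\mathcal{G}|}\mathrm{Hom}_{\mathcal{U}}(y,z)\otimes_{\mathrm{End}_{\mathcal{U}}(y)}\mathrm{Hom}_{\mathcal{D}}(x,y)\to\mathrm{Hom}_{\mathcal{G}}(x,z)$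 induced by composition is an isomorphism. Put $\mathcal{M}=\mathcal{U}\cap\mathcal{D}$. Modules. For a $\mathbf{k}$-linear category $\mathcal{C}$, a $\mathcal{C}$-module is a $\mathbf{k}$-linear functor from $\mathcal{C}$ to $\mathbf{k}$-vector spaces. For a $\mathbf{k}$-linear functor $f$, $f^*$ denotes restriction of modules along $f$ and $f_!$ its left adjoint. Let $j\colon\mathcal{D}\to\mathcal{G}$ be the inclusion. Weights. $\Lambda$ is the set of isomorphism classes of simple $\mathcal{M}$-modules; its elements are called weights. $S_\lambda$ is a representative of $\lambda\in\Lambda$; it is non-zero on a unique isomorphism class $\mathrm{supp}(\lambda)\in|\mathcal{G}|$. Put $\lambda<\mu$ if $\mathrm{supp}(\lambda)<\mathrm{supp}(\mu)$. A weight $\lambda$ occurs in a $\mathcal{G}$-module $M$ with multiplicity $m_\lambda(M)\in\mathbf{N}\cup\{\infty\}$, the multiplicity of $S_\lambda$ in the restriction of $M$ to $\mathcal{M}$; it occurs if this is non-zero. $S_\lambda$ is regarded as a $\mathcal{D}$-module by letting all maps between non-isomorphic objects act by zero, and the standard module is $\Delta_\lambda=j_!(S_\lambda)$. A $\mathcal{G}$-module $M$ is a lowest weight module with lowest weight $\lambda$ if: $\lambda$ occurs in $M$ with multiplicity one; $M$ is generated as a $\mathcal{G}$-module by the unique copy of $S_\lambda$ it contains; and if a weight $\mu$ occurs in $M$ then $\lambda\le\mu$. A simple constituent of $M$ is a simple module isomorphic to a subquotient of $M$; in (e), "other than $L_\lambda$" refers to the simple constituents not isomorphic to $L_\lamb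da$.
   Formalization: It is additionally assumed that objects isomorphic in G are isomorphic in M = U ∩ D; without this S_λ need not extend by zero to a D-module, and (d) fails in a three-object example where M has three simple modules but G only two. *)

theory Defs
  imports
    "HOL-Algebra.Algebraic_Closure"
    "HOL-Library.Extended_Nat"
    "Jordan_Normal_Form.Missing_VectorSpace"
begin

section \<open>Linear algebra\<close>

text \<open>Vector spaces are the records of \<^theory>\<open>HOL-Algebra.Module\<close>; the fields
  \<^const>\<open>monoid.mult\<close> and \<^const>\<open>monoid.one\<close>, which such a record inherits from rings, carry no
  information and are left undefined.\<close>

definition quot_space :: "('k, 'v) module \<Rightarrow> 'v set \<Rightarrow> ('k, 'v set) module" where
  "quot_space V W =
    \<lparr>carrier = a_rcosets\<^bsub>V\<^esub> W, monoid.mult = undefined, one = undefined,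
     zero = W, add = set_add V,
     smult = (\<lambda>a A. the_elem ((\<lambda>v. W +>\<^bsub>V\<^esub> (a \<odot>\<^bsub>V\<^esub> v)) ` A))\<rparr>"

definition direct_sum_space ::
    "'k ring \<Rightarrow> 'i set \<Rightarrow> ('i \<Rightarrow> ('k, 'v) module) \<Rightarrow> ('k, 'i \<Rightarrow> 'v) module" where
  "direct_sum_space K I V =
    \<lparr>carrier = {f \<in> \<Pi>\<^sub>E i\<in>I. carrier (V i). finite {i \<in> I. f i \<noteq> \<zero>\<^bsub>V i\<^esub>}},
     monoid.mult = undefined, one = undefined,
     zero = (\<lambda>i\<in>I. \<zero>\<^bsub>V i\<^esub>), add = (\<lambda>f g. \<lambda>i\<in>I. f i \<oplus>\<^bsub>V i\<^esub> g i),
     smult = (\<lambda>a f. \<lambda>i\<in>I. a \<odot>\<^bsub>V i\<^esub> f i)\<rparr>"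

definition free_space :: "'k ring \<Rightarrow> 'b set \<Rightarrow> ('k, 'b \<Rightarrow> 'k) module" where
  "free_space K B =
    \<lparr>carrier = {f. (\<forall>t. f t \<in> carrier K) \<and> {t. f t \<noteq> \<zero>\<^bsub>K\<^esub>} \<subseteq> B \<and> finite {t. f t \<noteq> \<zero>\<^bsub>K\<^esub>}},
     monoid.mult = undefined, one = undefined,
     zero = (\<lambda>t. \<zero>\<^bsub>K\<^esub>), add = (\<lambda>f g t. f t \<oplus>\<^bsub>K\<^esub> g t),
     smult = (\<lambda>a f t. a \<otimes>\<^bsub>K\<^esub> f t)\<rparr>"

definition basis_vec :: "'k ring \<Rightarrow> 'b \<Rightarrow> 'b \<Rightarrow> 'k" where
  "basis_vec K t = (\<lambda>t'. if t' = t then \<one>\<^bsub>K\<^esub> else \<zero>\<^bsub>K\<^esub>)"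

definition lin_ext :: "'k ring \<Rightarrow> ('k, 'v) module \<Rightarrow> ('b \<Rightarrow> 'v) \<Rightarrow> ('b \<Rightarrow> 'k) \<Rightarrow> 'v" where
  "lin_ext K V \<phi> f = (\<Oplus>\<^bsub>V\<^esub>t\<in>{t. f t \<noteq> \<zero>\<^bsub>K\<^esub>}. f t \<odot>\<^bsub>V\<^esub> \<phi> t)"

definition left_ideal :: "'a set \<Rightarrow> 'a ring \<Rightarrow> bool" where
  "left_ideal I R \<longleftrightarrow> additive_subgroup I R \<and> (\<forall>a\<in>carrier R. \<forall>x\<in>I. a \<otimes>\<^bsub>R\<^esub> x \<in> I)"

text \<open>The regular left module is semi-simple: each of its submodules has a complement.\<close>

definition semisimple_ring :: "'a ring \<Rightarrow> bool" where
  "semisimple_ring R \<longleftrightarrow> ring R \<and>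
    (\<forall>I. left_ideal I R \<longrightarrow>
      (\<exists>J. left_ideal J R \<and> I <+>\<^bsub>R\<^esub> J = carrier R \<and> I \<inter> J = {\<zero>\<^bsub>R\<^esub>}))"


section \<open>Linear categories\<close>

text \<open>\<open>Comp C x y z g f\<close> is the composite of \<open>f : x \<rightarrow> y\<close> and \<open>g : y \<rightarrow> z\<close>. Since composition is
  indexed by objects, Hom spaces with different end points may overlap. The objects form a set, so
  all categories are small.\<close>

record ('o, 'm, 'k) lin_category =
  Ob :: "'o set"
  Hom :: "'o \<Rightarrow> 'o \<Rightarrow> ('k, 'm) module"
  Comp :: "'o \<Rightarrow> 'o \<Rightarrow> 'o \<Rightarrow> 'm \<Rightarrow> 'm \<Rightarrow> 'm"
  Id :: "'o \<Rightarrow> 'm"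

locale linear_category = field K for K :: "'k ring" (structure) +
  fixes C :: "('o, 'm, 'k) lin_category"
  assumes Hom_space: "\<lbrakk>x \<in> Ob C; y \<in> Ob C\<rbrakk> \<Longrightarrow> vectorspace K (Hom C x y)"
    and Comp_linear_left:
      "\<lbrakk>x \<in> Ob C; y \<in> Ob C; z \<in> Ob C; f \<in> carrier (Hom C x y)\<rbrakk>
        \<Longrightarrow> (\<lambda>g. Comp C x y z g f) \<in> module_hom K (Hom C y z) (Hom C x z)"
    and Comp_linear_right:
      "\<lbrakk>x \<in> Ob C; y \<in> Ob C; z \<in> Ob C; g \<in> carrier (Hom C y z)\<rbrakk>
        \<Longrightarrow> (\<lambda>f. Comp C x y z g f) \<in> module_hom K (Hom C x y) (Hom C x z)"
    and Comp_assoc: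
      "\<lbrakk>w \<in> Ob C; x \<in> Ob C; y \<in> Ob C; z \<in> Ob C;
        f \<in> carrier (Hom C w x); g \<in> carrier (Hom C x y); h \<in> carrier (Hom C y z)\<rbrakk>
        \<Longrightarrow> Comp C w x z (Comp C x y z h g) f = Comp C w y z h (Comp C w x y g f)"
    and Id_closed: "x \<in> Ob C \<Longrightarrow> Id C x \<in> carrier (Hom C x x)"
    and Id_left:
      "\<lbrakk>x \<in> Ob C; y \<in> Ob C; f \<in> carrier (Hom C x y)\<rbrakk> \<Longrightarrow> Comp C x y y (Id C y) f = f"
    and Id_right:
      "\<lbrakk>x \<in> Ob C; y \<in> Ob C; f \<in> carrier (Hom C x y)\<rbrakk> \<Longrightarrow> Comp C x x y f (Id C x) = f"

definition iso_ob :: "('o, 'm, 'k) lin_category \<Rightarrow> 'o \<Rightarrow> 'o \<Rightarrow> bool" where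
  "iso_ob C x y \<longleftrightarrow> x \<in> Ob C \<and> y \<in> Ob C \<and>
    (\<exists>f\<in>carrier (Hom C x y). \<exists>g\<in>carrier (Hom C y x).
      Comp C x y x g f = Id C x \<and> Comp C y x y f g = Id C y)"

definition iso_class :: "('o, 'm, 'k) lin_category \<Rightarrow> 'o \<Rightarrow> 'o set" where
  "iso_class C x = {y. iso_ob C x y}"

definition iso_classes :: "('o, 'm, 'k) lin_category \<Rightarrow> 'o set set" where
  "iso_classes C = iso_class C ` Ob C"

definition end_ring :: "('o, 'm, 'k) lin_category \<Rightarrow> 'o \<Rightarrow> 'm ring" where
  "end_ring C x =
    \<lparr>carrier = carrier (Hom C x x), monoid.mult = Comp C x x x, one = Id C x,
     zero = \<zero>\<^bsub>Hom C x x\<^esub>, add = add (Hom C x x)\<rparr>"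

text \<open>A wide subcategory is given by its Hom spaces \<open>U x y\<close>, which are subspaces since
  subcategories of a linear category are understood to be linear.\<close>

definition wide_subcategory ::
    "'k ring \<Rightarrow> ('o, 'm, 'k) lin_category \<Rightarrow> ('o \<Rightarrow> 'o \<Rightarrow> 'm set) \<Rightarrow> bool" where
  "wide_subcategory K C U \<longleftrightarrow>
    (\<forall>x\<in>Ob C. \<forall>y\<in>Ob C. VectorSpace.subspace K (U x y) (Hom C x y)) \<and>
    (\<forall>x\<in>Ob C. Id C x \<in> U x x) \<and>
    (\<forall>x\<in>Ob C. \<forall>y\<in>Ob C. \<forall>z\<in>Ob C. \<forall>f\<in>U x y. \<forall>g\<in>U y z. Comp C x y z g f \<in> U x z)"

definition sub_cat ::
    "('o, 'm, 'k) lin_category \<Rightarrow> ('o \<Rightarrow> 'o \<Rightarrow> 'm set) \<Rightarrow> ('o, 'm, 'k) lin_category" where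
  "sub_cat C U = C\<lparr>Hom := (\<lambda>x y. (Hom C x y)\<lparr>carrier := U x y\<rparr>)\<rparr>"


section \<open>Modules over a linear category\<close>

text \<open>The same record is used for covariant and contravariant functors; \<open>Act N x y f\<close> is the
  action of \<open>f : x \<rightarrow> y\<close>. The restriction of a module to a wide subcategory is the same record,
  considered as a module over the subcategory.\<close>

record ('o, 'm, 'k, 'v) lin_functor =
  Val :: "'o \<Rightarrow> ('k, 'v) module"
  Act :: "'o \<Rightarrow> 'o \<Rightarrow> 'm \<Rightarrow> 'v \<Rightarrow> 'v"

locale cat_module = linear_category K C
  for K :: "'k ring" (structure) and C :: "('o, 'm, 'k) lin_category" +
  fixes N :: "('o, 'm, 'k, 'v) lin_functor"
  assumes Val_space: "x \<in> Ob C \<Longrightarrow> vectorspace K (Val N x)"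
    and Act_hom:
      "\<lbrakk>x \<in> Ob C; y \<in> Ob C; f \<in> carrier (Hom C x y)\<rbrakk>
        \<Longrightarrow> Act N x y f \<in> module_hom K (Val N x) (Val N y)"
    and Act_linear:
      "\<lbrakk>x \<in> Ob C; y \<in> Ob C; v \<in> carrier (Val N x)\<rbrakk>
        \<Longrightarrow> (\<lambda>f. Act N x y f v) \<in> module_hom K (Hom C x y) (Val N y)"
    and Act_Id: "\<lbrakk>x \<in> Ob C; v \<in> carrier (Val N x)\<rbrakk> \<Longrightarrow> Act N x x (Id C x) v = v"
    and Act_Comp:
      "\<lbrakk>x \<in> Ob C; y \<in> Ob C; z \<in> Ob C; f \<in> carrier (Hom C x y); g \<in> carrier (Hom C y z);
        v \<in> carrier (Val N x)\<rbrakk>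
        \<Longrightarrow> Act N x z (Comp C x y z g f) v = Act N y z g (Act N x y f v)"

definition cat_module_hom ::
    "'k ring \<Rightarrow> ('o, 'm, 'k) lin_category \<Rightarrow> ('o, 'm, 'k, 'v) lin_functor
      \<Rightarrow> ('o, 'm, 'k, 'w) lin_functor \<Rightarrow> ('o \<Rightarrow> 'v \<Rightarrow> 'w) \<Rightarrow> bool" where
  "cat_module_hom K C N N' \<phi> \<longleftrightarrow>
    (\<forall>x\<in>Ob C. \<phi> x \<in> module_hom K (Val N x) (Val N' x)) \<and>
    (\<forall>x\<in>Ob C. \<forall>y\<in>Ob C. \<forall>f\<in>carrier (Hom C x y). \<forall>v\<in>carrier (Val N x).
      \<phi> y (Act N x y f v) = Act N' x y f (\<phi> x v))"

definition cat_module_iso ::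
    "'k ring \<Rightarrow> ('o, 'm, 'k) lin_category \<Rightarrow> ('o, 'm, 'k, 'v) lin_functor
      \<Rightarrow> ('o, 'm, 'k, 'w) lin_functor \<Rightarrow> bool" where
  "cat_module_iso K C N N' \<longleftrightarrow>
    (\<exists>\<phi>. cat_module_hom K C N N' \<phi> \<and>
      (\<forall>x\<in>Ob C. bij_betw (\<phi> x) (carrier (Val N x)) (carrier (Val N' x))))"

text \<open>The last conjunct makes a submodule determined by its values on the objects, so that
  uniqueness of submodules can be expressed by equality.\<close>

definition cat_submodule ::
    "'k ring \<Rightarrow> ('o, 'm, 'k) lin_category \<Rightarrow> ('o, 'm, 'k, 'v) lin_functor
      \<Rightarrow> ('o \<Rightarrow> 'v set) \<Rightarrow> bool" where
  "cat_submodule K C N T \<longleftrightarrow>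
    (\<forall>x\<in>Ob C. VectorSpace.subspace K (T x) (Val N x)) \<and>
    (\<forall>x\<in>Ob C. \<forall>y\<in>Ob C. \<forall>f\<in>carrier (Hom C x y). \<forall>v\<in>T x. Act N x y f v \<in> T y) \<and>
    (\<forall>x. x \<notin> Ob C \<longrightarrow> T x = {})"

definition sub_module ::
    "('o, 'm, 'k, 'v) lin_functor \<Rightarrow> ('o \<Rightarrow> 'v set) \<Rightarrow> ('o, 'm, 'k, 'v) lin_functor" where
  "sub_module N T = N\<lparr>Val := (\<lambda>x. (Val N x)\<lparr>carrier := T x\<rparr>)\<rparr>"

definition quot_module ::
    "('o, 'm, 'k, 'v) lin_functor \<Rightarrow> ('o \<Rightarrow> 'v set) \<Rightarrow> ('o, 'm, 'k, 'v set) lin_functor" where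
  "quot_module N T =
    \<lparr>Val = (\<lambda>x. quot_space (Val N x) (T x)),
     Act = (\<lambda>x y f A. the_elem ((\<lambda>v. T y +>\<^bsub>Val N y\<^esub> Act N x y f v) ` A))\<rparr>"

definition simple_module ::
    "'k ring \<Rightarrow> ('o, 'm, 'k) lin_category \<Rightarrow> ('o, 'm, 'k, 'v) lin_functor \<Rightarrow> bool" where
  "simple_module K C N \<longleftrightarrow> cat_module K C N \<and>
    (\<exists>x\<in>Ob C. carrier (Val N x) \<noteq> {\<zero>\<^bsub>Val N x\<^esub>}) \<and>
    (\<forall>T. cat_submodule K C N T \<longrightarrow>
      (\<forall>x\<in>Ob C. T x = {\<zero>\<^bsub>Val N x\<^esub>}) \<or> (\<forall>x\<in>Ob C. T x = carrier (Val N x)))"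

definition is_quotient_of ::
    "'k ring \<Rightarrow> ('o, 'm, 'k) lin_category \<Rightarrow> ('o, 'm, 'k, 'v) lin_functor
      \<Rightarrow> ('o, 'm, 'k, 'w) lin_functor \<Rightarrow> bool" where
  "is_quotient_of K C Q N \<longleftrightarrow>
    (\<exists>T. cat_submodule K C N T \<and> cat_module_iso K C (quot_module N T) Q)"

definition is_subquotient_of ::
    "'k ring \<Rightarrow> ('o, 'm, 'k) lin_category \<Rightarrow> ('o, 'm, 'k, 'v) lin_functor
      \<Rightarrow> ('o, 'm, 'k, 'w) lin_functor \<Rightarrow> bool" where
  "is_subquotient_of K C Q N \<longleftrightarrow>
    (\<exists>T. cat_submodule K C N T \<and> is_quotient_of K C Q (sub_module N T))"

definition simple_constituent ::
    "'k ring \<Rightarrow> ('o, 'm, 'k) lin_category \<Rightarrow> ('o, 'm, 'k, 'v) lin_functor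
      \<Rightarrow> ('o, 'm, 'k, 'w) lin_functor \<Rightarrow> bool" where
  "simple_constituent K C S N \<longleftrightarrow> simple_module K C S \<and> is_subquotient_of K C S N"

definition generated_by ::
    "'k ring \<Rightarrow> ('o, 'm, 'k) lin_category \<Rightarrow> ('o, 'm, 'k, 'v) lin_functor
      \<Rightarrow> ('o \<Rightarrow> 'v set) \<Rightarrow> bool" where
  "generated_by K C N B \<longleftrightarrow>
    (\<forall>T. cat_submodule K C N T \<and> (\<forall>x\<in>Ob C. B x \<subseteq> T x) \<longrightarrow> (\<forall>x\<in>Ob C. T x = carrier (Val N x)))"

text \<open>The multiplicity of a simple module \<open>S\<close> in \<open>N\<close> is the supremum, over all finite filtrations
  of \<open>N\<close>, of the number of successive quotients isomorphic to \<open>S\<close>. If \<open>N\<close> is semi-simple, this is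
  the number of summands isomorphic to \<open>S\<close> in a decomposition of \<open>N\<close> into simple modules.\<close>

definition filtration ::
    "'k ring \<Rightarrow> ('o, 'm, 'k) lin_category \<Rightarrow> ('o, 'm, 'k, 'v) lin_functor
      \<Rightarrow> nat \<Rightarrow> (nat \<Rightarrow> 'o \<Rightarrow> 'v set) \<Rightarrow> bool" where
  "filtration K C N n F \<longleftrightarrow>
    (\<forall>i\<le>n. cat_submodule K C N (F i)) \<and>
    (\<forall>i<n. \<forall>x\<in>Ob C. F i x \<subseteq> F (Suc i) x) \<and>
    (\<forall>x\<in>Ob C. F 0 x = {\<zero>\<^bsub>Val N x\<^esub>}) \<and> (\<forall>x\<in>Ob C. F n x = carrier (Val N x))"

definition multiplicity_in ::
    "'k ring \<Rightarrow> ('o, 'm, 'k) lin_category \<Rightarrow> ('o, 'm, 'k, 'w) lin_functor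
      \<Rightarrow> ('o, 'm, 'k, 'v) lin_functor \<Rightarrow> enat" where
  "multiplicity_in K C S N =
    (SUP (n, F)\<in>{(n, F). filtration K C N n F}.
      enat (card {i. i < n \<and>
        cat_module_iso K C (quot_module (sub_module N (F (Suc i))) (F i)) S}))"


section \<open>Tensor products and the left adjoint of restriction\<close>

text \<open>The tensor product of a contravariant functor \<open>P\<close> and a covariant functor \<open>N\<close> on \<open>C\<close>: the
  quotient of the free vector space on the triples \<open>(x, p, n)\<close>, with \<open>p\<close> in \<open>P x\<close> and \<open>n\<close> in
  \<open>N x\<close>, which makes \<open>(p, n) \<mapsto> (x, p, n)\<close> bilinear and identifies \<open>(x, p f, n)\<close> with
  \<open>(y, p, f n)\<close> for \<open>f : x \<rightarrow> y\<close>. If \<open>C\<close> has a single object, this is the tensor product of a right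
  and a left module over its endomorphism ring.\<close>

definition tensor_gens ::
    "('o, 'm, 'k) lin_category \<Rightarrow> ('o, 'm, 'k, 'p) lin_functor \<Rightarrow> ('o, 'm, 'k, 'n) lin_functor
      \<Rightarrow> ('o \<times> 'p \<times> 'n) set" where
  "tensor_gens C P N = {(x, p, n). x \<in> Ob C \<and> p \<in> carrier (Val P x) \<and> n \<in> carrier (Val N x)}"

abbreviation tensor_free where
  "tensor_free K C P N \<equiv> free_space K (tensor_gens C P N)"

definition tensor_rels ::
    "'k ring \<Rightarrow> ('o, 'm, 'k) lin_category \<Rightarrow> ('o, 'm, 'k, 'p) lin_functor
      \<Rightarrow> ('o, 'm, 'k, 'n) lin_functor \<Rightarrow> ('o \<times> 'p \<times> 'n \<Rightarrow> 'k) set" where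
  "tensor_rels K C P N =
    (let F = tensor_free K C P N; e = basis_vec K in
      {e (x, p \<oplus>\<^bsub>Val P x\<^esub> p', n) \<ominus>\<^bsub>F\<^esub> (e (x, p, n) \<oplus>\<^bsub>F\<^esub> e (x, p', n)) | x p p' n.
        x \<in> Ob C \<and> p \<in> carrier (Val P x) \<and> p' \<in> carrier (Val P x) \<and> n \<in> carrier (Val N x)} \<union>
      {e (x, p, n \<oplus>\<^bsub>Val N x\<^esub> n') \<ominus>\<^bsub>F\<^esub> (e (x, p, n) \<oplus>\<^bsub>F\<^esub> e (x, p, n')) | x p n n'.
        x \<in> Ob C \<and> p \<in> carrier (Val P x) \<and> n \<in> carrier (Val N x) \<and> n' \<in> carrier (Val N x)} \<union>
      {e (x, a \<odot>\<^bsub>Val P x\<^esub> p, n) \<ominus>\<^bsub>F\<^esub> a \<odot>\<^bsub>F\<^esub> e (x, p, n) | x a p n.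
        x \<in> Ob C \<and> a \<in> carrier K \<and> p \<in> carrier (Val P x) \<and> n \<in> carrier (Val N x)} \<union>
      {e (x, p, a \<odot>\<^bsub>Val N x\<^esub> n) \<ominus>\<^bsub>F\<^esub> a \<odot>\<^bsub>F\<^esub> e (x, p, n) | x a p n.
        x \<in> Ob C \<and> a \<in> carrier K \<and> p \<in> carrier (Val P x) \<and> n \<in> carrier (Val N x)} \<union>
      {e (x, Act P x y f p, n) \<ominus>\<^bsub>F\<^esub> e (y, p, Act N x y f n) | x y f p n.
        x \<in> Ob C \<and> y \<in> Ob C \<and> f \<in> carrier (Hom C x y) \<and>
        p \<in> carrier (Val P y) \<and> n \<in> carrier (Val N x)})"

definition tensor_null ::
    "'k ring \<Rightarrow> ('o, 'm, 'k) lin_category \<Rightarrow> ('o, 'm, 'k, 'p) lin_functor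
      \<Rightarrow> ('o, 'm, 'k, 'n) lin_functor \<Rightarrow> ('o \<times> 'p \<times> 'n \<Rightarrow> 'k) set" where
  "tensor_null K C P N = module.span K (tensor_free K C P N) (tensor_rels K C P N)"

definition tensor ::
    "'k ring \<Rightarrow> ('o, 'm, 'k) lin_category \<Rightarrow> ('o, 'm, 'k, 'p) lin_functor
      \<Rightarrow> ('o, 'm, 'k, 'n) lin_functor \<Rightarrow> ('k, ('o \<times> 'p \<times> 'n \<Rightarrow> 'k) set) module" where
  "tensor K C P N = quot_space (tensor_free K C P N) (tensor_null K C P N)"

definition pure_tensor ::
    "'k ring \<Rightarrow> ('o, 'm, 'k) lin_category \<Rightarrow> ('o, 'm, 'k, 'p) lin_functor
      \<Rightarrow> ('o, 'm, 'k, 'n) lin_functor \<Rightarrow> 'o \<times> 'p \<times> 'n \<Rightarrow> ('o \<times> 'p \<times> 'n \<Rightarrow> 'k) set" where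
  "pure_tensor K C P N t = tensor_null K C P N +>\<^bsub>tensor_free K C P N\<^esub> basis_vec K t"

text \<open>The linear map out of a tensor product given by a balanced map \<open>\<phi>\<close> on pure tensors.\<close>

definition tensor_lift ::
    "'k ring \<Rightarrow> ('k, 'v) module \<Rightarrow> ('o \<times> 'p \<times> 'n \<Rightarrow> 'v) \<Rightarrow> ('o \<times> 'p \<times> 'n \<Rightarrow> 'k) set \<Rightarrow> 'v" where
  "tensor_lift K V \<phi> A = the_elem (lin_ext K V \<phi> ` A)"

definition hom_from :: "('o, 'm, 'k) lin_category \<Rightarrow> 'o \<Rightarrow> ('o, 'm, 'k, 'm) lin_functor" where
  "hom_from C x = \<lparr>Val = Hom C x, Act = Comp C x\<rparr>"

definition hom_to :: "('o, 'm, 'k) lin_category \<Rightarrow> 'o \<Rightarrow> ('o, 'm, 'k, 'm) lin_functor" where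
  "hom_to C z = \<lparr>Val = (\<lambda>y. Hom C y z), Act = (\<lambda>x y f g. Comp C x y z g f)\<rparr>"

text \<open>The left adjoint \<open>j\<^sub>!\<close> of restriction along the inclusion \<open>j\<close> of a wide subcategory \<open>D\<close> into
  \<open>G\<close>, constructed as usual: the value at \<open>y\<close> is the tensor product over \<open>D\<close> of \<open>Hom\<^sub>G(-, y)\<close>
  and \<open>N\<close>. The adjunction is proved in \<open>induced_universal\<close> below.\<close>

definition induced_module ::
    "'k ring \<Rightarrow> ('o, 'm, 'k) lin_category \<Rightarrow> ('o \<Rightarrow> 'o \<Rightarrow> 'm set) \<Rightarrow> ('o, 'm, 'k, 'n) lin_functor
      \<Rightarrow> ('o, 'm, 'k, ('o \<times> 'm \<times> 'n \<Rightarrow> 'k) set) lin_functor" where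
  "induced_module K G D N =
    \<lparr>Val = (\<lambda>y. tensor K (sub_cat G D) (hom_to G y) N),
     Act = (\<lambda>y z h. tensor_lift K (tensor K (sub_cat G D) (hom_to G z) N)
       (\<lambda>(x, g, n). pure_tensor K (sub_cat G D) (hom_to G z) N (x, Comp G x y z h g, n)))\<rparr>"


section \<open>Triangular categories\<close>

definition admissible_order ::
    "('o, 'm, 'k) lin_category \<Rightarrow> ('o \<Rightarrow> 'o \<Rightarrow> 'm set) \<Rightarrow> ('o \<Rightarrow> 'o \<Rightarrow> 'm set) \<Rightarrow> 'o set rel \<Rightarrow> bool"
  where
  "admissible_order G U D r \<longleftrightarrow>
    partial_order_on (iso_classes G) r \<and>
    (\<forall>Z\<in>iso_classes G. finite {Y. (Y, Z) \<in> r}) \<and>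
    (\<forall>x\<in>Ob G. \<forall>y\<in>Ob G. (\<exists>f\<in>U x y. f \<noteq> \<zero>\<^bsub>Hom G x y\<^esub>) \<longrightarrow> (iso_class G x, iso_class G y) \<in> r) \<and>
    (\<forall>x\<in>Ob G. \<forall>y\<in>Ob G. (\<exists>f\<in>D x y. f \<noteq> \<zero>\<^bsub>Hom G x y\<^esub>) \<longrightarrow> (iso_class G y, iso_class G x) \<in> r)"

definition class_rep :: "'o set \<Rightarrow> 'o" where
  "class_rep Y = (SOME x. x \<in> Y)"

definition mid_cat ::
    "('o, 'm, 'k) lin_category \<Rightarrow> ('o \<Rightarrow> 'o \<Rightarrow> 'm set) \<Rightarrow> ('o \<Rightarrow> 'o \<Rightarrow> 'm set)
      \<Rightarrow> ('o, 'm, 'k) lin_category" where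
  "mid_cat G U D = sub_cat G (\<lambda>x y. U x y \<inter> D x y)"

text \<open>\<open>Hom\<^sub>U(y, z) \<otimes> Hom\<^sub>D(x, y)\<close> over \<open>End\<^sub>U(y)\<close>, i.e. over the full subcategory of \<open>U\<close> on \<open>y\<close>.\<close>

definition middle_tensor ::
    "'k ring \<Rightarrow> ('o, 'm, 'k) lin_category \<Rightarrow> ('o \<Rightarrow> 'o \<Rightarrow> 'm set) \<Rightarrow> ('o \<Rightarrow> 'o \<Rightarrow> 'm set)
      \<Rightarrow> 'o \<Rightarrow> 'o \<Rightarrow> 'o \<Rightarrow> ('k, ('o \<times> 'm \<times> 'm \<Rightarrow> 'k) set) module" where
  "middle_tensor K G U D x y z =
    tensor K ((sub_cat G U)\<lparr>Ob := {y}\<rparr>) (hom_to (sub_cat G U) z) (hom_from (sub_cat G D) x)"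

definition triangular_sum ::
    "'k ring \<Rightarrow> ('o, 'm, 'k) lin_category \<Rightarrow> ('o \<Rightarrow> 'o \<Rightarrow> 'm set) \<Rightarrow> ('o \<Rightarrow> 'o \<Rightarrow> 'm set)
      \<Rightarrow> 'o \<Rightarrow> 'o \<Rightarrow> ('k, 'o set \<Rightarrow> ('o \<times> 'm \<times> 'm \<Rightarrow> 'k) set) module" where
  "triangular_sum K G U D x z =
    direct_sum_space K (iso_classes G) (\<lambda>Y. middle_tensor K G U D x (class_rep Y) z)"

definition triangular_map ::
    "'k ring \<Rightarrow> ('o, 'm, 'k) lin_category \<Rightarrow> ('o \<Rightarrow> 'o \<Rightarrow> 'm set) \<Rightarrow> ('o \<Rightarrow> 'o \<Rightarrow> 'm set)
      \<Rightarrow> 'o \<Rightarrow> 'o \<Rightarrow> ('o set \<Rightarrow> ('o \<times> 'm \<times> 'm \<Rightarrow> 'k) set) \<Rightarrow> 'm" where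
  "triangular_map K G U D x z \<theta> =
    (\<Oplus>\<^bsub>Hom G x z\<^esub>Y\<in>{Y \<in> iso_classes G. \<theta> Y \<noteq> \<zero>\<^bsub>middle_tensor K G U D x (class_rep Y) z\<^esub>}.
      tensor_lift K (Hom G x z) (\<lambda>(y, u, d). Comp G x y z u d) (\<theta> Y))"

text \<open>The assumption \<open>iso_mid\<close> makes explicit the convention that \<open>G\<close>, \<open>U\<close>, \<open>D\<close> and \<open>U \<inter> D\<close>
  have the same isomorphism classes of objects (the converse implication is clear). It makes the
  direct sum in \<open>T3\<close> independent of the representatives \<open>class_rep\<close>, and allows simple modules over
  \<open>U \<inter> D\<close> to be extended by zero to \<open>D\<close>. It does not follow from the other axioms: given \<open>x \<noteq> y\<close>
  isomorphic in \<open>U \<inter> D\<close>, replace \<open>U(a, x)\<close> by \<open>s U(a, x)\<close> and \<open>U(x, b)\<close> by \<open>U(x, b) s\<inverse>\<close>, where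
  the automorphism \<open>s\<close> of \<open>x\<close> centralizes \<open>End\<^sub>U(x)\<close> and \<open>s - 1\<close> is non-zero and factors through
  smaller objects; then \<open>x\<close> and \<open>y\<close> are no longer isomorphic in \<open>U \<inter> D\<close>.\<close>

locale triangular_category = linear_category K G
  for K :: "'k ring" (structure) and G :: "('o, 'm, 'k) lin_category" +
  fixes U D :: "'o \<Rightarrow> 'o \<Rightarrow> 'm set"
  assumes wide_U: "wide_subcategory K G U"
    and wide_D: "wide_subcategory K G D"
    and iso_mid: "iso_ob G x y \<Longrightarrow> iso_ob (mid_cat G U D) x y"
    and T0: "\<lbrakk>x \<in> Ob G; y \<in> Ob G\<rbrakk> \<Longrightarrow> vectorspace.fin_dim K (Hom G x y)"
    and T1: "x \<in> Ob G \<Longrightarrow> U x x = D x x \<and> semisimple_ring (end_ring (sub_cat G U) x)"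
    and T2: "\<exists>r. admissible_order G U D r"
    and T3: "\<lbrakk>x \<in> Ob G; z \<in> Ob G\<rbrakk> \<Longrightarrow>
      triangular_map K G U D x z \<in> module_hom K (triangular_sum K G U D x z) (Hom G x z) \<and>
      bij_betw (triangular_map K G U D x z)
        (carrier (triangular_sum K G U D x z)) (carrier (Hom G x z))"


section \<open>Weights, standard modules and lowest weight modules\<close>

text \<open>A weight is an isomorphism class of simple modules over \<open>U \<inter> D\<close>. To have a set of weights, the
  vectors of these modules are taken from the type \<^typ>\<open>'m set\<close>; by \<open>simple_module_universe\<close> below,
  this type is large enough for all simple modules.\<close>

type_synonym ('o, 'm, 'k) weight = "('o, 'm, 'k, 'm set) lin_functor set"

definition weights ::
    "'k ring \<Rightarrow> ('o, 'm, 'k) lin_category \<Rightarrow> ('o \<Rightarrow> 'o \<Rightarrow> 'm set) \<Rightarrow> ('o \<Rightarrow> 'o \<Rightarrow> 'm set)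
      \<Rightarrow> ('o, 'm, 'k) weight set" where
  "weights K G U D =
    (let M = mid_cat G U D; A = {S. simple_module K M S}
     in A // {(S, S'). S \<in> A \<and> S' \<in> A \<and> cat_module_iso K M S S'})"

definition weight_rep :: "('o, 'm, 'k) weight \<Rightarrow> ('o, 'm, 'k, 'm set) lin_functor" where
  "weight_rep l = (SOME S. S \<in> l)"

definition supp :: "('o, 'm, 'k) lin_category \<Rightarrow> ('o, 'm, 'k) weight \<Rightarrow> 'o set" where
  "supp G l = (THE Y. Y \<in> iso_classes G \<and>
    (\<exists>x\<in>Y. carrier (Val (weight_rep l) x) \<noteq> {\<zero>\<^bsub>Val (weight_rep l) x\<^esub>}))"

definition weight_less ::
    "('o, 'm, 'k) lin_category \<Rightarrow> 'o set rel \<Rightarrow> ('o, 'm, 'k) weight \<Rightarrow> ('o, 'm, 'k) weight \<Rightarrow> bool"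
  where "weight_less G r l m \<longleftrightarrow> (supp G l, supp G m) \<in> r \<and> supp G l \<noteq> supp G m"

definition weight_le ::
    "('o, 'm, 'k) lin_category \<Rightarrow> 'o set rel \<Rightarrow> ('o, 'm, 'k) weight \<Rightarrow> ('o, 'm, 'k) weight \<Rightarrow> bool"
  where "weight_le G r l m \<longleftrightarrow> l = m \<or> weight_less G r l m"

definition weight_mult ::
    "'k ring \<Rightarrow> ('o, 'm, 'k) lin_category \<Rightarrow> ('o \<Rightarrow> 'o \<Rightarrow> 'm set) \<Rightarrow> ('o \<Rightarrow> 'o \<Rightarrow> 'm set)
      \<Rightarrow> ('o, 'm, 'k) weight \<Rightarrow> ('o, 'm, 'k, 'v) lin_functor \<Rightarrow> enat" where
  "weight_mult K G U D l N = multiplicity_in K (mid_cat G U D) (weight_rep l) N"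

definition extend_by_zero ::
    "('o, 'm, 'k) lin_category \<Rightarrow> ('o, 'm, 'k, 'v) lin_functor \<Rightarrow> ('o, 'm, 'k, 'v) lin_functor"
  where
  "extend_by_zero G S =
    S\<lparr>Act := (\<lambda>x y f v. if iso_ob G x y then Act S x y f v else \<zero>\<^bsub>Val S y\<^esub>)\<rparr>"

definition standard_module ::
    "'k ring \<Rightarrow> ('o, 'm, 'k) lin_category \<Rightarrow> ('o \<Rightarrow> 'o \<Rightarrow> 'm set) \<Rightarrow> ('o, 'm, 'k) weight
      \<Rightarrow> ('o, 'm, 'k, ('o \<times> 'm \<times> 'm set \<Rightarrow> 'k) set) lin_functor" where
  "standard_module K G D l = induced_module K G D (extend_by_zero G (weight_rep l))"

definition weight_copy ::
    "'k ring \<Rightarrow> ('o, 'm, 'k) lin_category \<Rightarrow> ('o \<Rightarrow> 'o \<Rightarrow> 'm set) \<Rightarrow> ('o \<Rightarrow> 'o \<Rightarrow> 'm set)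
      \<Rightarrow> ('o, 'm, 'k) weight \<Rightarrow> ('o, 'm, 'k, 'v) lin_functor \<Rightarrow> ('o \<Rightarrow> 'v set) \<Rightarrow> bool" where
  "weight_copy K G U D l N T \<longleftrightarrow> cat_submodule K (mid_cat G U D) N T \<and>
    cat_module_iso K (mid_cat G U D) (sub_module N T) (weight_rep l)"

definition lowest_weight_module ::
    "'k ring \<Rightarrow> ('o, 'm, 'k) lin_category \<Rightarrow> ('o \<Rightarrow> 'o \<Rightarrow> 'm set) \<Rightarrow> ('o \<Rightarrow> 'o \<Rightarrow> 'm set)
      \<Rightarrow> 'o set rel \<Rightarrow> ('o, 'm, 'k) weight \<Rightarrow> ('o, 'm, 'k, 'v) lin_functor \<Rightarrow> bool" where
  "lowest_weight_module K G U D r l N \<longleftrightarrow>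
    cat_module K G N \<and>
    weight_mult K G U D l N = 1 \<and>
    (\<exists>T. {T'. weight_copy K G U D l N T'} = {T} \<and> generated_by K G N T) \<and>
    (\<forall>m\<in>weights K G U D. weight_mult K G U D m N \<noteq> 0 \<longrightarrow> weight_le G r l m)"

text \<open>The quotients of the standard module are indexed by its submodules.\<close>

definition simple_quotient_kernel ::
    "'k ring \<Rightarrow> ('o, 'm, 'k) lin_category \<Rightarrow> ('o, 'm, 'k, 'v) lin_functor
      \<Rightarrow> ('o \<Rightarrow> 'v set) \<Rightarrow> bool" where
  "simple_quotient_kernel K C N T \<longleftrightarrow>
    cat_submodule K C N T \<and> simple_module K C (quot_module N T)"

definition simple_head ::
    "'k ring \<Rightarrow> ('o, 'm, 'k) lin_category \<Rightarrow> ('o \<Rightarrow> 'o \<Rightarrow> 'm set) \<Rightarrow> ('o, 'm, 'k) weight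
      \<Rightarrow> ('o, 'm, 'k, ('o \<times> 'm \<times> 'm set \<Rightarrow> 'k) set set) lin_functor" where
  "simple_head K G D l = quot_module (standard_module K G D l)
    (THE T. simple_quotient_kernel K G (standard_module K G D l) T)"


section \<open>Properties of the constructions\<close>

text \<open>The two facts that justify the definitions above are \<open>induced_universal\<close>, which shows that
  \<^const>\<open>induced_module\<close> is left adjoint to restriction, and \<open>simple_module_universe\<close>, which shows
  that every simple module is isomorphic to one with vectors in \<^typ>\<open>'m set\<close>.\<close>

subsection \<open>Quotients and free vector spaces\<close>

lemma vs_module: "vectorspace K V \<Longrightarrow> Module.module K V"
  by (simp add: vectorspace_def)

lemma vs_field: "vectorspace K V \<Longrightarrow> field K"
  by (simp add: vectorspace_def)

lemma subspace_add_subgroup: 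
  assumes "VectorSpace.subspace K W V" shows "abelian_subgroup W V"
proof -
  interpret V: vectorspace K V using assms by (simp add: VectorSpace.subspace_def)
  have s: "LinearCombinations.submodule K W V" using assms by (simp add: VectorSpace.subspace_def)
  interpret W: LinearCombinations.submodule K W V by (rule s)
  have ag: "abelian_group V" ..
  have neg: "\<ominus>\<^bsub>V\<^esub> x \<in> W" if "x \<in> W" for x
  proof -
    have "(\<ominus>\<^bsub>K\<^esub> \<one>\<^bsub>K\<^esub>) \<odot>\<^bsub>V\<^esub> x \<in> W" using that W.smult_closed by simp
    moreover have "x \<in> carrier V" using that W.subset by blast
    ultimately show ?thesis by (simp add: V.smult_minus_1)
  qed
  have "subgroup W (add_monoid V)"
    apply (rule group.subgroupI)
    using V.add.is_group apply simp
    using W.subset apply simp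
    using W.zero_closed apply blast
    using neg apply (simp add: a_inv_def)
    using W.m_closed apply simp
    done
  then show ?thesis
    using ag by (simp add: abelian_subgroupI3 additive_subgroup.intro)
qed

lemma quot_space_smult:
  assumes "VectorSpace.subspace K W V" "a \<in> carrier K" "v \<in> carrier V"
  shows "a \<odot>\<^bsub>quot_space V W\<^esub> (W +>\<^bsub>V\<^esub> v) = W +>\<^bsub>V\<^esub> (a \<odot>\<^bsub>V\<^esub> v)"
proof -
  interpret V: vectorspace K V using assms by (simp add: VectorSpace.subspace_def)
  interpret W: LinearCombinations.submodule K W V using assms by (simp add: VectorSpace.subspace_def)
  interpret A: abelian_subgroup W V using assms subspace_add_subgroup by blast
  have "the_elem ((\<lambda>v. W +>\<^bsub>V\<^esub> (a \<odot>\<^bsub>V\<^esub> v)) ` (W +>\<^bsub>V\<^esub> v)) = W +>\<^bsub>V\<^esub> (a \<odot>\<^bsub>V\<^esub> v)"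
  proof (rule the_elem_image_unique)
    show "W +>\<^bsub>V\<^esub> v \<noteq> {}" using A.a_rcos_self assms by blast
    fix u assume "u \<in> W +>\<^bsub>V\<^esub> v"
    then obtain w where w: "w \<in> W" "u = w \<oplus>\<^bsub>V\<^esub> v" by (auto simp: a_r_coset_def')
    then have "a \<odot>\<^bsub>V\<^esub> u = (a \<odot>\<^bsub>V\<^esub> w) \<oplus>\<^bsub>V\<^esub> (a \<odot>\<^bsub>V\<^esub> v)"
      using assms W.subset V.smult_r_distr by auto
    then have "a \<odot>\<^bsub>V\<^esub> u \<in> W +>\<^bsub>V\<^esub> (a \<odot>\<^bsub>V\<^esub> v)"
      using w assms W.smult_closed by (auto simp: a_r_coset_def')
    then show "W +>\<^bsub>V\<^esub> (a \<odot>\<^bsub>V\<^esub> u) = W +>\<^bsub>V\<^esub> (a \<odot>\<^bsub>V\<^esub> v)"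
      using V.a_repr_independence A.a_subgroup assms by (metis V.smult_closed)
  qed
  then show ?thesis by (simp add: quot_space_def)
qed

lemma quot_space_add:
  assumes "VectorSpace.subspace K W V" "u \<in> carrier V" "v \<in> carrier V"
  shows "(W +>\<^bsub>V\<^esub> u) \<oplus>\<^bsub>quot_space V W\<^esub> (W +>\<^bsub>V\<^esub> v) = W +>\<^bsub>V\<^esub> (u \<oplus>\<^bsub>V\<^esub> v)"
proof -
  interpret A: abelian_subgroup W V using assms subspace_add_subgroup by blast
  show ?thesis using A.a_rcos_sum assms by (simp add: quot_space_def)
qed

lemma quot_space_carrier: "carrier (quot_space V W) = (\<lambda>v. W +>\<^bsub>V\<^esub> v) ` carrier V"
  by (auto simp: quot_space_def A_RCOSETS_def')

lemma quot_space_zero: 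
  assumes "VectorSpace.subspace K W V"
  shows "\<zero>\<^bsub>quot_space V W\<^esub> = W +>\<^bsub>V\<^esub> \<zero>\<^bsub>V\<^esub>"
proof -
  interpret A: abelian_subgroup W V using assms subspace_add_subgroup by blast
  show ?thesis by (simp add: quot_space_def A.a_subset)
qed

lemma coset_eq_iff:
  assumes "VectorSpace.subspace K W V" "u \<in> carrier V" "v \<in> carrier V"
  shows "W +>\<^bsub>V\<^esub> u = W +>\<^bsub>V\<^esub> v \<longleftrightarrow> u \<ominus>\<^bsub>V\<^esub> v \<in> W"
proof -
  interpret V: vectorspace K V using assms by (simp add: VectorSpace.subspace_def)
  interpret A: abelian_subgroup W V using assms subspace_add_subgroup by blast
  show ?thesis
    by (metis A.a_rcos_self A.a_rcos_module V.a_repr_independence A.a_subgroup assms(2,3) a_minus_def A.is_additive_subgroup A.a_rcos_module_rev A.a_rcos_module_imp)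
qed

lemma vectorspace_surj:
  assumes V: "vectorspace K V"
    and c: "carrier Q = p ` carrier V"
    and a: "\<And>u v. \<lbrakk>u \<in> carrier V; v \<in> carrier V\<rbrakk> \<Longrightarrow> p u \<oplus>\<^bsub>Q\<^esub> p v = p (u \<oplus>\<^bsub>V\<^esub> v)"
    and s: "\<And>b v. \<lbrakk>b \<in> carrier K; v \<in> carrier V\<rbrakk> \<Longrightarrow> b \<odot>\<^bsub>Q\<^esub> p v = p (b \<odot>\<^bsub>V\<^esub> v)"
    and z: "\<zero>\<^bsub>Q\<^esub> = p \<zero>\<^bsub>V\<^esub>"
  shows "vectorspace K Q"
proof -
  interpret V: vectorspace K V by (rule V)
  have "abelian_group Q"
  proof (rule abelian_groupI)
    fix x y z' assume "x \<in> carrier Q" "y \<in> carrier Q" "z' \<in> carrier Q"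
    then show "x \<oplus>\<^bsub>Q\<^esub> y \<oplus>\<^bsub>Q\<^esub> z' = x \<oplus>\<^bsub>Q\<^esub> (y \<oplus>\<^bsub>Q\<^esub> z')"
      by (auto simp: c a V.add.m_assoc)
  next
    fix x y assume "x \<in> carrier Q" "y \<in> carrier Q"
    then show "x \<oplus>\<^bsub>Q\<^esub> y = y \<oplus>\<^bsub>Q\<^esub> x" by (auto simp: c a V.add.m_comm)
  next
    fix x assume "x \<in> carrier Q"
    then obtain v where v: "v \<in> carrier V" "x = p v" by (auto simp: c)
    have "p (\<ominus>\<^bsub>V\<^esub> v) \<oplus>\<^bsub>Q\<^esub> x = \<zero>\<^bsub>Q\<^esub>" by (simp add: v a z V.l_neg)
    then show "\<exists>y\<in>carrier Q. y \<oplus>\<^bsub>Q\<^esub> x = \<zero>\<^bsub>Q\<^esub>" using v c by blast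
  qed (auto simp: c a z)
  moreover have "module_axioms K Q"
    by (auto simp: module_axioms_def c a s V.smult_l_distr V.smult_r_distr V.smult_assoc1)
  ultimately show ?thesis
    by (simp add: vectorspace_def Module.module_def V.R.is_cring V.field.field_axioms)
qed

lemma quot_space_vectorspace:
  assumes "VectorSpace.subspace K W V"
  shows "vectorspace K (quot_space V W)"
proof (rule vectorspace_surj[where V = V and p = "\<lambda>v. W +>\<^bsub>V\<^esub> v"])
  show "vectorspace K V" using assms by (simp add: VectorSpace.subspace_def)
qed (use assms in \<open>auto simp: quot_space_carrier quot_space_add quot_space_smult quot_space_zero\<close>)

lemma free_space_vectorspace:
  assumes "field K" shows "vectorspace K (free_space K B)"
proof -
  interpret field K by (rule assms)
  let ?F = "free_space K B"
  have add: "(\<lambda>t. f t \<oplus>\<^bsub>K\<^esub> g t) \<in> carrier ?F" if "f \<in> carrier ?F" "g \<in> carrier ?F" for f g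
  proof -
    have "{t. f t \<oplus>\<^bsub>K\<^esub> g t \<noteq> \<zero>\<^bsub>K\<^esub>} \<subseteq> {t. f t \<noteq> \<zero>\<^bsub>K\<^esub>} \<union> {t. g t \<noteq> \<zero>\<^bsub>K\<^esub>}" by auto
    moreover have "finite ({t. f t \<noteq> \<zero>\<^bsub>K\<^esub>} \<union> {t. g t \<noteq> \<zero>\<^bsub>K\<^esub>})"
      "{t. f t \<noteq> \<zero>\<^bsub>K\<^esub>} \<union> {t. g t \<noteq> \<zero>\<^bsub>K\<^esub>} \<subseteq> B" "\<forall>t. f t \<oplus>\<^bsub>K\<^esub> g t \<in> carrier K"
      using that by (auto simp: free_space_def)
    ultimately have "finite {t. f t \<oplus>\<^bsub>K\<^esub> g t \<noteq> \<zero>\<^bsub>K\<^esub>}" "{t. f t \<oplus>\<^bsub>K\<^esub> g t \<noteq> \<zero>\<^bsub>K\<^esub>} \<subseteq> B"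
      "\<forall>t. f t \<oplus>\<^bsub>K\<^esub> g t \<in> carrier K"
      using finite_subset by blast+
    then show ?thesis by (simp add: free_space_def)
  qed
  have sm: "(\<lambda>t. a \<otimes>\<^bsub>K\<^esub> f t) \<in> carrier ?F" if "a \<in> carrier K" "f \<in> carrier ?F" for a f
  proof -
    have "{t. a \<otimes>\<^bsub>K\<^esub> f t \<noteq> \<zero>\<^bsub>K\<^esub>} \<subseteq> {t. f t \<noteq> \<zero>\<^bsub>K\<^esub>}" using that by auto
    moreover have "finite {t. f t \<noteq> \<zero>\<^bsub>K\<^esub>}"
      "{t. f t \<noteq> \<zero>\<^bsub>K\<^esub>} \<subseteq> B" "\<forall>t. a \<otimes>\<^bsub>K\<^esub> f t \<in> carrier K"
      using that by (auto simp: free_space_def)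
    ultimately show ?thesis
      by (simp add: free_space_def) (meson finite_subset order_trans)
  qed
  have cl: "f t \<in> carrier K" if "f \<in> carrier ?F" for f t using that by (auto simp: free_space_def)
  have "abelian_group ?F"
  proof (rule abelian_groupI)
    fix x assume x: "x \<in> carrier ?F"
    have "(\<lambda>t. (\<ominus>\<^bsub>K\<^esub> \<one>\<^bsub>K\<^esub>) \<otimes>\<^bsub>K\<^esub> x t) \<in> carrier ?F" using x sm by simp
    moreover have "(\<lambda>t. (\<ominus>\<^bsub>K\<^esub> \<one>\<^bsub>K\<^esub>) \<otimes>\<^bsub>K\<^esub> x t) \<oplus>\<^bsub>?F\<^esub> x = \<zero>\<^bsub>?F\<^esub>"
      using cl[OF x] by (auto simp: free_space_def l_minus l_neg)
    ultimately show "\<exists>y\<in>carrier ?F. y \<oplus>\<^bsub>?F\<^esub> x = \<zero>\<^bsub>?F\<^esub>" by blast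
  next
    fix x y assume "x \<in> carrier ?F" "y \<in> carrier ?F"
    then show "x \<oplus>\<^bsub>?F\<^esub> y \<in> carrier ?F" using add by (simp add: free_space_def)
  next
    fix x y assume "x \<in> carrier ?F" "y \<in> carrier ?F"
    then show "x \<oplus>\<^bsub>?F\<^esub> y = y \<oplus>\<^bsub>?F\<^esub> x" by (auto simp: free_space_def a_comm)
  qed (auto simp: free_space_def a_assoc)
  moreover have "module_axioms K ?F"
    unfolding module_axioms_def using sm
    by (auto simp: free_space_def l_distr r_distr m_assoc)
  ultimately show ?thesis
    by (simp add: vectorspace_def Module.module_def is_cring assms)
qed

lemma basis_vec_closed:
  assumes "field K" "t \<in> B" shows "basis_vec K t \<in> carrier (free_space K B)"
proof -
  interpret field K by fact
  show ?thesis using assms(2) by (auto simp: basis_vec_def free_space_def)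
qed

lemma lin_ext_superset:
  assumes V: "vectorspace K V" and f: "f \<in> carrier (free_space K B)" and \<phi>: "\<phi> \<in> B \<rightarrow> carrier V"
    and A: "finite A" "{t. f t \<noteq> \<zero>\<^bsub>K\<^esub>} \<subseteq> A" "A \<subseteq> B"
  shows "lin_ext K V \<phi> f = (\<Oplus>\<^bsub>V\<^esub>t\<in>A. f t \<odot>\<^bsub>V\<^esub> \<phi> t)"
proof -
  interpret V: vectorspace K V by fact
  have cl: "f t \<in> carrier K" for t using f by (auto simp: free_space_def)
  show ?thesis unfolding lin_ext_def
    apply (rule V.add.finprod_mono_neutral_cong_left)
    using A cl \<phi> by (auto simp: Pi_iff subset_iff)
qed

lemma lin_ext_hom:
  assumes V: "vectorspace K V" and \<phi>: "\<phi> \<in> B \<rightarrow> carrier V"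
  shows "lin_ext K V \<phi> \<in> module_hom K (free_space K B) V"
proof -
  interpret V: vectorspace K V by fact
  let ?F = "free_space K B"
  interpret F: vectorspace K ?F by (rule free_space_vectorspace) (rule V.field.field_axioms)
  have cl: "f t \<in> carrier K" if "f \<in> carrier ?F" for f t using that by (auto simp: free_space_def)
  have fin: "finite {t. f t \<noteq> \<zero>\<^bsub>K\<^esub>}" "{t. f t \<noteq> \<zero>\<^bsub>K\<^esub>} \<subseteq> B" if "f \<in> carrier ?F" for f
    using that by (auto simp: free_space_def)
  have closed: "lin_ext K V \<phi> f \<in> carrier V" if "f \<in> carrier ?F" for f
    unfolding lin_ext_def using cl[OF that] fin[OF that] \<phi>
    by (intro V.finsum_closed) (auto simp: Pi_iff)
  show ?thesis unfolding module_hom_def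
  proof (safe)
    fix f assume "f \<in> carrier ?F" then show "lin_ext K V \<phi> f \<in> carrier V" by (rule closed)
  next
    fix f g assume f: "f \<in> carrier ?F" and g: "g \<in> carrier ?F"
    let ?A = "{t. f t \<noteq> \<zero>\<^bsub>K\<^esub>} \<union> {t. g t \<noteq> \<zero>\<^bsub>K\<^esub>}"
    have A: "finite ?A" "?A \<subseteq> B" using fin[OF f] fin[OF g] by auto
    have fg: "f \<oplus>\<^bsub>?F\<^esub> g \<in> carrier ?F" using f g by simp
    have e: "(f \<oplus>\<^bsub>?F\<^esub> g) t = f t \<oplus>\<^bsub>K\<^esub> g t" for t by (simp add: free_space_def)
    have s: "{t. (f \<oplus>\<^bsub>?F\<^esub> g) t \<noteq> \<zero>\<^bsub>K\<^esub>} \<subseteq> ?A" by (auto simp: e)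
    have "lin_ext K V \<phi> (f \<oplus>\<^bsub>?F\<^esub> g) = (\<Oplus>\<^bsub>V\<^esub>t\<in>?A. (f \<oplus>\<^bsub>?F\<^esub> g) t \<odot>\<^bsub>V\<^esub> \<phi> t)"
      by (rule lin_ext_superset[OF V fg \<phi> A(1) s A(2)])
    also have "\<dots> = (\<Oplus>\<^bsub>V\<^esub>t\<in>?A. (f t \<odot>\<^bsub>V\<^esub> \<phi> t) \<oplus>\<^bsub>V\<^esub> (g t \<odot>\<^bsub>V\<^esub> \<phi> t))"
      apply (rule V.finsum_cong') using A \<phi> cl[OF f] cl[OF g]
      by (auto simp: e Pi_iff subset_iff V.smult_l_distr)
    also have "\<dots> = (\<Oplus>\<^bsub>V\<^esub>t\<in>?A. f t \<odot>\<^bsub>V\<^esub> \<phi> t) \<oplus>\<^bsub>V\<^esub> (\<Oplus>\<^bsub>V\<^esub>t\<in>?A. g t \<odot>\<^bsub>V\<^esub> \<phi> t)"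
      apply (rule V.finsum_addf) using A \<phi> cl[OF f] cl[OF g]
      by (auto simp: Pi_iff subset_iff)
    also have "\<dots> = lin_ext K V \<phi> f \<oplus>\<^bsub>V\<^esub> lin_ext K V \<phi> g"
      using lin_ext_superset[OF V f \<phi> A(1) _ A(2)] lin_ext_superset[OF V g \<phi> A(1) _ A(2)] by auto
    finally show "lin_ext K V \<phi> (f \<oplus>\<^bsub>?F\<^esub> g) = lin_ext K V \<phi> f \<oplus>\<^bsub>V\<^esub> lin_ext K V \<phi> g" .
  next
    fix a f assume a: "a \<in> carrier K" and f: "f \<in> carrier ?F"
    let ?A = "{t. f t \<noteq> \<zero>\<^bsub>K\<^esub>}"
    have af: "a \<odot>\<^bsub>?F\<^esub> f \<in> carrier ?F" using a f by simp
    have e: "(a \<odot>\<^bsub>?F\<^esub> f) t = a \<otimes>\<^bsub>K\<^esub> f t" for t by (simp add: free_space_def)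
    have s: "{t. (a \<odot>\<^bsub>?F\<^esub> f) t \<noteq> \<zero>\<^bsub>K\<^esub>} \<subseteq> ?A" using a by (auto simp: e)
    have "lin_ext K V \<phi> (a \<odot>\<^bsub>?F\<^esub> f) = (\<Oplus>\<^bsub>V\<^esub>t\<in>?A. (a \<odot>\<^bsub>?F\<^esub> f) t \<odot>\<^bsub>V\<^esub> \<phi> t)"
      by (rule lin_ext_superset[OF V af \<phi> fin(1)[OF f] s fin(2)[OF f]])
    also have "\<dots> = (\<Oplus>\<^bsub>V\<^esub>t\<in>?A. a \<odot>\<^bsub>V\<^esub> (f t \<odot>\<^bsub>V\<^esub> \<phi> t))"
      apply (rule V.finsum_cong') using fin[OF f] \<phi> cl[OF f] a
      by (auto simp: e Pi_iff subset_iff V.smult_assoc1)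
    also have "\<dots> = a \<odot>\<^bsub>V\<^esub> lin_ext K V \<phi> f"
      unfolding lin_ext_def apply (rule V.finsum_smult_ldistr[symmetric]) using fin[OF f] \<phi> cl[OF f] a
      by (auto simp: Pi_iff subset_iff)
    finally show "lin_ext K V \<phi> (a \<odot>\<^bsub>?F\<^esub> f) = a \<odot>\<^bsub>V\<^esub> lin_ext K V \<phi> f" .
  qed
qed

lemma lin_ext_basis:
  assumes V: "vectorspace K V" and \<phi>: "\<phi> \<in> B \<rightarrow> carrier V" and t: "t \<in> B"
  shows "lin_ext K V \<phi> (basis_vec K t) = \<phi> t"
proof -
  interpret V: vectorspace K V by fact
  have "{t'. basis_vec K t t' \<noteq> \<zero>\<^bsub>K\<^esub>} = {t}" by (auto simp: basis_vec_def)
  then show ?thesis using \<phi> t by (auto simp: lin_ext_def basis_vec_def Pi_iff)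
qed

lemma free_space_induct:
  fixes f :: "'b \<Rightarrow> 'k"
  assumes K: "field K" and f: "f \<in> carrier (free_space K B)"
    and z: "P \<zero>\<^bsub>free_space K B\<^esub>"
    and s: "\<And>a t f. \<lbrakk>a \<in> carrier K; t \<in> B; f \<in> carrier (free_space K B); P f\<rbrakk>
      \<Longrightarrow> P (f \<oplus>\<^bsub>free_space K B\<^esub> a \<odot>\<^bsub>free_space K B\<^esub> basis_vec K t)"
  shows "P f"
proof -
  let ?F = "free_space K B"
  interpret field K by (rule K)
  have "\<forall>f\<in>carrier ?F. {t. f t \<noteq> \<zero>\<^bsub>K\<^esub>} = A \<longrightarrow> P f" if "finite A" for A :: "'b set"
    using that
  proof (induction A)
    case empty
    { fix f :: "'b \<Rightarrow> 'k" assume "{t. f t \<noteq> \<zero>\<^bsub>K\<^esub>} = {}"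
      then have "f = \<zero>\<^bsub>?F\<^esub>" by (auto simp: free_space_def) 
      then have "P f" using z by simp }
    then show ?case by blast
  next
    case (insert t A)
    show ?case
    proof safe
      fix f assume f: "f \<in> carrier ?F" and eq: "{t. f t \<noteq> \<zero>\<^bsub>K\<^esub>} = insert t A"
      let ?g = "f(t := \<zero>\<^bsub>K\<^esub>)"
      have ft: "f t' \<in> carrier K" for t' using f by (auto simp: free_space_def)
      have gs: "{t. ?g t \<noteq> \<zero>\<^bsub>K\<^esub>} = A" using eq insert.hyps by auto
      have "A \<subseteq> B" "t \<in> B" using f eq by (auto simp: free_space_def)
      then have g: "?g \<in> carrier ?F" using ft insert.hyps gs by (simp add: free_space_def)
      then have "P ?g" using insert.IH gs by blast
      then have "P (?g \<oplus>\<^bsub>?F\<^esub> f t \<odot>\<^bsub>?F\<^esub> basis_vec K t)" using s g ft \<open>t \<in> B\<close> by blast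
      moreover have "?g \<oplus>\<^bsub>?F\<^esub> f t \<odot>\<^bsub>?F\<^esub> basis_vec K t = f"
        using ft by (auto simp: free_space_def basis_vec_def)
      ultimately show "P f" by simp
    qed
  qed
  then show ?thesis using f by (auto simp: free_space_def)
qed

lemma free_space_hom_ext:
  assumes V: "vectorspace K V"
    and h: "h \<in> module_hom K (free_space K B) V" and h': "h' \<in> module_hom K (free_space K B) V"
    and e: "\<And>t. t \<in> B \<Longrightarrow> h (basis_vec K t) = h' (basis_vec K t)"
    and f: "f \<in> carrier (free_space K B)"
  shows "h f = h' f"
proof -
  let ?F = "free_space K B"
  have K: "field K" using V vs_field by blast
  have F: "vectorspace K ?F" by (rule free_space_vectorspace) (rule K)
  have "mod_hom K ?F V h" "mod_hom K ?F V h'" 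
    using h h' V F by (auto simp: mod_hom_def mod_hom_axioms_def vs_module)
  have z: "h \<zero>\<^bsub>?F\<^esub> = h' \<zero>\<^bsub>?F\<^esub>"
    using mod_hom.f0_is_0[OF \<open>mod_hom K ?F V h\<close>] mod_hom.f0_is_0[OF \<open>mod_hom K ?F V h'\<close>] by (rule trans[OF _ sym])
  have st: "h (f \<oplus>\<^bsub>?F\<^esub> a \<odot>\<^bsub>?F\<^esub> basis_vec K t) = h' (f \<oplus>\<^bsub>?F\<^esub> a \<odot>\<^bsub>?F\<^esub> basis_vec K t)"
    if *: "a \<in> carrier K" "t \<in> B" "f \<in> carrier ?F" "h f = h' f" for a t f
  proof -
    have b: "basis_vec K t \<in> carrier ?F" by (rule basis_vec_closed[OF K *(2)])
    have ab: "a \<odot>\<^bsub>?F\<^esub> basis_vec K t \<in> carrier ?F"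
      by (rule module.smult_closed[OF vs_module[OF F] *(1) b])
    show ?thesis
      unfolding module_hom_add[OF h *(3) ab] module_hom_smult[OF h *(1) b]
       module_hom_add[OF h' *(3) ab] module_hom_smult[OF h' *(1) b]
       e[OF *(2)] *(4) ..
  qed
  show ?thesis
    by (rule free_space_induct[OF K f, where P = "\<lambda>f. h f = h' f"]) (fact z, rule st)
qed

subsection \<open>Tensor products\<close>

definition balanced_map ::
    "'k ring \<Rightarrow> ('o, 'm, 'k) lin_category \<Rightarrow> ('o, 'm, 'k, 'p) lin_functor
      \<Rightarrow> ('o, 'm, 'k, 'n) lin_functor \<Rightarrow> ('k, 'v) module \<Rightarrow> ('o \<times> 'p \<times> 'n \<Rightarrow> 'v) \<Rightarrow> bool" where
  "balanced_map K C P N V \<phi> \<longleftrightarrow>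
    (\<forall>x\<in>Ob C. \<forall>n\<in>carrier (Val N x). (\<lambda>p. \<phi> (x, p, n)) \<in> module_hom K (Val P x) V) \<and>
    (\<forall>x\<in>Ob C. \<forall>p\<in>carrier (Val P x). (\<lambda>n. \<phi> (x, p, n)) \<in> module_hom K (Val N x) V) \<and>
    (\<forall>x\<in>Ob C. \<forall>y\<in>Ob C. \<forall>f\<in>carrier (Hom C x y). \<forall>p\<in>carrier (Val P y). \<forall>n\<in>carrier (Val N x).
      \<phi> (x, Act P x y f p, n) = \<phi> (y, p, Act N x y f n))"

locale tensor_setup = field K for K :: "'k ring" (structure) +
  fixes C :: "('o, 'm, 'k) lin_category"
    and P :: "('o, 'm, 'k, 'p) lin_functor" and N :: "('o, 'm, 'k, 'n) lin_functor"
  assumes P_space: "x \<in> Ob C \<Longrightarrow> vectorspace K (Val P x)"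
    and N_space: "x \<in> Ob C \<Longrightarrow> vectorspace K (Val N x)"
    and P_act: "\<lbrakk>x \<in> Ob C; y \<in> Ob C; f \<in> carrier (Hom C x y); p \<in> carrier (Val P y)\<rbrakk>
      \<Longrightarrow> Act P x y f p \<in> carrier (Val P x)"
    and N_act: "\<lbrakk>x \<in> Ob C; y \<in> Ob C; f \<in> carrier (Hom C x y); n \<in> carrier (Val N x)\<rbrakk>
      \<Longrightarrow> Act N x y f n \<in> carrier (Val N y)"
begin

abbreviation "F \<equiv> tensor_free K C P N"
abbreviation "T \<equiv> tensor K C P N"
abbreviation "gens \<equiv> tensor_gens C P N"

lemma F_vs: "vectorspace K F"
  by (rule free_space_vectorspace) (rule field_axioms)

sublocale F: vectorspace K F by (rule F_vs)

lemma P_add: "\<lbrakk>x \<in> Ob C; p \<in> carrier (Val P x); p' \<in> carrier (Val P x)\<rbrakk> \<Longrightarrow> p \<oplus>\<^bsub>Val P x\<^esub> p' \<in> carrier (Val P x)"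
  and P_smult: "\<lbrakk>x \<in> Ob C; p \<in> carrier (Val P x); a \<in> carrier K\<rbrakk> \<Longrightarrow> a \<odot>\<^bsub>Val P x\<^esub> p \<in> carrier (Val P x)"
  using P_space by (metis vs_module module.smult_closed Module.module_def abelian_group_def abelian_monoid.a_closed)+

lemma N_add: "\<lbrakk>x \<in> Ob C; p \<in> carrier (Val N x); p' \<in> carrier (Val N x)\<rbrakk> \<Longrightarrow> p \<oplus>\<^bsub>Val N x\<^esub> p' \<in> carrier (Val N x)"
  and N_smult: "\<lbrakk>x \<in> Ob C; p \<in> carrier (Val N x); a \<in> carrier K\<rbrakk> \<Longrightarrow> a \<odot>\<^bsub>Val N x\<^esub> p \<in> carrier (Val N x)"
  using N_space by (metis vs_module module.smult_closed Module.module_def abelian_group_def abelian_monoid.a_closed)+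

lemma gensI: "\<lbrakk>x \<in> Ob C; p \<in> carrier (Val P x); n \<in> carrier (Val N x)\<rbrakk> \<Longrightarrow> (x, p, n) \<in> gens"
  by (simp add: tensor_gens_def)

lemma e_closed: "\<lbrakk>x \<in> Ob C; p \<in> carrier (Val P x); n \<in> carrier (Val N x)\<rbrakk>
    \<Longrightarrow> basis_vec K (x, p, n) \<in> carrier F"
  by (rule basis_vec_closed) (auto intro: gensI field_axioms)

lemma rels_closed: "tensor_rels K C P N \<subseteq> carrier F"
  unfolding tensor_rels_def Let_def
  by (auto intro!: F.minus_closed F.add.m_closed F.smult_closed e_closed P_add P_smult N_add N_smult P_act N_act)

lemma null_subspace: "VectorSpace.subspace K (tensor_null K C P N) F"
  unfolding tensor_null_def VectorSpace.subspace_def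
  using F.span_is_submodule[OF rels_closed] F_vs by blast

lemma rel_null: "w \<in> tensor_rels K C P N \<Longrightarrow> w \<in> tensor_null K C P N"
  unfolding tensor_null_def using F.in_own_span[OF rels_closed] by blast

lemma T_vs: "vectorspace K T"
  unfolding tensor_def by (rule quot_space_vectorspace[OF null_subspace])

sublocale T: vectorspace K T by (rule T_vs)

abbreviation "pr v \<equiv> tensor_null K C P N +>\<^bsub>F\<^esub> v"

lemma pr_hom: "(\<lambda>v. pr v) \<in> module_hom K F T"
  unfolding module_hom_def tensor_def
  by (auto simp: quot_space_carrier quot_space_add[OF null_subspace] quot_space_smult[OF null_subspace])

sublocale pr: mod_hom K F T "\<lambda>v. pr v"
  by unfold_locales (rule pr_hom)

lemma pr_rel: "\<lbrakk>u \<in> carrier F; v \<in> carrier F; u \<ominus>\<^bsub>F\<^esub> v \<in> tensor_rels K C P N\<rbrakk> \<Longrightarrow> pr u = pr v"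
  using coset_eq_iff[OF null_subspace] rel_null by blast

abbreviation "pt \<equiv> pure_tensor K C P N"

lemma pt_closed: "\<lbrakk>x \<in> Ob C; p \<in> carrier (Val P x); n \<in> carrier (Val N x)\<rbrakk> \<Longrightarrow> pt (x, p, n) \<in> carrier T"
  unfolding pure_tensor_def using pr.f_im e_closed by blast

lemma pt_add_left: "\<lbrakk>x \<in> Ob C; p \<in> carrier (Val P x); p' \<in> carrier (Val P x); n \<in> carrier (Val N x)\<rbrakk>
    \<Longrightarrow> pt (x, p \<oplus>\<^bsub>Val P x\<^esub> p', n) = pt (x, p, n) \<oplus>\<^bsub>T\<^esub> pt (x, p', n)"
  unfolding pure_tensor_def
  apply (subst pr.f_add[symmetric], (rule e_closed; assumption)+)
  apply (rule pr_rel)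
    apply (auto intro: e_closed P_add)[2]
  unfolding tensor_rels_def Let_def by blast

lemma pt_add_right: "\<lbrakk>x \<in> Ob C; p \<in> carrier (Val P x); n \<in> carrier (Val N x); n' \<in> carrier (Val N x)\<rbrakk>
    \<Longrightarrow> pt (x, p, n \<oplus>\<^bsub>Val N x\<^esub> n') = pt (x, p, n) \<oplus>\<^bsub>T\<^esub> pt (x, p, n')"
  unfolding pure_tensor_def
  apply (subst pr.f_add[symmetric], (rule e_closed; assumption)+)
  apply (rule pr_rel)
    apply (auto intro: e_closed N_add)[2]
  unfolding tensor_rels_def Let_def by blast

lemma pt_smult_left: "\<lbrakk>x \<in> Ob C; p \<in> carrier (Val P x); n \<in> carrier (Val N x); a \<in> carrier K\<rbrakk>
    \<Longrightarrow> pt (x, a \<odot>\<^bsub>Val P x\<^esub> p, n) = a \<odot>\<^bsub>T\<^esub> pt (x, p, n)"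
  unfolding pure_tensor_def
  apply (subst pr.f_smult[symmetric], assumption, (rule e_closed; assumption)+)
  apply (rule pr_rel)
    apply (auto intro: e_closed P_smult)[2]
  unfolding tensor_rels_def Let_def by blast

lemma pt_smult_right: "\<lbrakk>x \<in> Ob C; p \<in> carrier (Val P x); n \<in> carrier (Val N x); a \<in> carrier K\<rbrakk>
    \<Longrightarrow> pt (x, p, a \<odot>\<^bsub>Val N x\<^esub> n) = a \<odot>\<^bsub>T\<^esub> pt (x, p, n)"
  unfolding pure_tensor_def
  apply (subst pr.f_smult[symmetric], assumption, (rule e_closed; assumption)+)
  apply (rule pr_rel)
    apply (auto intro: e_closed N_smult)[2]
  unfolding tensor_rels_def Let_def by blast

lemma pt_act: "\<lbrakk>x \<in> Ob C; y \<in> Ob C; f \<in> carrier (Hom C x y); p \<in> carrier (Val P y); n \<in> carrier (Val N x)\<rbrakk>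
    \<Longrightarrow> pt (x, Act P x y f p, n) = pt (y, p, Act N x y f n)"
  unfolding pure_tensor_def
  apply (rule pr_rel)
    apply (auto intro: e_closed P_act N_act)[2]
  unfolding tensor_rels_def Let_def by blast

lemma pt_balanced: "balanced_map K C P N T pt"
  unfolding balanced_map_def module_hom_def
  by (auto simp: pt_add_left pt_add_right pt_smult_left pt_smult_right pt_act pt_closed)

lemma tensor_hom_ext:
  assumes V: "vectorspace K V" and h: "h \<in> module_hom K T V" and h': "h' \<in> module_hom K T V"
    and e: "\<And>x p n. \<lbrakk>x \<in> Ob C; p \<in> carrier (Val P x); n \<in> carrier (Val N x)\<rbrakk>
      \<Longrightarrow> h (pt (x, p, n)) = h' (pt (x, p, n))"
    and t: "t \<in> carrier T"
  shows "h t = h' t"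
proof -
  obtain f where f: "f \<in> carrier F" "t = pr f"
    using t by (auto simp: tensor_def quot_space_carrier)
  have *: "(\<lambda>v. g (pr v)) \<in> module_hom K F V" if "g \<in> module_hom K T V" for g
  proof -
    have "pr v \<in> carrier T" if "v \<in> carrier F" for v using that pr.f_im by blast
    then show ?thesis using that unfolding module_hom_def by auto
  qed
  show ?thesis unfolding f(2)
  proof (rule free_space_hom_ext[OF V *[OF h] *[OF h'] _ f(1)])
    fix s assume "s \<in> gens"
    then show "h (pr (basis_vec K s)) = h' (pr (basis_vec K s))"
      using e by (auto simp: tensor_gens_def pure_tensor_def)
  qed
qed

context
  fixes V :: "('k, 'v) module" and \<phi>
  assumes V: "vectorspace K V" and bal: "balanced_map K C P N V \<phi>"
begin

interpretation V: vectorspace K V by (rule V)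

lemma phi_gens: "\<phi> \<in> gens \<rightarrow> carrier V"
proof -
  have "\<phi> (x, p, n) \<in> carrier V" if "x \<in> Ob C" "p \<in> carrier (Val P x)" "n \<in> carrier (Val N x)" for x p n
    using bal that module_hom_closed[of "\<lambda>p. \<phi> (x, p, n)" K "Val P x" V]
    unfolding balanced_map_def by blast
  then show ?thesis by (auto simp: tensor_gens_def)
qed

lemma le_hom: "lin_ext K V \<phi> \<in> module_hom K F V"
  by (rule lin_ext_hom[OF V phi_gens])

interpretation h: mod_hom K F V "lin_ext K V \<phi>"
  by unfold_locales (rule le_hom)

lemma le_e: "\<lbrakk>x \<in> Ob C; p \<in> carrier (Val P x); n \<in> carrier (Val N x)\<rbrakk>
   \<Longrightarrow> lin_ext K V \<phi> (basis_vec K (x, p, n)) = \<phi> (x, p, n)"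
  by (rule lin_ext_basis[OF V phi_gens]) (rule gensI)

lemma phi_closed: "\<lbrakk>x \<in> Ob C; p \<in> carrier (Val P x); n \<in> carrier (Val N x)\<rbrakk> \<Longrightarrow> \<phi> (x, p, n) \<in> carrier V"
  using phi_gens gensI by blast

lemma null_kernel: "tensor_null K C P N \<subseteq> h.ker"
  unfolding tensor_null_def
proof (rule F.span_is_subset)
  show "LinearCombinations.submodule K h.ker F" by (rule h.ker_is_submodule)
  have 1: "\<phi> (x, p \<oplus>\<^bsub>Val P x\<^esub> p', n) = \<phi> (x, p, n) \<oplus>\<^bsub>V\<^esub> \<phi> (x, p', n)"
    if "x \<in> Ob C" "p \<in> carrier (Val P x)" "p' \<in> carrier (Val P x)" "n \<in> carrier (Val N x)" for x p p' n
    using bal that unfolding balanced_map_def module_hom_def by auto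
  have 2: "\<phi> (x, p, n \<oplus>\<^bsub>Val N x\<^esub> n') = \<phi> (x, p, n) \<oplus>\<^bsub>V\<^esub> \<phi> (x, p, n')"
    if "x \<in> Ob C" "p \<in> carrier (Val P x)" "n' \<in> carrier (Val N x)" "n \<in> carrier (Val N x)" for x p n n'
    using bal that unfolding balanced_map_def module_hom_def by auto
  have 3: "\<phi> (x, a \<odot>\<^bsub>Val P x\<^esub> p, n) = a \<odot>\<^bsub>V\<^esub> \<phi> (x, p, n)"
    if "x \<in> Ob C" "p \<in> carrier (Val P x)" "a \<in> carrier K" "n \<in> carrier (Val N x)" for x p a n
    using bal that unfolding balanced_map_def module_hom_def by auto
  have 4: "\<phi> (x, p, a \<odot>\<^bsub>Val N x\<^esub> n) = a \<odot>\<^bsub>V\<^esub> \<phi> (x, p, n)"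
    if "x \<in> Ob C" "p \<in> carrier (Val P x)" "a \<in> carrier K" "n \<in> carrier (Val N x)" for x p a n
    using bal that unfolding balanced_map_def module_hom_def by auto
  have 5: "\<phi> (x, Act P x y f p, n) = \<phi> (y, p, Act N x y f n)"
    if "x \<in> Ob C" "y \<in> Ob C" "f \<in> carrier (Hom C x y)" "p \<in> carrier (Val P y)" "n \<in> carrier (Val N x)" for x y f p n
    using bal that unfolding balanced_map_def by auto
  have kerI: "u \<ominus>\<^bsub>F\<^esub> v \<in> h.ker"
    if "u \<in> carrier F" "v \<in> carrier F" "lin_ext K V \<phi> u = lin_ext K V \<phi> v" for u v
    using that by (simp add: h.ker_def V.minus_eq V.r_neg F.minus_closed)
  show "tensor_rels K C P N \<subseteq> h.ker"
    unfolding tensor_rels_def Let_def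
    by (auto intro!: kerI e_closed P_add P_smult N_add N_smult P_act N_act
        simp: le_e P_add P_smult N_add N_smult P_act N_act 1 2 3 4 5 e_closed)
qed

lemma tensor_lift_pr:
  assumes "f \<in> carrier F" shows "tensor_lift K V \<phi> (pr f) = lin_ext K V \<phi> f"
  unfolding tensor_lift_def
proof (rule the_elem_image_unique)
  interpret A: abelian_subgroup "tensor_null K C P N" F by (rule subspace_add_subgroup[OF null_subspace])
  show "pr f \<noteq> {}" using A.a_rcos_self assms by blast
  fix g assume "g \<in> pr f"
  then obtain w where w: "w \<in> tensor_null K C P N" "g = w \<oplus>\<^bsub>F\<^esub> f" by (auto simp: a_r_coset_def')
  then have "lin_ext K V \<phi> w = \<zero>\<^bsub>V\<^esub>" "w \<in> carrier F" using null_kernel by (auto simp: h.ker_def)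
  then show "lin_ext K V \<phi> g = lin_ext K V \<phi> f" using w assms h.f_im by simp
qed

lemma tensor_lift_pt: "\<lbrakk>x \<in> Ob C; p \<in> carrier (Val P x); n \<in> carrier (Val N x)\<rbrakk>
   \<Longrightarrow> tensor_lift K V \<phi> (pt (x, p, n)) = \<phi> (x, p, n)"
  unfolding pure_tensor_def using tensor_lift_pr e_closed le_e by simp

lemma tensor_lift_hom: "tensor_lift K V \<phi> \<in> module_hom K T V"
proof -
  have c: "carrier T = (\<lambda>v. pr v) ` carrier F" by (simp add: tensor_def quot_space_carrier)
  show ?thesis unfolding module_hom_def c
    by (auto simp: tensor_lift_pr simp flip: pr.f_add pr.f_smult)
qed

end

end

subsection \<open>The left adjoint of restriction\<close>

lemma module_hom_sum:
  assumes W: "vectorspace K W" and f: "f \<in> module_hom K V W" and g: "g \<in> module_hom K V W"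
  shows "(\<lambda>v. f v \<oplus>\<^bsub>W\<^esub> g v) \<in> module_hom K V W"
proof -
  interpret W: vectorspace K W by fact
  have c: "f v \<in> carrier W" "g v \<in> carrier W" if "v \<in> carrier V" for v
    using that f g module_hom_closed by blast+
  have four: "(a \<oplus>\<^bsub>W\<^esub> b) \<oplus>\<^bsub>W\<^esub> (a' \<oplus>\<^bsub>W\<^esub> b') = (a \<oplus>\<^bsub>W\<^esub> a') \<oplus>\<^bsub>W\<^esub> (b \<oplus>\<^bsub>W\<^esub> b')"
    if "a \<in> carrier W" "b \<in> carrier W" "a' \<in> carrier W" "b' \<in> carrier W" for a b a' b'
    using that by (simp add: W.M.a_ac)
  show ?thesis
    unfolding module_hom_def
  proof (intro CollectI conjI allI impI)
    show "(\<lambda>v. f v \<oplus>\<^bsub>W\<^esub> g v) \<in> carrier V \<rightarrow> carrier W" using c by blast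
  next
    fix u v assume "u \<in> carrier V \<and> v \<in> carrier V"
    then show "f (u \<oplus>\<^bsub>V\<^esub> v) \<oplus>\<^bsub>W\<^esub> g (u \<oplus>\<^bsub>V\<^esub> v) = f u \<oplus>\<^bsub>W\<^esub> g u \<oplus>\<^bsub>W\<^esub> (f v \<oplus>\<^bsub>W\<^esub> g v)"
      using module_hom_add[OF f] module_hom_add[OF g] c four by metis
  next
    fix a v assume "a \<in> carrier K \<and> v \<in> carrier V"
    then show "f (a \<odot>\<^bsub>V\<^esub> v) \<oplus>\<^bsub>W\<^esub> g (a \<odot>\<^bsub>V\<^esub> v) = a \<odot>\<^bsub>W\<^esub> (f v \<oplus>\<^bsub>W\<^esub> g v)"
      using module_hom_smult[OF f] module_hom_smult[OF g] c W.smult_r_distr by metis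
  qed
qed

lemma module_hom_scaled:
  assumes W: "vectorspace K W" and f: "f \<in> module_hom K V W" and a: "a \<in> carrier K"
  shows "(\<lambda>v. a \<odot>\<^bsub>W\<^esub> f v) \<in> module_hom K V W"
proof -
  interpret W: vectorspace K W by fact
  have c: "f v \<in> carrier W" if "v \<in> carrier V" for v
    using that f module_hom_closed by blast
  have "a \<odot>\<^bsub>W\<^esub> (r \<odot>\<^bsub>W\<^esub> f m) = r \<odot>\<^bsub>W\<^esub> (a \<odot>\<^bsub>W\<^esub> f m)" if "r \<in> carrier K" "m \<in> carrier V" for r m
    using that a c W.smult_assoc1 W.R.m_comm by metis
  then show ?thesis
    using f c a unfolding module_hom_def
    by (auto simp: W.smult_r_distr)
qed

lemma module_hom_compose:
  assumes "f \<in> module_hom K U V" "g \<in> module_hom K V W"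
  shows "(\<lambda>v. g (f v)) \<in> module_hom K U W"
proof -
  have "f v \<in> carrier V" if "v \<in> carrier U" for v using assms(1) that module_hom_closed by blast
  then show ?thesis using assms unfolding module_hom_def by auto
qed

locale induction_setup = linear_category K G + N: cat_module K "sub_cat G D" N
  for K :: "'k ring" (structure) and G :: "('o, 'm, 'k) lin_category" and D
    and N :: "('o, 'm, 'k, 'n) lin_functor" +
  assumes wide: "wide_subcategory K G D"
begin

abbreviation "C \<equiv> sub_cat G D"
abbreviation "I \<equiv> induced_module K G D N"
abbreviation "T y \<equiv> tensor K C (hom_to G y) N"
abbreviation "pt y \<equiv> pure_tensor K C (hom_to G y) N"

lemma C_simps [simp]: "Ob C = Ob G" "carrier (Hom C x y) = D x y" "Comp C = Comp G" "Id C = Id G"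
  by (simp_all add: sub_cat_def)

lemma C_add [simp]: "add (Hom C x y) = add (Hom G x y)" "smult (Hom C x y) = smult (Hom G x y)"
  by (simp_all add: sub_cat_def)

lemma D_sub: "\<lbrakk>x \<in> Ob G; y \<in> Ob G; f \<in> D x y\<rbrakk> \<Longrightarrow> f \<in> carrier (Hom G x y)"
  using wide unfolding wide_subcategory_def VectorSpace.subspace_def LinearCombinations.submodule_def
  by blast

lemma D_id: "x \<in> Ob G \<Longrightarrow> Id G x \<in> D x x"
  using wide unfolding wide_subcategory_def by blast

lemma Comp_closed: "\<lbrakk>x \<in> Ob G; y \<in> Ob G; z \<in> Ob G; f \<in> carrier (Hom G x y); g \<in> carrier (Hom G y z)\<rbrakk>
    \<Longrightarrow> Comp G x y z g f \<in> carrier (Hom G x z)"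
  using module_hom_closed[OF Comp_linear_left] by blast

lemma N_act: "\<lbrakk>x \<in> Ob G; y \<in> Ob G; f \<in> D x y; n \<in> carrier (Val N x)\<rbrakk> \<Longrightarrow> Act N x y f n \<in> carrier (Val N y)"
  using module_hom_closed[OF N.Act_hom, of x y f] by auto

lemma hom_to_simps [simp]: "Val (hom_to G y) x = Hom G x y" "Act (hom_to G y) w x f g = Comp G w x y g f"
  by (simp_all add: hom_to_def)

lemma Val_I [simp]: "Val I y = T y"
  by (simp add: induced_module_def)

lemma tensor_setup: "y \<in> Ob G \<Longrightarrow> tensor_setup K C (hom_to G y) N"
  unfolding tensor_setup_def tensor_setup_axioms_def
  using N.Val_space field_axioms by (simp add: Hom_space Comp_closed D_sub N_act)

lemma T_vs: "y \<in> Ob G \<Longrightarrow> vectorspace K (T y)"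
  using tensor_setup.T_vs[OF tensor_setup] .

lemma pt_closed: "\<lbrakk>y \<in> Ob G; x \<in> Ob G; g \<in> carrier (Hom G x y); n \<in> carrier (Val N x)\<rbrakk>
   \<Longrightarrow> pt y (x, g, n) \<in> carrier (T y)"
  using tensor_setup.pt_closed[OF tensor_setup, of y x g n] by simp

lemma T_ext:
  assumes "y \<in> Ob G" "vectorspace K V" "h \<in> module_hom K (T y) V" "h' \<in> module_hom K (T y) V"
    and "\<And>x g n. \<lbrakk>x \<in> Ob G; g \<in> carrier (Hom G x y); n \<in> carrier (Val N x)\<rbrakk> \<Longrightarrow>
      h (pt y (x, g, n)) = h' (pt y (x, g, n))"
    and "t \<in> carrier (T y)"
  shows "h t = h' t"
  using tensor_setup.tensor_hom_ext[OF tensor_setup, of y V h h' t] assms by simp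

lemma push_balanced:
  assumes y: "y \<in> Ob G" and z: "z \<in> Ob G" and h: "h \<in> carrier (Hom G y z)"
  shows "balanced_map K C (hom_to G y) N (T z) (\<lambda>(x, g, n). pt z (x, Comp G x y z h g, n))"
proof -
  interpret Z: tensor_setup K C "hom_to G z" N by (rule tensor_setup[OF z])
  note bal = Z.pt_balanced[unfolded balanced_map_def, simplified]
  have 1: "(\<lambda>g. pt z (x, Comp G x y z h g, n)) \<in> module_hom K (Hom G x y) (T z)"
    if "x \<in> Ob G" "n \<in> carrier (Val N x)" for x n
  proof (rule module_hom_compose[OF Comp_linear_right[OF that(1) y z h]])
    show "(\<lambda>p. pt z (x, p, n)) \<in> module_hom K (Hom G x z) (T z)" using bal that by blast
  qed
  have 2: "(\<lambda>n. pt z (x, Comp G x y z h g, n)) \<in> module_hom K (Val N x) (T z)"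
    if "x \<in> Ob G" "g \<in> carrier (Hom G x y)" for x g
    using bal that Comp_closed[OF that(1) y z that(2) h] by blast
  have 3: "pt z (x, Comp G x y z h (Comp G x x' y g f), n) = pt z (x', Comp G x' y z h g, Act N x x' f n)"
    if "x \<in> Ob G" "x' \<in> Ob G" "f \<in> D x x'" "g \<in> carrier (Hom G x' y)" "n \<in> carrier (Val N x)" for x x' f g n
  proof -
    have f: "f \<in> carrier (Hom G x x')" using that D_sub by blast
    have "Comp G x y z h (Comp G x x' y g f) = Comp G x x' z (Comp G x' y z h g) f"
      using Comp_assoc[OF that(1,2) y z f that(4) h] by simp
    then show ?thesis using bal that Comp_closed[OF that(2) y z that(4) h] by simp
  qed
  show ?thesis unfolding balanced_map_def using 1 2 3 by simp
qed

lemma Act_I: "Act I y z h = tensor_lift K (T z) (\<lambda>(x, g, n). pt z (x, Comp G x y z h g, n))"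
  by (simp add: induced_module_def)

lemma Act_I_hom:
  assumes "y \<in> Ob G" "z \<in> Ob G" "h \<in> carrier (Hom G y z)"
  shows "Act I y z h \<in> module_hom K (T y) (T z)"
  unfolding Act_I
  by (rule tensor_setup.tensor_lift_hom[OF tensor_setup T_vs push_balanced]) (use assms in auto)

lemma Act_I_pt:
  assumes "y \<in> Ob G" "z \<in> Ob G" "h \<in> carrier (Hom G y z)" "x \<in> Ob G" "g \<in> carrier (Hom G x y)" "n \<in> carrier (Val N x)"
  shows "Act I y z h (pt y (x, g, n)) = pt z (x, Comp G x y z h g, n)"
  unfolding Act_I
  using tensor_setup.tensor_lift_pt[OF tensor_setup[OF assms(1)] T_vs[OF assms(2)]
      push_balanced[OF assms(1-3)], of x g n] assms
  by simp

theorem induced_is_module: "cat_module K G I"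
proof (intro cat_module.intro cat_module_axioms.intro linear_category_axioms)
  fix x assume "x \<in> Ob G" then show "vectorspace K (Val I x)" using T_vs by simp
next
  fix x y f assume "x \<in> Ob G" "y \<in> Ob G" "f \<in> carrier (Hom G x y)"
  then show "Act I x y f \<in> module_hom K (Val I x) (Val I y)" using Act_I_hom by simp
next
  fix y z t assume y: "y \<in> Ob G" and z: "z \<in> Ob G" and t: "t \<in> carrier (Val I y)"
  interpret Z: tensor_setup K C "hom_to G z" N by (rule tensor_setup[OF z])
  interpret H: vectorspace K "Hom G y z" using Hom_space y z by blast
  note bal = Z.pt_balanced[unfolded balanced_map_def, simplified]
  note vs = T_vs[OF z]
  have t': "t \<in> carrier (T y)" using t by simp
  have add: "Act I y z (f \<oplus>\<^bsub>Hom G y z\<^esub> g) t = Act I y z f t \<oplus>\<^bsub>T z\<^esub> Act I y z g t"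
    if f: "f \<in> carrier (Hom G y z)" and g: "g \<in> carrier (Hom G y z)" for f g
  proof (rule T_ext[OF y vs Act_I_hom module_hom_sum[OF vs Act_I_hom Act_I_hom] _ t'])
    fix x u n assume x: "x \<in> Ob G" and u: "u \<in> carrier (Hom G x y)" and n: "n \<in> carrier (Val N x)"
    have c: "Comp G x y z (f \<oplus>\<^bsub>Hom G y z\<^esub> g) u = Comp G x y z f u \<oplus>\<^bsub>Hom G x z\<^esub> Comp G x y z g u"
      by (rule module_hom_add[OF Comp_linear_left[OF x y z u] f g])
    have p: "(\<lambda>p. pt z (x, p, n)) \<in> module_hom K (Hom G x z) (T z)" using bal x n by blast
    show "Act I y z (f \<oplus>\<^bsub>Hom G y z\<^esub> g) (pt y (x, u, n)) =
        Act I y z f (pt y (x, u, n)) \<oplus>\<^bsub>T z\<^esub> Act I y z g (pt y (x, u, n))"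
      using module_hom_add[OF p Comp_closed[OF x y z u f] Comp_closed[OF x y z u g]] f g x y z u n
      by (simp add: Act_I_pt c)
  qed (use f g y z in auto)
  have sm: "Act I y z (a \<odot>\<^bsub>Hom G y z\<^esub> f) t = a \<odot>\<^bsub>T z\<^esub> Act I y z f t"
    if a: "a \<in> carrier K" and f: "f \<in> carrier (Hom G y z)" for a f
  proof (rule T_ext[OF y vs Act_I_hom module_hom_scaled[OF vs Act_I_hom a] _ t'])
    fix x u n assume x: "x \<in> Ob G" and u: "u \<in> carrier (Hom G x y)" and n: "n \<in> carrier (Val N x)"
    have c: "Comp G x y z (a \<odot>\<^bsub>Hom G y z\<^esub> f) u = a \<odot>\<^bsub>Hom G x z\<^esub> Comp G x y z f u"
      by (rule module_hom_smult[OF Comp_linear_left[OF x y z u] a f])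
    have p: "(\<lambda>p. pt z (x, p, n)) \<in> module_hom K (Hom G x z) (T z)" using bal x n by blast
    show "Act I y z (a \<odot>\<^bsub>Hom G y z\<^esub> f) (pt y (x, u, n)) = a \<odot>\<^bsub>T z\<^esub> Act I y z f (pt y (x, u, n))"
      using module_hom_smult[OF p a Comp_closed[OF x y z u f]] a f x y z u n
      by (simp add: Act_I_pt c)
  qed (use a f y z in auto)
  have cl: "Act I y z f t \<in> carrier (T z)" if "f \<in> carrier (Hom G y z)" for f
    using module_hom_closed[OF Act_I_hom[OF y z that]] t' by blast
  show "(\<lambda>f. Act I y z f t) \<in> module_hom K (Hom G y z) (Val I z)"
    unfolding module_hom_def using add sm cl by simp
next
  fix y t assume y: "y \<in> Ob G" and t: "t \<in> carrier (Val I y)"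
  have "(\<lambda>t. t) \<in> module_hom K (T y) (T y)" by (simp add: module_hom_def)
  then show "Act I y y (Id G y) t = t"
    using T_ext[OF y T_vs[OF y] Act_I_hom[OF y y Id_closed[OF y]], of "\<lambda>t. t"] t y
    by (simp add: Act_I_pt Id_closed Id_left)
next
  fix x y z f g t
  assume x: "x \<in> Ob G" and y: "y \<in> Ob G" and z: "z \<in> Ob G"
    and f: "f \<in> carrier (Hom G x y)" and g: "g \<in> carrier (Hom G y z)" and t: "t \<in> carrier (Val I x)"
  have t': "t \<in> carrier (T x)" using t by simp
  show "Act I x z (Comp G x y z g f) t = Act I y z g (Act I x y f t)"
    by (rule T_ext[OF x T_vs[OF z] Act_I_hom[OF x z Comp_closed[OF x y z f g]]
          module_hom_compose[OF Act_I_hom[OF x y f] Act_I_hom[OF y z g]] _ t'])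
      (simp add: Act_I_pt x y z f g Comp_closed Comp_assoc)
qed

definition unit :: "'o \<Rightarrow> 'n \<Rightarrow> ('o \<times> 'm \<times> 'n \<Rightarrow> 'k) set" where
  "unit x n = pt x (x, Id G x, n)"

theorem unit_hom: "cat_module_hom K C N I unit"
  unfolding cat_module_hom_def
proof (intro conjI ballI)
  fix x assume "x \<in> Ob C"
  then have x: "x \<in> Ob G" by simp
  interpret X: tensor_setup K C "hom_to G x" N by (rule tensor_setup[OF x])
  show "unit x \<in> module_hom K (Val N x) (Val I x)"
    using X.pt_balanced[unfolded balanced_map_def, simplified] x Id_closed[OF x]
    by (simp add: unit_def[abs_def])
next
  fix x y f n assume "x \<in> Ob C" "y \<in> Ob C" "f \<in> carrier (Hom C x y)" and n: "n \<in> carrier (Val N x)"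
  then have x: "x \<in> Ob G" and y: "y \<in> Ob G" and f: "f \<in> D x y" by simp_all
  have f': "f \<in> carrier (Hom G x y)" using D_sub x y f by blast
  interpret Y: tensor_setup K C "hom_to G y" N by (rule tensor_setup[OF y])
  have "pt y (x, Comp G x y y (Id G y) f, n) = pt y (y, Id G y, Act N x y f n)"
    using Y.pt_act[of x y f "Id G y" n] x y f n Id_closed by simp
  moreover have "Comp G x y y (Id G y) f = Comp G x x y f (Id G x)"
    using x y f' by (simp add: Id_left Id_right)
  ultimately show "unit y (Act N x y f n) = Act I x y f (unit x n)"
    using x y f' n by (simp add: unit_def Act_I_pt Id_closed)
qed

theorem induced_universal:
  fixes M :: "('o, 'm, 'k, 'v) lin_functor"
  assumes M: "cat_module K G M" and \<psi>: "cat_module_hom K C N M \<psi>"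
  shows "\<exists>\<phi>. cat_module_hom K G I M \<phi> \<and> (\<forall>x\<in>Ob G. \<forall>n\<in>carrier (Val N x). \<phi> x (unit x n) = \<psi> x n) \<and>
    (\<forall>\<phi>'. cat_module_hom K G I M \<phi>' \<and> (\<forall>x\<in>Ob G. \<forall>n\<in>carrier (Val N x). \<phi>' x (unit x n) = \<psi> x n)
      \<longrightarrow> (\<forall>x\<in>Ob G. \<forall>t\<in>carrier (Val I x). \<phi>' x t = \<phi> x t))"
proof -
  interpret M: cat_module K G M by (rule M)
  have \<psi>h: "\<psi> x \<in> module_hom K (Val N x) (Val M x)" if "x \<in> Ob G" for x
    using \<psi> that unfolding cat_module_hom_def by simp
  have \<psi>n: "\<psi> y (Act N x y f n) = Act M x y f (\<psi> x n)"
    if "x \<in> Ob G" "y \<in> Ob G" "f \<in> D x y" "n \<in> carrier (Val N x)" for x y f n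
    using \<psi> that unfolding cat_module_hom_def by simp
  have \<psi>c: "\<psi> x n \<in> carrier (Val M x)" if "x \<in> Ob G" "n \<in> carrier (Val N x)" for x n
    using module_hom_closed[OF \<psi>h] that by blast
  define b where "b y = (\<lambda>(x, g, n). Act M x y g (\<psi> x n))" for y
  define \<phi> where "\<phi> y = tensor_lift K (Val M y) (b y)" for y
  have bal: "balanced_map K C (hom_to G y) N (Val M y) (b y)" if y: "y \<in> Ob G" for y
  proof -
    have 1: "(\<lambda>g. Act M x y g (\<psi> x n)) \<in> module_hom K (Hom G x y) (Val M y)"
      if "x \<in> Ob G" "n \<in> carrier (Val N x)" for x n
      by (rule M.Act_linear) (use that y \<psi>c in auto)
    have 2: "(\<lambda>n. Act M x y g (\<psi> x n)) \<in> module_hom K (Val N x) (Val M y)"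
      if "x \<in> Ob G" "g \<in> carrier (Hom G x y)" for x g
      by (rule module_hom_compose[OF \<psi>h M.Act_hom]) (use that y in auto)
    have 3: "Act M x y (Comp G x x' y g f) (\<psi> x n) = Act M x' y g (\<psi> x' (Act N x x' f n))"
      if "x \<in> Ob G" "x' \<in> Ob G" "f \<in> D x x'" "g \<in> carrier (Hom G x' y)" "n \<in> carrier (Val N x)" for x x' f g n
      using M.Act_Comp[OF that(1,2) y D_sub[OF that(1-3)] that(4) \<psi>c[OF that(1,5)]] \<psi>n that by simp
    show ?thesis unfolding balanced_map_def b_def using 1 2 3 by simp
  qed
  have \<phi>h: "\<phi> y \<in> module_hom K (T y) (Val M y)" if "y \<in> Ob G" for y
    unfolding \<phi>_def by (rule tensor_setup.tensor_lift_hom[OF tensor_setup M.Val_space bal]) (use that in auto)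
  have \<phi>pt: "\<phi> y (pt y (x, g, n)) = Act M x y g (\<psi> x n)"
    if "y \<in> Ob G" "x \<in> Ob G" "g \<in> carrier (Hom G x y)" "n \<in> carrier (Val N x)" for y x g n
    using tensor_setup.tensor_lift_pt[OF tensor_setup[OF that(1)] M.Val_space[OF that(1)]
        bal[OF that(1)], of x g n] that
    unfolding \<phi>_def by (simp add: b_def)
  have "cat_module_hom K G I M \<phi>"
    unfolding cat_module_hom_def
  proof (intro conjI ballI)
    fix x assume "x \<in> Ob G" then show "\<phi> x \<in> module_hom K (Val I x) (Val M x)" using \<phi>h by simp
  next
    fix y z h t assume y: "y \<in> Ob G" and z: "z \<in> Ob G" and h: "h \<in> carrier (Hom G y z)" and t: "t \<in> carrier (Val I y)"
    have t': "t \<in> carrier (T y)" using t by simp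
    show "\<phi> z (Act I y z h t) = Act M y z h (\<phi> y t)"
      by (rule T_ext[OF y M.Val_space[OF z] module_hom_compose[OF Act_I_hom[OF y z h] \<phi>h[OF z]]
           module_hom_compose[OF \<phi>h[OF y] M.Act_hom[OF y z h]] _ t'])
        (simp add: Act_I_pt \<phi>pt y z h Comp_closed M.Act_Comp \<psi>c)
  qed
  moreover have "\<phi> x (unit x n) = \<psi> x n" if "x \<in> Ob G" "n \<in> carrier (Val N x)" for x n
    using that by (simp add: unit_def \<phi>pt Id_closed M.Act_Id \<psi>c)
  moreover have "\<phi>' y t = \<phi> y t"
    if \<phi>': "cat_module_hom K G I M \<phi>'" and u: "\<forall>x\<in>Ob G. \<forall>n\<in>carrier (Val N x). \<phi>' x (unit x n) = \<psi> x n"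
      and y: "y \<in> Ob G" and t: "t \<in> carrier (Val I y)" for \<phi>' y t
  proof -
    have t': "t \<in> carrier (T y)" using t by simp
    have h': "\<phi>' y \<in> module_hom K (T y) (Val M y)" using \<phi>' y unfolding cat_module_hom_def by simp
    show ?thesis
    proof (rule T_ext[OF y M.Val_space[OF y] h' \<phi>h[OF y] _ t'])
      fix x g n assume x: "x \<in> Ob G" and g: "g \<in> carrier (Hom G x y)" and n: "n \<in> carrier (Val N x)"
      have un: "unit x n \<in> carrier (Val I x)" using x n by (simp add: unit_def pt_closed Id_closed)
      have "pt y (x, g, n) = Act I x y g (unit x n)"
        using x y g n by (simp add: unit_def Act_I_pt Id_closed Id_right)
      then have "\<phi>' y (pt y (x, g, n)) = Act M x y g (\<phi>' x (unit x n))"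
        using \<phi>' x y g un unfolding cat_module_hom_def by simp
      then show "\<phi>' y (pt y (x, g, n)) = \<phi> y (pt y (x, g, n))"
        using u x y g n by (simp add: \<phi>pt)
    qed
  qed
  ultimately show ?thesis by blast
qed

end

subsection \<open>Vectors of simple modules\<close>

lemma vs_subspaceI:
  assumes "vectorspace K V" "S \<subseteq> carrier V" "\<zero>\<^bsub>V\<^esub> \<in> S"
    "\<And>u v. \<lbrakk>u \<in> S; v \<in> S\<rbrakk> \<Longrightarrow> u \<oplus>\<^bsub>V\<^esub> v \<in> S"
    "\<And>a v. \<lbrakk>a \<in> carrier K; v \<in> S\<rbrakk> \<Longrightarrow> a \<odot>\<^bsub>V\<^esub> v \<in> S"
  shows "VectorSpace.subspace K S V"
  unfolding VectorSpace.subspace_def LinearCombinations.submodule_def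
  using assms vs_module by auto

lemma vs_subspaceD:
  assumes "VectorSpace.subspace K S V"
  shows "S \<subseteq> carrier V" "\<zero>\<^bsub>V\<^esub> \<in> S"
    "\<And>u v. \<lbrakk>u \<in> S; v \<in> S\<rbrakk> \<Longrightarrow> u \<oplus>\<^bsub>V\<^esub> v \<in> S"
    "\<And>a v. \<lbrakk>a \<in> carrier K; v \<in> S\<rbrakk> \<Longrightarrow> a \<odot>\<^bsub>V\<^esub> v \<in> S"
  using assms unfolding VectorSpace.subspace_def LinearCombinations.submodule_def by auto

lemma simple_module_transport:
  fixes N :: "('o, 'm, 'k, 'v) lin_functor" and e :: "'o \<Rightarrow> 'v \<Rightarrow> 'w"
  assumes N: "simple_module K C N"
    and inj: "\<And>y. y \<in> Ob C \<Longrightarrow> inj_on (e y) (carrier (Val N y))"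
  shows "\<exists>S :: ('o, 'm, 'k, 'w) lin_functor. simple_module K C S \<and> cat_module_iso K C N S"
proof -
  interpret N: cat_module K C N using N by (simp add: simple_module_def)
  define i where "i y = inv_into (carrier (Val N y)) (e y)" for y
  have i: "i y (e y v) = v" if "y \<in> Ob C" "v \<in> carrier (Val N y)" for y v
    using inv_into_f_f[OF inj[OF that(1)] that(2)] by (simp add: i_def)
  define S :: "('o, 'm, 'k, 'w) lin_functor" where
    "S = \<lparr>Val = (\<lambda>y. \<lparr>carrier = e y ` carrier (Val N y), monoid.mult = undefined, one = undefined,
        zero = e y \<zero>\<^bsub>Val N y\<^esub>, add = (\<lambda>a b. e y (i y a \<oplus>\<^bsub>Val N y\<^esub> i y b)),
        smult = (\<lambda>c a. e y (c \<odot>\<^bsub>Val N y\<^esub> i y a))\<rparr>),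
      Act = (\<lambda>x y f a. e y (Act N x y f (i x a)))\<rparr>"
  have Sc: "carrier (Val S y) = e y ` carrier (Val N y)" "\<zero>\<^bsub>Val S y\<^esub> = e y \<zero>\<^bsub>Val N y\<^esub>" for y
    by (simp_all add: S_def)
  have Sa: "e y u \<oplus>\<^bsub>Val S y\<^esub> e y v = e y (u \<oplus>\<^bsub>Val N y\<^esub> v)"
    if "y \<in> Ob C" "u \<in> carrier (Val N y)" "v \<in> carrier (Val N y)" for y u v
    using that i by (simp add: S_def)
  have Ss: "c \<odot>\<^bsub>Val S y\<^esub> e y v = e y (c \<odot>\<^bsub>Val N y\<^esub> v)"
    if "y \<in> Ob C" "v \<in> carrier (Val N y)" for y c v
    using that i by (simp add: S_def)
  have SA: "Act S x y f (e x v) = e y (Act N x y f v)"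
    if "x \<in> Ob C" "v \<in> carrier (Val N x)" for x y f v
    using that i by (simp add: S_def)
  have vsS: "vectorspace K (Val S y)" if "y \<in> Ob C" for y
    by (rule vectorspace_surj[OF N.Val_space[OF that], of _ "e y"]) (use that in \<open>simp_all add: Sc Sa Ss\<close>)
  have Acl: "Act N x y f v \<in> carrier (Val N y)"
    if "x \<in> Ob C" "y \<in> Ob C" "f \<in> carrier (Hom C x y)" "v \<in> carrier (Val N x)" for x y f v
    using module_hom_closed[OF N.Act_hom[OF that(1-3)]] that by blast
  have eh: "e y \<in> module_hom K (Val N y) (Val S y)" if "y \<in> Ob C" for y
    unfolding module_hom_def using that by (auto simp: Sc Sa Ss)
  have mS: "cat_module K C S"
  proof (intro cat_module.intro cat_module_axioms.intro N.linear_category_axioms)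
    fix x assume "x \<in> Ob C" then show "vectorspace K (Val S x)" by (rule vsS)
  next
    fix x y f assume x: "x \<in> Ob C" and y: "y \<in> Ob C" and f: "f \<in> carrier (Hom C x y)"
    interpret X: vectorspace K "Val N x" using N.Val_space x by blast
    note A = N.Act_hom[OF x y f]
    show "Act S x y f \<in> module_hom K (Val S x) (Val S y)"
      unfolding module_hom_def
    proof (intro CollectI conjI allI impI)
      show "Act S x y f \<in> carrier (Val S x) \<rightarrow> carrier (Val S y)"
        using x y f by (auto simp: Sc SA Acl)
    next
      fix a b assume "a \<in> carrier (Val S x) \<and> b \<in> carrier (Val S x)"
      then obtain u v where "a = e x u" "b = e x v" "u \<in> carrier (Val N x)" "v \<in> carrier (Val N x)"
        by (auto simp: Sc)
      then show "Act S x y f (a \<oplus>\<^bsub>Val S x\<^esub> b) = Act S x y f a \<oplus>\<^bsub>Val S y\<^esub> Act S x y f b"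
        using x y f module_hom_add[OF A] by (simp add: Sa SA Acl)
    next
      fix c a assume "c \<in> carrier K \<and> a \<in> carrier (Val S x)"
      then obtain u where "a = e x u" "u \<in> carrier (Val N x)" "c \<in> carrier K" by (auto simp: Sc)
      then show "Act S x y f (c \<odot>\<^bsub>Val S x\<^esub> a) = c \<odot>\<^bsub>Val S y\<^esub> Act S x y f a"
        using x y f module_hom_smult[OF A] by (simp add: Ss SA Acl)
    qed
  next
    fix x y a assume x: "x \<in> Ob C" and y: "y \<in> Ob C" and "a \<in> carrier (Val S x)"
    then obtain v where v: "v \<in> carrier (Val N x)" "a = e x v" by (auto simp: Sc)
    show "(\<lambda>f. Act S x y f a) \<in> module_hom K (Hom C x y) (Val S y)"
      using module_hom_compose[OF N.Act_linear[OF x y v(1)] eh[OF y]] x v by (simp add: SA)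
  next
    fix x a assume "x \<in> Ob C" "a \<in> carrier (Val S x)"
    then show "Act S x x (Id C x) a = a" by (auto simp: Sc SA N.Act_Id)
  next
    fix x y z f g a assume "x \<in> Ob C" "y \<in> Ob C" "z \<in> Ob C" "f \<in> carrier (Hom C x y)"
      "g \<in> carrier (Hom C y z)" "a \<in> carrier (Val S x)"
    then show "Act S x z (Comp C x y z g f) a = Act S y z g (Act S x y f a)"
      by (auto simp: Sc SA Acl N.Act_Comp)
  qed
  have iso: "cat_module_iso K C N S"
    unfolding cat_module_iso_def cat_module_hom_def
    by (rule exI[of _ e]) (auto simp: eh SA Sc bij_betw_def inj)
  obtain x where x: "x \<in> Ob C" "carrier (Val N x) \<noteq> {\<zero>\<^bsub>Val N x\<^esub>}"
    using N by (auto simp: simple_module_def)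
  have z: "\<zero>\<^bsub>Val N y\<^esub> \<in> carrier (Val N y)" if "y \<in> Ob C" for y
  proof -
    interpret X: vectorspace K "Val N y" using N.Val_space that by blast
    show ?thesis by simp
  qed
  have nz: "carrier (Val S x) \<noteq> {\<zero>\<^bsub>Val S x\<^esub>}"
  proof
    assume "carrier (Val S x) = {\<zero>\<^bsub>Val S x\<^esub>}"
    then have "e x ` carrier (Val N x) = e x ` {\<zero>\<^bsub>Val N x\<^esub>}" by (simp add: Sc)
    then have "carrier (Val N x) = {\<zero>\<^bsub>Val N x\<^esub>}"
      using inj_on_image_eq_iff[OF inj[OF x(1)]] z x by blast
    then show False using x by simp
  qed
  have "(\<forall>x\<in>Ob C. T x = {\<zero>\<^bsub>Val S x\<^esub>}) \<or> (\<forall>x\<in>Ob C. T x = carrier (Val S x))"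
    if T: "cat_submodule K C S T" for T
  proof -
    define T' where "T' y = {v. y \<in> Ob C \<and> v \<in> carrier (Val N y) \<and> e y v \<in> T y}" for y
    have Ts: "VectorSpace.subspace K (T y) (Val S y)" if "y \<in> Ob C" for y
      using T that by (simp add: cat_submodule_def)
    have T_eq: "T y = e y ` T' y" if "y \<in> Ob C" for y
      using vs_subspaceD(1)[OF Ts[OF that]] that by (auto simp: T'_def Sc)
    have "cat_submodule K C N T'"
      unfolding cat_submodule_def
    proof (intro conjI ballI allI impI)
      fix y assume y: "y \<in> Ob C"
      interpret Y: vectorspace K "Val N y" using N.Val_space y by blast
      note s = vs_subspaceD[OF Ts[OF y]]
      show "VectorSpace.subspace K (T' y) (Val N y)"
      proof (rule vs_subspaceI[OF N.Val_space[OF y]])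
        show "\<zero>\<^bsub>Val N y\<^esub> \<in> T' y" using s(2) y by (simp add: T'_def Sc)
        show "u \<oplus>\<^bsub>Val N y\<^esub> v \<in> T' y" if "u \<in> T' y" "v \<in> T' y" for u v
          using that s(3)[of "e y u" "e y v"] y by (simp add: T'_def Sa)
        show "a \<odot>\<^bsub>Val N y\<^esub> v \<in> T' y" if "a \<in> carrier K" "v \<in> T' y" for a v
          using that s(4)[of a "e y v"] y by (simp add: T'_def Ss)
      qed (auto simp: T'_def)
    next
      fix x y f v assume *: "x \<in> Ob C" "y \<in> Ob C" "f \<in> carrier (Hom C x y)" "v \<in> T' x"
      then have "Act S x y f (e x v) \<in> T y" using T by (simp add: cat_submodule_def T'_def)
      then show "Act N x y f v \<in> T' y" using * by (simp add: T'_def SA Acl)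
    qed (simp add: T'_def)
    then have "(\<forall>x\<in>Ob C. T' x = {\<zero>\<^bsub>Val N x\<^esub>}) \<or> (\<forall>x\<in>Ob C. T' x = carrier (Val N x))"
      using N unfolding simple_module_def by blast
    then show ?thesis using T_eq by (auto simp: Sc)
  qed
  then have "simple_module K C S" unfolding simple_module_def using mS nz x(1) by blast
  then show ?thesis using iso by blast
qed

theorem simple_module_universe:
  fixes N :: "('o, 'm, 'k, 'v) lin_functor"
  assumes N: "simple_module K C N"
  shows "\<exists>S :: ('o, 'm, 'k, 'm set) lin_functor. simple_module K C S \<and> cat_module_iso K C N S"
proof -
  interpret N: cat_module K C N using N by (simp add: simple_module_def)
  obtain x where x: "x \<in> Ob C" "carrier (Val N x) \<noteq> {\<zero>\<^bsub>Val N x\<^esub>}"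
    using N by (auto simp: simple_module_def)
  interpret X: vectorspace K "Val N x" using N.Val_space x by blast
  obtain v where v: "v \<in> carrier (Val N x)" "v \<noteq> \<zero>\<^bsub>Val N x\<^esub>"
    using x X.M.zero_closed by blast
  define T where "T y = (if y \<in> Ob C then (\<lambda>f. Act N x y f v) ` carrier (Hom C x y) else {})" for y
  have "cat_submodule K C N T"
    unfolding cat_submodule_def
  proof (intro conjI ballI allI impI)
    fix y assume y: "y \<in> Ob C"
    interpret H: vectorspace K "Hom C x y" using N.Hom_space x y by blast
    note h = N.Act_linear[OF x(1) y v(1)]
    interpret h: mod_hom K "Hom C x y" "Val N y" "\<lambda>f. Act N x y f v"
      using h N.Val_space[OF y] N.Hom_space[OF x(1) y] by (simp add: mod_hom_def mod_hom_axioms_def vs_module)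
    show "VectorSpace.subspace K (T y) (Val N y)"
      using h.im_is_submodule N.Val_space[OF y] y
      by (simp add: VectorSpace.subspace_def T_def h.im_def)
  next
    fix y z g u assume *: "y \<in> Ob C" "z \<in> Ob C" "g \<in> carrier (Hom C y z)" "u \<in> T y"
    then obtain f where f: "f \<in> carrier (Hom C x y)" "u = Act N x y f v" by (auto simp: T_def)
    have "Comp C x y z g f \<in> carrier (Hom C x z)"
      using module_hom_closed[OF N.Comp_linear_left[OF x(1) *(1,2) f(1)]] * by blast
    moreover have "Act N y z g u = Act N x z (Comp C x y z g f) v"
      using N.Act_Comp[OF x(1) *(1,2) f(1) *(3) v(1)] f by simp
    ultimately show "Act N y z g u \<in> T z" using * by (simp add: T_def)
  qed (simp add: T_def)
  moreover have "v \<in> T x" using x v N.Act_Id[OF x(1) v(1)] N.Id_closed[OF x(1)]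
    by (force simp: T_def)
  ultimately have T: "\<forall>y\<in>Ob C. T y = carrier (Val N y)"
    using N v x unfolding simple_module_def by blast
  show ?thesis
  proof (rule simple_module_transport[OF N])
    fix y assume y: "y \<in> Ob C"
    show "inj_on (\<lambda>n. {f \<in> carrier (Hom C x y). Act N x y f v = n}) (carrier (Val N y))"
    proof (rule inj_onI)
      fix n n' assume "n \<in> carrier (Val N y)" "n' \<in> carrier (Val N y)"
        and eq: "{f \<in> carrier (Hom C x y). Act N x y f v = n} = {f \<in> carrier (Hom C x y). Act N x y f v = n'}"
      then have "n \<in> T y" using T y by blast
      then obtain f where "f \<in> carrier (Hom C x y)" "Act N x y f v = n" using y by (auto simp: T_def)
      then show "n = n'" using eq by blast
    qed
  qed
qed

end

theory Submission
  imports Defs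
begin

text \<open>The triangular decomposition \<open>Hom\<^sub>G = \<Oplus> Hom\<^sub>U \<otimes> Hom\<^sub>D\<close> shows that \<open>\<Delta>\<^sub>\<lambda>\<close> is spanned by tensors
  \<open>u \<otimes> n\<close> with \<open>u\<close> in \<open>U\<close> starting in the support of \<open>\<lambda>\<close>; hence it lives above \<open>supp \<lambda>\<close>, is generated by
  \<open>S\<^sub>\<lambda>\<close>, and restricts to a copy of \<open>S\<^sub>\<lambda>\<close> on \<open>supp \<lambda>\<close>. (That this copy is not killed uses the injectivity
  of the decomposition.) A submodule is proper iff it vanishes on \<open>supp \<lambda>\<close>, so there is a largest
  proper submodule: the vectors killed by all morphisms into \<open>supp \<lambda>\<close>. Conversely, a map from \<open>S\<^sub>\<lambda>\<close> to a
  \<open>G\<close>-module that vanishes strictly below \<open>supp \<lambda>\<close> is automatically \<open>D\<close>-linear and so extends to \<open>\<Delta>\<^sub>\<lambda>\<close>;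
  for a simple module one takes an object that is minimal among those where the module is non-zero and a simple
  submodule there, which exists by finite dimensionality.\<close>

text \<open>The hard point is that \<open>S\<^sub>\<lambda>\<close> survives in
  \<open>\<Delta>\<^sub>\<lambda>\<close>: a map back has to be balanced over all of
  \<open>D\<close>, not only over the middle category. For isomorphic \<open>x\<close> and
  \<open>z\<close>, \<open>Hom G x z\<close> is split into the middle morphisms and the span of the
  composites \<open>u d\<close> through objects not isomorphic to \<open>x\<close>. Injectivity in
  \<open>T3\<close> makes the two parts meet in zero. The projection to the first part is compatible
  with \<open>D\<close> because a non-zero path in \<open>D\<close> that starts and ends in one
  class cannot leave that class in between: \<open>D\<close> only goes down, and the order is
  antisymmetric.

  Multiplicities are suprema over filtrations. They are controlled by one fact: a middle submodule
  of \<open>\<Delta>\<^sub>\<lambda>\<close> is, on \<open>supp \<lambda>\<close>, either zero or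
  everything. The same fact gives the dichotomy behind the largest proper submodule. The simple
  quotient keeps the same bottom part, and this makes \<open>\<lambda>\<close> recoverable from it.

  Modules may have infinite-dimensional values. Finiteness comes from the Hom spaces, which yield
  simple middle submodules, and from the finite down-sets, which yield minimal objects.\<close>

section \<open>Subspaces and linear maps\<close>

lemma subspace_carrier:
  "vectorspace K V \<Longrightarrow> VectorSpace.subspace K (carrier V) V"
proof -
  assume V: "vectorspace K V"
  interpret vectorspace K V by (rule V)
  show ?thesis by (rule vs_subspaceI[OF V]) auto
qed

lemma subspace_zero:
  assumes "vectorspace K V" shows "VectorSpace.subspace K {\<zero>\<^bsub>V\<^esub>} V"
proof -
  interpret vectorspace K V by fact
  show ?thesis by (rule vs_subspaceI[OF assms]) auto
qed

lemma subspace_minus_closed: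
  assumes "VectorSpace.subspace K S V" "u \<in> S" "v \<in> S" shows "u \<ominus>\<^bsub>V\<^esub> v \<in> S"
proof -
  interpret V: vectorspace K V using assms by (simp add: VectorSpace.subspace_def)
  note s = vs_subspaceD[OF assms(1)]
  have "u \<oplus>\<^bsub>V\<^esub> (\<ominus>\<^bsub>K\<^esub> \<one>\<^bsub>K\<^esub>) \<odot>\<^bsub>V\<^esub> v \<in> S" using s(3,4) assms by simp
  moreover have "v \<in> carrier V" using s(1) assms by blast
  ultimately show ?thesis by (simp add: V.smult_minus_1 a_minus_def)
qed

lemma module_hom_zero:
  assumes "vectorspace K V" "vectorspace K W" "f \<in> module_hom K V W"
  shows "f \<zero>\<^bsub>V\<^esub> = \<zero>\<^bsub>W\<^esub>"
proof -
  interpret mod_hom K V W f using assms by (simp add: mod_hom_def mod_hom_axioms_def vs_module)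
  show ?thesis by (rule f0_is_0)
qed

lemma module_hom_minus:
  assumes "vectorspace K V" "vectorspace K W" "f \<in> module_hom K V W" "u \<in> carrier V" "v \<in> carrier V"
  shows "f (u \<ominus>\<^bsub>V\<^esub> v) = f u \<ominus>\<^bsub>W\<^esub> f v"
proof -
  interpret mod_hom K V W f using assms by (simp add: mod_hom_def mod_hom_axioms_def vs_module)
  show ?thesis using assms by simp
qed

lemma minus_eq_zero_iff:
  assumes "vectorspace K V" "u \<in> carrier V" "v \<in> carrier V"
  shows "u \<ominus>\<^bsub>V\<^esub> v = \<zero>\<^bsub>V\<^esub> \<longleftrightarrow> u = v"
proof -
  interpret V: vectorspace K V by fact
  show ?thesis using assms by (metis V.M.r_neg V.M.add.inv_equality V.M.minus_minus V.minus_eq V.M.a_inv_closed)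
qed

lemma module_hom_vimage_subspace:
  assumes "vectorspace K V" "f \<in> module_hom K V W" "VectorSpace.subspace K S W"
  shows "VectorSpace.subspace K {v \<in> carrier V. f v \<in> S} V"
proof -
  interpret V: vectorspace K V by fact
  have W: "vectorspace K W" using assms by (simp add: VectorSpace.subspace_def)
  note s = vs_subspaceD[OF assms(3)]
  show ?thesis
    by (rule vs_subspaceI)
      (use assms s module_hom_zero[OF assms(1) W assms(2)] in
        \<open>auto simp: module_hom_add[OF assms(2)] module_hom_smult[OF assms(2)]\<close>)
qed

lemma module_hom_image_subspace:
  assumes "vectorspace K W" "f \<in> module_hom K V W" "VectorSpace.subspace K S V"
  shows "VectorSpace.subspace K (f ` S) W"
proof -
  have V: "vectorspace K V" using assms by (simp add: VectorSpace.subspace_def)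
  note s = vs_subspaceD[OF assms(3)]
  have c: "f v \<in> carrier W" if "v \<in> S" for v
    using module_hom_closed[OF assms(2)] s that by blast
  show ?thesis
  proof (rule vs_subspaceI)
    show "\<zero>\<^bsub>W\<^esub> \<in> f ` S" using module_hom_zero[OF V assms(1,2)] s(2) by force
    fix u v assume "u \<in> f ` S" "v \<in> f ` S"
    then obtain u' v' where *: "u' \<in> S" "v' \<in> S" "u = f u'" "v = f v'" by blast
    then have "u \<oplus>\<^bsub>W\<^esub> v = f (u' \<oplus>\<^bsub>V\<^esub> v')"
      using module_hom_add[OF assms(2), of u' v'] subsetD[OF s(1)] by simp
    then show "u \<oplus>\<^bsub>W\<^esub> v \<in> f ` S" using * s(3) by blast
  next
    fix a u assume a: "a \<in> carrier K" and "u \<in> f ` S"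
    then obtain u' where *: "u' \<in> S" "u = f u'" by blast
    then have "a \<odot>\<^bsub>W\<^esub> u = f (a \<odot>\<^bsub>V\<^esub> u')"
      using module_hom_smult[OF assms(2) a, of u'] subsetD[OF s(1)] by simp
    then show "a \<odot>\<^bsub>W\<^esub> u \<in> f ` S" using a * s(4) by blast
  qed (use assms c in auto)
qed

section \<open>Isomorphism classes of objects and elementary rules for modules\<close>

context linear_category
begin

lemma Comp_closed: "\<lbrakk>x \<in> Ob C; y \<in> Ob C; z \<in> Ob C; f \<in> carrier (Hom C x y); g \<in> carrier (Hom C y z)\<rbrakk>
    \<Longrightarrow> Comp C x y z g f \<in> carrier (Hom C x z)"
  using module_hom_closed[OF Comp_linear_left] by blast


lemma Comp_zero_left: "\<lbrakk>x \<in> Ob C; y \<in> Ob C; z \<in> Ob C; f \<in> carrier (Hom C x y)\<rbrakk>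
    \<Longrightarrow> Comp C x y z \<zero>\<^bsub>Hom C y z\<^esub> f = \<zero>\<^bsub>Hom C x z\<^esub>"
  using module_hom_zero[OF Hom_space Hom_space Comp_linear_left] by simp

lemma Comp_zero_right: "\<lbrakk>x \<in> Ob C; y \<in> Ob C; z \<in> Ob C; g \<in> carrier (Hom C y z)\<rbrakk>
    \<Longrightarrow> Comp C x y z g \<zero>\<^bsub>Hom C x y\<^esub> = \<zero>\<^bsub>Hom C x z\<^esub>"
  using module_hom_zero[OF Hom_space Hom_space Comp_linear_right] by simp

lemma iso_ob_refl: "x \<in> Ob C \<Longrightarrow> iso_ob C x x"
  unfolding iso_ob_def using Id_closed Id_left by blast

lemma iso_ob_sym: "iso_ob C x y \<Longrightarrow> iso_ob C y x"
  unfolding iso_ob_def by blast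

lemma iso_ob_trans:
  assumes "iso_ob C x y" "iso_ob C y z" shows "iso_ob C x z"
proof -
  obtain f g where f: "x \<in> Ob C" "y \<in> Ob C" "f \<in> carrier (Hom C x y)" "g \<in> carrier (Hom C y x)"
    "Comp C x y x g f = Id C x" "Comp C y x y f g = Id C y"
    using assms(1) by (auto simp: iso_ob_def)
  obtain h k where h: "z \<in> Ob C" "h \<in> carrier (Hom C y z)" "k \<in> carrier (Hom C z y)"
    "Comp C y z y k h = Id C y" "Comp C z y z h k = Id C z"
    using assms(2) by (auto simp: iso_ob_def)
  have "Comp C x z x (Comp C z y x g k) (Comp C x y z h f) = Id C x"
    using f h by (simp add: Comp_assoc Comp_closed Id_left flip: Comp_assoc[of x y z y f h k])
  moreover have "Comp C z x z (Comp C x y z h f) (Comp C z y x g k) = Id C z"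
    using f h by (simp add: Comp_assoc Comp_closed Id_left flip: Comp_assoc[of z y x y k g f])
  ultimately show ?thesis
    unfolding iso_ob_def using f h Comp_closed by blast
qed

lemma iso_class_eq_iff:
  assumes "x \<in> Ob C" "y \<in> Ob C"
  shows "iso_class C x = iso_class C y \<longleftrightarrow> iso_ob C x y"
  unfolding iso_class_def using assms iso_ob_refl iso_ob_sym iso_ob_trans by blast

lemma iso_class_self: "x \<in> Ob C \<Longrightarrow> x \<in> iso_class C x"
  by (simp add: iso_class_def iso_ob_refl)

lemma iso_class_in: "x \<in> Ob C \<Longrightarrow> iso_class C x \<in> iso_classes C"
  by (simp add: iso_classes_def)

lemma iso_classes_Ob: "\<lbrakk>Y \<in> iso_classes C; x \<in> Y\<rbrakk> \<Longrightarrow> x \<in> Ob C"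
  by (auto simp: iso_classes_def iso_class_def iso_ob_def)

lemma iso_classes_eq: "\<lbrakk>Y \<in> iso_classes C; x \<in> Y\<rbrakk> \<Longrightarrow> Y = iso_class C x"
  using iso_class_eq_iff iso_classes_Ob[of Y x] by (auto simp: iso_classes_def) (auto simp: iso_class_def)

lemma iso_classes_iso:
  "\<lbrakk>Y \<in> iso_classes C; x \<in> Y\<rbrakk> \<Longrightarrow> y \<in> Y \<longleftrightarrow> iso_ob C x y"
  using iso_classes_eq by (auto simp: iso_class_def)

lemma class_rep_in: "Y \<in> iso_classes C \<Longrightarrow> class_rep Y \<in> Y"
  unfolding class_rep_def by (rule someI_ex) (use iso_class_self in \<open>auto simp: iso_classes_def\<close>)

end

context cat_module
begin

lemma Act_closed: "\<lbrakk>x \<in> Ob C; y \<in> Ob C; f \<in> carrier (Hom C x y); v \<in> carrier (Val N x)\<rbrakk>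
    \<Longrightarrow> Act N x y f v \<in> carrier (Val N y)"
  using module_hom_closed[OF Act_hom] by blast

lemma Val_zero_closed: "x \<in> Ob C \<Longrightarrow> \<zero>\<^bsub>Val N x\<^esub> \<in> carrier (Val N x)"
  using vs_subspaceD(2)[OF subspace_carrier[OF Val_space]] .

lemma Act_zero: "\<lbrakk>x \<in> Ob C; y \<in> Ob C; f \<in> carrier (Hom C x y)\<rbrakk>
    \<Longrightarrow> Act N x y f \<zero>\<^bsub>Val N x\<^esub> = \<zero>\<^bsub>Val N y\<^esub>"
  using module_hom_zero[OF Val_space Val_space Act_hom] .

lemma zero_Act: "\<lbrakk>x \<in> Ob C; y \<in> Ob C; v \<in> carrier (Val N x)\<rbrakk>
    \<Longrightarrow> Act N x y \<zero>\<^bsub>Hom C x y\<^esub> v = \<zero>\<^bsub>Val N y\<^esub>"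
  using module_hom_zero[OF Hom_space Val_space Act_linear] .

end

subsection \<open>Homomorphisms and submodules\<close>

lemma cat_module_homD:
  assumes "cat_module_hom K C N N' \<phi>"
  shows "x \<in> Ob C \<Longrightarrow> \<phi> x \<in> module_hom K (Val N x) (Val N' x)"
    and "\<lbrakk>x \<in> Ob C; v \<in> carrier (Val N x)\<rbrakk> \<Longrightarrow> \<phi> x v \<in> carrier (Val N' x)"
    and "\<lbrakk>x \<in> Ob C; y \<in> Ob C; f \<in> carrier (Hom C x y); v \<in> carrier (Val N x)\<rbrakk>
      \<Longrightarrow> \<phi> y (Act N x y f v) = Act N' x y f (\<phi> x v)"
  using assms module_hom_closed unfolding cat_module_hom_def by blast+

lemma cat_module_hom_comp:
  assumes "cat_module_hom K C N N' \<phi>" "cat_module_hom K C N' N'' \<psi>"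
  shows "cat_module_hom K C N N'' (\<lambda>x v. \<psi> x (\<phi> x v))"
  unfolding cat_module_hom_def
  using module_hom_compose[OF cat_module_homD(1)[OF assms(1)] cat_module_homD(1)[OF assms(2)]]
    cat_module_homD(2,3)[OF assms(1)] cat_module_homD(3)[OF assms(2)] by simp

lemma module_hom_id: "(\<lambda>v. v) \<in> module_hom K V V"
  by (simp add: module_hom_def)

lemma cat_module_iso_refl: "cat_module_iso K C N N"
  unfolding cat_module_iso_def cat_module_hom_def
  by (rule exI[of _ "\<lambda>x v. v"]) (auto simp: module_hom_id bij_betw_def)

lemma cat_module_iso_trans:
  assumes "cat_module_iso K C N N'" "cat_module_iso K C N' N''" shows "cat_module_iso K C N N''"
proof -
  obtain \<phi> \<psi> where "cat_module_hom K C N N' \<phi>" "cat_module_hom K C N' N'' \<psi>"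
    "\<forall>x\<in>Ob C. bij_betw (\<phi> x) (carrier (Val N x)) (carrier (Val N' x))"
    "\<forall>x\<in>Ob C. bij_betw (\<psi> x) (carrier (Val N' x)) (carrier (Val N'' x))"
    using assms unfolding cat_module_iso_def by blast
  then show ?thesis unfolding cat_module_iso_def
    using cat_module_hom_comp[of K C N N' \<phi> N'' \<psi>] bij_betw_trans[of "\<phi> _" _ _ "\<psi> _"]
    by (intro exI[of _ "\<lambda>x v. \<psi> x (\<phi> x v)"]) (auto simp: comp_def)
qed

lemma cat_module_iso_sym:
  assumes N: "cat_module K C N" and iso: "cat_module_iso K C N N'" shows "cat_module_iso K C N' N"
proof -
  interpret N: cat_module K C N by fact
  obtain \<phi> where h: "cat_module_hom K C N N' \<phi>"
    and b: "\<And>x. x \<in> Ob C \<Longrightarrow> bij_betw (\<phi> x) (carrier (Val N x)) (carrier (Val N' x))"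
    using iso unfolding cat_module_iso_def by blast
  define \<psi> where "\<psi> x = inv_into (carrier (Val N x)) (\<phi> x)" for x
  have \<psi>: "bij_betw (\<psi> x) (carrier (Val N' x)) (carrier (Val N x))" if "x \<in> Ob C" for x
    unfolding \<psi>_def by (rule bij_betw_inv_into[OF b[OF that]])
  have c: "\<psi> x v \<in> carrier (Val N x)" "\<phi> x (\<psi> x v) = v" if "x \<in> Ob C" "v \<in> carrier (Val N' x)" for x v
    using bij_betwE[OF \<psi>[OF that(1)]] that bij_betw_inv_into_right[OF b] by (auto simp: \<psi>_def)
  have eq: "\<psi> x w = v" if "x \<in> Ob C" "v \<in> carrier (Val N x)" "\<phi> x v = w" for x v w
    using bij_betw_inv_into_left[OF b] that by (auto simp: \<psi>_def)
  have "cat_module_hom K C N' N \<psi>"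
    unfolding cat_module_hom_def
  proof (intro conjI ballI)
    fix x assume x: "x \<in> Ob C"
    interpret V: vectorspace K "Val N x" using N.Val_space x by blast
    note hx = cat_module_homD(1)[OF h x]
    show "\<psi> x \<in> module_hom K (Val N' x) (Val N x)"
      unfolding module_hom_def using x c
      by (auto intro!: eq simp: module_hom_add[OF hx] module_hom_smult[OF hx])
  next
    fix x y f v assume "x \<in> Ob C" "y \<in> Ob C" "f \<in> carrier (Hom C x y)" "v \<in> carrier (Val N' x)"
    then show "\<psi> y (Act N' x y f v) = Act N x y f (\<psi> x v)"
      using c by (auto intro!: eq simp: N.Act_closed cat_module_homD(3)[OF h])
  qed
  then show ?thesis unfolding cat_module_iso_def using \<psi> by blast
qed

lemma cat_submoduleD:
  assumes "cat_submodule K C N T"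
  shows "x \<in> Ob C \<Longrightarrow> VectorSpace.subspace K (T x) (Val N x)"
    and "x \<in> Ob C \<Longrightarrow> T x \<subseteq> carrier (Val N x)"
    and "x \<in> Ob C \<Longrightarrow> \<zero>\<^bsub>Val N x\<^esub> \<in> T x"
    and "\<lbrakk>x \<in> Ob C; y \<in> Ob C; f \<in> carrier (Hom C x y); v \<in> T x\<rbrakk> \<Longrightarrow> Act N x y f v \<in> T y"
    and "x \<notin> Ob C \<Longrightarrow> T x = {}"
  using assms vs_subspaceD(1,2) unfolding cat_submodule_def by metis+


text \<open>The module axioms are equations, so they pass along maps that are onto and commute with
  all operations. \<open>Q\<close> enters as a bare record, which allows structures on cosets to be
  checked on representatives.\<close>

lemma cat_module_surj:
  assumes N: "cat_module K C N"
    and c: "\<And>x. x \<in> Ob C \<Longrightarrow> carrier (Val Q x) = e x ` carrier (Val N x)"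
    and z: "\<And>x. x \<in> Ob C \<Longrightarrow> \<zero>\<^bsub>Val Q x\<^esub> = e x \<zero>\<^bsub>Val N x\<^esub>"
    and a: "\<And>x u v. \<lbrakk>x \<in> Ob C; u \<in> carrier (Val N x); v \<in> carrier (Val N x)\<rbrakk>
      \<Longrightarrow> e x u \<oplus>\<^bsub>Val Q x\<^esub> e x v = e x (u \<oplus>\<^bsub>Val N x\<^esub> v)"
    and s: "\<And>x b v. \<lbrakk>x \<in> Ob C; b \<in> carrier K; v \<in> carrier (Val N x)\<rbrakk>
      \<Longrightarrow> b \<odot>\<^bsub>Val Q x\<^esub> e x v = e x (b \<odot>\<^bsub>Val N x\<^esub> v)"
    and A: "\<And>x y f v. \<lbrakk>x \<in> Ob C; y \<in> Ob C; f \<in> carrier (Hom C x y); v \<in> carrier (Val N x)\<rbrakk>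
      \<Longrightarrow> Act Q x y f (e x v) = e y (Act N x y f v)"
  shows "cat_module K C Q" "cat_module_hom K C N Q e"
proof -
  interpret N: cat_module K C N by fact
  have eh: "e y \<in> module_hom K (Val N y) (Val Q y)" if "y \<in> Ob C" for y
    unfolding module_hom_def using that by (auto simp: c a s)
  show "cat_module_hom K C N Q e"
    unfolding cat_module_hom_def by (auto simp: eh A)
  have cl: "u \<oplus>\<^bsub>Val N x\<^esub> v \<in> carrier (Val N x)"
    if "x \<in> Ob C" "u \<in> carrier (Val N x)" "v \<in> carrier (Val N x)" for x u v
    using vs_subspaceD(3)[OF subspace_carrier[OF N.Val_space[OF that(1)]]] that by blast
  have cl': "b \<odot>\<^bsub>Val N x\<^esub> v \<in> carrier (Val N x)"
    if "x \<in> Ob C" "v \<in> carrier (Val N x)" "b \<in> carrier K" for x v b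
    using vs_subspaceD(4)[OF subspace_carrier[OF N.Val_space[OF that(1)]]] that by blast
  show "cat_module K C Q"
  proof (intro cat_module.intro cat_module_axioms.intro N.linear_category_axioms)
    fix x assume "x \<in> Ob C" then show "vectorspace K (Val Q x)"
      by (intro vectorspace_surj[OF N.Val_space, of x _ "e x"]) (simp_all add: c z a s)
  next
    fix x y f assume x: "x \<in> Ob C" and y: "y \<in> Ob C" and f: "f \<in> carrier (Hom C x y)"
    note B = N.Act_hom[OF x y f]
    show "Act Q x y f \<in> module_hom K (Val Q x) (Val Q y)"
      unfolding module_hom_def using x y f
      by (auto simp: c A a s N.Act_closed cl cl' module_hom_add[OF B] module_hom_smult[OF B])
  next
    fix x y v assume x: "x \<in> Ob C" and y: "y \<in> Ob C" and "v \<in> carrier (Val Q x)"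
    then obtain u where u: "u \<in> carrier (Val N x)" "v = e x u" by (auto simp: c)
    show "(\<lambda>f. Act Q x y f v) \<in> module_hom K (Hom C x y) (Val Q y)"
      using module_hom_compose[OF N.Act_linear[OF x y u(1)] eh[OF y]] x y u
        vs_subspaceD(3,4)[OF subspace_carrier[OF N.Hom_space[OF x y]]]
      by (auto simp: module_hom_def A)
  next
    fix x v assume "x \<in> Ob C" "v \<in> carrier (Val Q x)"
    then show "Act Q x x (Id C x) v = v" by (auto simp: c A N.Act_Id N.Id_closed)
  next
    fix x y z f g v assume "x \<in> Ob C" "y \<in> Ob C" "z \<in> Ob C" "f \<in> carrier (Hom C x y)"
      "g \<in> carrier (Hom C y z)" "v \<in> carrier (Val Q x)"
    then show "Act Q x z (Comp C x y z g f) v = Act Q y z g (Act Q x y f v)"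
      by (auto simp: c A N.Act_closed N.Act_Comp N.Comp_closed)
  qed
qed

lemma sub_module_simps [simp]:
  "carrier (Val (sub_module N T) x) = T x" "\<zero>\<^bsub>Val (sub_module N T) x\<^esub> = \<zero>\<^bsub>Val N x\<^esub>"
  "add (Val (sub_module N T) x) = add (Val N x)" "smult (Val (sub_module N T) x) = smult (Val N x)"
  "Act (sub_module N T) = Act N"
  by (simp_all add: sub_module_def)

lemma sub_module_is_module:
  assumes N: "cat_module K C N" and T: "cat_submodule K C N T"
  shows "cat_module K C (sub_module N T)"
proof -
  interpret N: cat_module K C N by fact
  note t = cat_submoduleD[OF T]
  show ?thesis
  proof (intro cat_module.intro cat_module_axioms.intro N.linear_category_axioms)
    fix x assume x: "x \<in> Ob C"
    interpret X: vectorspace K "Val N x" using N.Val_space x by blast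
    show "vectorspace K (Val (sub_module N T) x)"
      using X.subspace_is_vs[OF t(1)[OF x]] by (simp add: sub_module_def)
  next
    fix x y f assume *: "x \<in> Ob C" "y \<in> Ob C" "f \<in> carrier (Hom C x y)"
    then show "Act (sub_module N T) x y f \<in> module_hom K (Val (sub_module N T) x) (Val (sub_module N T) y)"
      using N.Act_hom[OF *] t(2)[OF *(1)] t(4)[OF *] by (auto simp: module_hom_def subset_iff)
  next
    fix x y v assume *: "x \<in> Ob C" "y \<in> Ob C" "v \<in> carrier (Val (sub_module N T) x)"
    then show "(\<lambda>f. Act (sub_module N T) x y f v) \<in> module_hom K (Hom C x y) (Val (sub_module N T) y)"
      using N.Act_linear[OF *(1,2), of v] t(2)[OF *(1)] t(4)[OF *(1,2)] by (auto simp: module_hom_def subset_iff)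
  next
    fix x v assume "x \<in> Ob C" "v \<in> carrier (Val (sub_module N T) x)"
    then show "Act (sub_module N T) x x (Id C x) v = v" using N.Act_Id t(2) by auto
  next
    fix x y z f g v assume "x \<in> Ob C" "y \<in> Ob C" "z \<in> Ob C" "f \<in> carrier (Hom C x y)"
      "g \<in> carrier (Hom C y z)" "v \<in> carrier (Val (sub_module N T) x)"
    then show "Act (sub_module N T) x z (Comp C x y z g f) v
        = Act (sub_module N T) y z g (Act (sub_module N T) x y f v)"
      using N.Act_Comp t(2)[of x] by (simp add: subset_iff)
  qed
qed

lemma sub_module_inclusion:
  assumes "cat_submodule K C N T" shows "cat_module_hom K C (sub_module N T) N (\<lambda>x v. v)"
  using cat_submoduleD(2)[OF assms] unfolding cat_module_hom_def module_hom_def by (auto simp: subset_iff)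

text \<open>Lets questions about submodules of a submodule be asked inside the ambient
  module.\<close>

lemma cat_submodule_sub_module:
  assumes T: "cat_submodule K C N T" and N: "cat_module K C N"
  shows "cat_submodule K C (sub_module N T) T' \<longleftrightarrow>
    cat_submodule K C N T' \<and> (\<forall>x\<in>Ob C. T' x \<subseteq> T x)"
proof -
  have s: "VectorSpace.subspace K (T' x) (Val (sub_module N T) x) \<longleftrightarrow>
      VectorSpace.subspace K (T' x) (Val N x) \<and> T' x \<subseteq> T x" if "x \<in> Ob C" for x
  proof
    assume "VectorSpace.subspace K (T' x) (Val (sub_module N T) x)"
    note s = vs_subspaceD[OF this]
    show "VectorSpace.subspace K (T' x) (Val N x) \<and> T' x \<subseteq> T x"
      using s cat_submoduleD(2)[OF T that] by (auto intro!: vs_subspaceI cat_module.Val_space[OF N that])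
  next
    assume a: "VectorSpace.subspace K (T' x) (Val N x) \<and> T' x \<subseteq> T x"
    note s = vs_subspaceD[OF conjunct1[OF a]]
    show "VectorSpace.subspace K (T' x) (Val (sub_module N T) x)"
      using s conjunct2[OF a] by (auto intro!: vs_subspaceI cat_module.Val_space[OF sub_module_is_module[OF N T] that])
  qed
  show ?thesis unfolding cat_submodule_def using s by (auto simp: sub_module_simps)
qed

text \<open>Empty off the objects, as the last conjunct of \<open>cat_submodule\<close> demands. The
  same convention shapes \<open>full_sub\<close>, \<open>hom_vimage\<close> and
  \<open>hom_image\<close>.\<close>

definition zero_sub :: "('o, 'm, 'k) lin_category \<Rightarrow> ('o, 'm, 'k, 'v) lin_functor \<Rightarrow> 'o \<Rightarrow> 'v set" where
  "zero_sub C N x = (if x \<in> Ob C then {\<zero>\<^bsub>Val N x\<^esub>} else {})"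

definition full_sub :: "('o, 'm, 'k) lin_category \<Rightarrow> ('o, 'm, 'k, 'v) lin_functor \<Rightarrow> 'o \<Rightarrow> 'v set" where
  "full_sub C N x = (if x \<in> Ob C then carrier (Val N x) else {})"

lemma zero_submodule: assumes "cat_module K C N" shows "cat_submodule K C N (zero_sub C N)"
  using cat_module.Val_space[OF assms] cat_module.Act_zero[OF assms] subspace_zero
  unfolding cat_submodule_def zero_sub_def by fastforce

lemma full_submodule: assumes "cat_module K C N" shows "cat_submodule K C N (full_sub C N)"
  using cat_module.Val_space[OF assms] cat_module.Act_closed[OF assms] subspace_carrier
  unfolding cat_submodule_def full_sub_def by fastforce

definition hom_vimage :: "('o, 'm, 'k) lin_category \<Rightarrow> ('o, 'm, 'k, 'v) lin_functor
    \<Rightarrow> ('o \<Rightarrow> 'v \<Rightarrow> 'w) \<Rightarrow> ('o \<Rightarrow> 'w set) \<Rightarrow> 'o \<Rightarrow> 'v set" where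
  "hom_vimage C N \<phi> T x = {v. x \<in> Ob C \<and> v \<in> carrier (Val N x) \<and> \<phi> x v \<in> T x}"

definition hom_image :: "('o, 'm, 'k) lin_category \<Rightarrow> ('o \<Rightarrow> 'v \<Rightarrow> 'w) \<Rightarrow> ('o \<Rightarrow> 'v set) \<Rightarrow> 'o \<Rightarrow> 'w set" where
  "hom_image C \<phi> T x = (if x \<in> Ob C then \<phi> x ` T x else {})"

lemma vimage_submodule:
  assumes N: "cat_module K C N" and h: "cat_module_hom K C N N' \<phi>" and T: "cat_submodule K C N' T"
  shows "cat_submodule K C N (hom_vimage C N \<phi> T)"
  unfolding cat_submodule_def
proof (intro conjI ballI allI impI)
  interpret N: cat_module K C N by fact
  fix x assume x: "x \<in> Ob C"
  show "VectorSpace.subspace K (hom_vimage C N \<phi> T x) (Val N x)"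
    using module_hom_vimage_subspace[OF N.Val_space[OF x] cat_module_homD(1)[OF h x] cat_submoduleD(1)[OF T x]] x
    by (simp add: hom_vimage_def)
  fix y f v assume "y \<in> Ob C" "f \<in> carrier (Hom C x y)" "v \<in> hom_vimage C N \<phi> T x"
  then show "Act N x y f v \<in> hom_vimage C N \<phi> T y"
    by (simp add: hom_vimage_def N.Act_closed cat_module_homD(3)[OF h] cat_submoduleD(4)[OF T])
qed (simp add: hom_vimage_def)

lemma image_submodule:
  assumes N': "cat_module K C N'" and h: "cat_module_hom K C N N' \<phi>" and T: "cat_submodule K C N T"
  shows "cat_submodule K C N' (hom_image C \<phi> T)"
  unfolding cat_submodule_def
proof (intro conjI ballI allI impI)
  interpret N': cat_module K C N' by fact
  fix x assume x: "x \<in> Ob C"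
  show "VectorSpace.subspace K (hom_image C \<phi> T x) (Val N' x)"
    using module_hom_image_subspace[OF N'.Val_space[OF x] cat_module_homD(1)[OF h x] cat_submoduleD(1)[OF T x]] x
    by (simp add: hom_image_def)
  fix y f v assume *: "y \<in> Ob C" "f \<in> carrier (Hom C x y)" "v \<in> hom_image C \<phi> T x"
  then obtain u where u: "u \<in> T x" "v = \<phi> x u" using x by (auto simp: hom_image_def)
  then have "Act N' x y f v = \<phi> y (Act N x y f u)"
    using cat_module_homD(3)[OF h x *(1,2)] subsetD[OF cat_submoduleD(2)[OF T x]] by simp
  then show "Act N' x y f v \<in> hom_image C \<phi> T y"
    using cat_submoduleD(4)[OF T x *(1,2) u(1)] * by (simp add: hom_image_def)
qed (simp add: hom_image_def)

subsection \<open>Quotients\<close>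

text \<open>Presents \<open>Q\<close> as \<open>N / T\<close> by a surjection with kernel
  \<open>T\<close>, so that later arguments work with elements of \<open>N\<close> instead of
  cosets.\<close>

definition quotient_map :: "'k ring \<Rightarrow> ('o, 'm, 'k) lin_category \<Rightarrow> ('o, 'm, 'k, 'v) lin_functor
    \<Rightarrow> ('o \<Rightarrow> 'v set) \<Rightarrow> ('o, 'm, 'k, 'w) lin_functor \<Rightarrow> ('o \<Rightarrow> 'v \<Rightarrow> 'w) \<Rightarrow> bool" where
  "quotient_map K C N T Q p \<longleftrightarrow> cat_module_hom K C N Q p \<and>
    (\<forall>x\<in>Ob C. p x ` carrier (Val N x) = carrier (Val Q x)) \<and>
    (\<forall>x\<in>Ob C. \<forall>v\<in>carrier (Val N x). p x v = \<zero>\<^bsub>Val Q x\<^esub> \<longleftrightarrow> v \<in> T x)"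

lemma quotient_map_eq_iff:
  assumes N: "cat_module K C N" and Q: "cat_module K C Q" and p: "quotient_map K C N T Q p"
    and x: "x \<in> Ob C" and "u \<in> carrier (Val N x)" "v \<in> carrier (Val N x)"
  shows "p x u = p x v \<longleftrightarrow> u \<ominus>\<^bsub>Val N x\<^esub> v \<in> T x"
proof -
  interpret N: cat_module K C N by fact
  interpret Q: cat_module K C Q by fact
  interpret V: vectorspace K "Val N x" using N.Val_space x by blast
  have h: "cat_module_hom K C N Q p" using p by (simp add: quotient_map_def)
  have "p x (u \<ominus>\<^bsub>Val N x\<^esub> v) = p x u \<ominus>\<^bsub>Val Q x\<^esub> p x v"
    by (rule module_hom_minus[OF N.Val_space[OF x] Q.Val_space[OF x] cat_module_homD(1)[OF h x]]) fact+
  moreover have "u \<ominus>\<^bsub>Val N x\<^esub> v \<in> T x \<longleftrightarrow> p x (u \<ominus>\<^bsub>Val N x\<^esub> v) = \<zero>\<^bsub>Val Q x\<^esub>"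
    using p x assms(5,6) by (auto simp: quotient_map_def)
  ultimately show ?thesis
    using minus_eq_zero_iff[OF Q.Val_space[OF x], of "p x u" "p x v"] cat_module_homD(2)[OF h x] assms by simp
qed

text \<open>The action on cosets is well defined because \<open>T\<close> is stable: representatives
  that differ by \<open>w\<close> in \<open>T x\<close> are sent to elements that differ by the
  image of \<open>w\<close>, which lies in \<open>T y\<close>.\<close>

lemma quot_module_quotient:
  assumes N: "cat_module K C N" and T: "cat_submodule K C N T"
  shows quot_module_is_module: "cat_module K C (quot_module N T)"
    and quot_module_quotient_map:
      "quotient_map K C N T (quot_module N T) (\<lambda>x v. T x +>\<^bsub>Val N x\<^esub> v)"
proof -
  interpret N: cat_module K C N by fact
  note t = cat_submoduleD[OF T]
  have A: "Act (quot_module N T) x y f (T x +>\<^bsub>Val N x\<^esub> v) = T y +>\<^bsub>Val N y\<^esub> Act N x y f v"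
    if *: "x \<in> Ob C" "y \<in> Ob C" "f \<in> carrier (Hom C x y)" "v \<in> carrier (Val N x)" for x y f v
  proof -
    interpret V: abelian_subgroup "T x" "Val N x" using subspace_add_subgroup[OF t(1)[OF *(1)]] .
    interpret W: vectorspace K "Val N y" using N.Val_space * by blast
    have "the_elem ((\<lambda>v. T y +>\<^bsub>Val N y\<^esub> Act N x y f v) ` (T x +>\<^bsub>Val N x\<^esub> v)) = T y +>\<^bsub>Val N y\<^esub> Act N x y f v"
    proof (rule the_elem_image_unique)
      show "T x +>\<^bsub>Val N x\<^esub> v \<noteq> {}" using V.a_rcos_self * by blast
      fix u assume "u \<in> T x +>\<^bsub>Val N x\<^esub> v"
      then obtain w where w: "w \<in> T x" "u = w \<oplus>\<^bsub>Val N x\<^esub> v" by (auto simp: a_r_coset_def')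
      have wc: "w \<in> carrier (Val N x)" using w t(2) * by blast
      have u: "Act N x y f u = Act N x y f w \<oplus>\<^bsub>Val N y\<^esub> Act N x y f v"
        using module_hom_add[OF N.Act_hom[OF *(1-3)] wc *(4)] w by simp
      have "Act N x y f u \<ominus>\<^bsub>Val N y\<^esub> Act N x y f v = Act N x y f w"
        unfolding u using N.Act_closed[OF *(1-3)] wc *(4)
        by (simp add: W.minus_eq W.M.a_assoc W.M.r_neg)
      then show "T y +>\<^bsub>Val N y\<^esub> Act N x y f u = T y +>\<^bsub>Val N y\<^esub> Act N x y f v"
        using coset_eq_iff[OF t(1)[OF *(2)]] t(4)[OF *(1-3) w(1)] u N.Act_closed[OF *(1-3)] wc *(4) by simp
    qed
    then show ?thesis by (simp add: quot_module_def)
  qed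
  have V: "Val (quot_module N T) x = quot_space (Val N x) (T x)" for x
    by (simp add: quot_module_def)
  note q = quot_space_carrier quot_space_zero[OF t(1)] quot_space_add[OF t(1)] quot_space_smult[OF t(1)]
  have m: "cat_module K C (quot_module N T)"
      "cat_module_hom K C N (quot_module N T) (\<lambda>x v. T x +>\<^bsub>Val N x\<^esub> v)"
    by (rule cat_module_surj[OF N, where e = "\<lambda>x v. T x +>\<^bsub>Val N x\<^esub> v"]; simp add: V q A)+
  show "cat_module K C (quot_module N T)" by (rule m)
  have "T x +>\<^bsub>Val N x\<^esub> v = \<zero>\<^bsub>Val (quot_module N T) x\<^esub> \<longleftrightarrow> v \<in> T x"
    if x: "x \<in> Ob C" and v: "v \<in> carrier (Val N x)" for x v
  proof -
    interpret W: vectorspace K "Val N x" using N.Val_space x by blast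
    have "v \<ominus>\<^bsub>Val N x\<^esub> \<zero>\<^bsub>Val N x\<^esub> = v"
      using v by (metis W.M.add.inv_one W.M.r_zero W.minus_eq a_inv_def)
    then show ?thesis using coset_eq_iff[OF t(1)[OF x] v W.M.zero_closed] v x
      by (simp add: V q)
  qed
  then show "quotient_map K C N T (quot_module N T) (\<lambda>x v. T x +>\<^bsub>Val N x\<^esub> v)"
    unfolding quotient_map_def using m by (simp add: V q)
qed

lemma quotient_map_compose_iso:
  assumes "cat_module K C Q" "cat_module K C Q'"
    and p: "quotient_map K C N T Q p" and h: "cat_module_hom K C Q Q' \<phi>"
    and b: "\<forall>x\<in>Ob C. bij_betw (\<phi> x) (carrier (Val Q x)) (carrier (Val Q' x))"
  shows "quotient_map K C N T Q' (\<lambda>x v. \<phi> x (p x v))"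
proof -
  interpret Q: cat_module K C Q by fact
  interpret Q': cat_module K C Q' by fact
  have hp: "cat_module_hom K C N Q p" using p by (simp add: quotient_map_def)
  have z: "\<phi> x u = \<zero>\<^bsub>Val Q' x\<^esub> \<longleftrightarrow> u = \<zero>\<^bsub>Val Q x\<^esub>" if "x \<in> Ob C" "u \<in> carrier (Val Q x)" for x u
    using inj_on_eq_iff[of "\<phi> x" "carrier (Val Q x)" u "\<zero>\<^bsub>Val Q x\<^esub>"] b that
      module_hom_zero[OF Q.Val_space Q'.Val_space cat_module_homD(1)[OF h]] Q.Val_zero_closed
    by (auto simp: bij_betw_def)
  have im: "(\<lambda>v. \<phi> x (p x v)) ` carrier (Val N x) = carrier (Val Q' x)" if "x \<in> Ob C" for x
    using b p that unfolding quotient_map_def bij_betw_def by (metis image_image)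
  show ?thesis unfolding quotient_map_def
    using cat_module_hom_comp[OF hp h] im z cat_module_homD(2)[OF hp] p
    by (auto simp: quotient_map_def)
qed

text \<open>Both maps identify exactly the pairs whose difference lies in \<open>T\<close>. Hence
  \<open>p'\<close> is constant on the fibres of \<open>p\<close>, and the preimage picked by
  \<open>inv_into\<close> does not matter.\<close>

lemma iso_of_quotient_maps:
  assumes N: "cat_module K C N" and Q: "cat_module K C Q" and Q': "cat_module K C Q'"
    and p: "quotient_map K C N T Q p" and p': "quotient_map K C N T Q' p'"
  shows "cat_module_iso K C Q Q'"
proof -
  interpret N: cat_module K C N by fact
  interpret Q: cat_module K C Q by fact
  have h: "cat_module_hom K C N Q p" "cat_module_hom K C N Q' p'" using p p' by (simp_all add: quotient_map_def)
  have eq: "p' x u = p' x v \<longleftrightarrow> p x u = p x v"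
    if "x \<in> Ob C" "u \<in> carrier (Val N x)" "v \<in> carrier (Val N x)" for x u v
    using quotient_map_eq_iff[OF N Q p that] quotient_map_eq_iff[OF N Q' p' that] by simp
  define \<phi> where "\<phi> x w = p' x (inv_into (carrier (Val N x)) (p x) w)" for x w
  have \<phi>: "\<phi> x (p x v) = p' x v" if "x \<in> Ob C" "v \<in> carrier (Val N x)" for x v
    unfolding \<phi>_def using eq[OF that(1)] that
    by (simp add: f_inv_into_f inv_into_into)
  have c: "carrier (Val Q x) = p x ` carrier (Val N x)" "carrier (Val Q' x) = p' x ` carrier (Val N x)"
    if "x \<in> Ob C" for x using p p' that by (simp_all add: quotient_map_def)
  have "cat_module_hom K C Q Q' \<phi>"
    unfolding cat_module_hom_def
  proof (intro conjI ballI)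
    fix x assume x: "x \<in> Ob C"
    interpret V: vectorspace K "Val N x" using N.Val_space x by blast
    note hx = cat_module_homD(1)[OF h(1) x] cat_module_homD(1)[OF h(2) x]
    show "\<phi> x \<in> module_hom K (Val Q x) (Val Q' x)"
      unfolding module_hom_def using x
      by (auto simp: c \<phi> module_hom_add[OF hx(2)] module_hom_smult[OF hx(2)]
          simp flip: module_hom_add[OF hx(1)] module_hom_smult[OF hx(1)])
  next
    fix x y f w assume *: "x \<in> Ob C" "y \<in> Ob C" "f \<in> carrier (Hom C x y)" "w \<in> carrier (Val Q x)"
    then obtain v where v: "v \<in> carrier (Val N x)" "w = p x v" by (auto simp: c)
    show "\<phi> y (Act Q x y f w) = Act Q' x y f (\<phi> x w)"
      unfolding v(2) \<phi>[OF *(1) v(1)]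
      by (simp add: cat_module_homD(3)[OF h(1) *(1-3) v(1), symmetric]
          cat_module_homD(3)[OF h(2) *(1-3) v(1), symmetric] \<phi> * N.Act_closed v)
  qed
  moreover have "bij_betw (\<phi> x) (carrier (Val Q x)) (carrier (Val Q' x))" if "x \<in> Ob C" for x
    unfolding bij_betw_def inj_on_def using that by (auto simp: c \<phi> eq image_image)
  ultimately show ?thesis unfolding cat_module_iso_def by blast
qed

lemma iso_quot_module_iff:
  assumes N: "cat_module K C N" and T: "cat_submodule K C N T" and Q: "cat_module K C Q"
  shows "cat_module_iso K C (quot_module N T) Q \<longleftrightarrow> (\<exists>p. quotient_map K C N T Q p)"
proof
  assume "cat_module_iso K C (quot_module N T) Q"
  then obtain \<phi> where "cat_module_hom K C (quot_module N T) Q \<phi>"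
    "\<forall>x\<in>Ob C. bij_betw (\<phi> x) (carrier (Val (quot_module N T) x)) (carrier (Val Q x))"
    unfolding cat_module_iso_def by blast
  then show "\<exists>p. quotient_map K C N T Q p"
    using quotient_map_compose_iso[OF quot_module_is_module[OF N T] Q quot_module_quotient_map[OF N T]] by blast
next
  assume "\<exists>p. quotient_map K C N T Q p"
  then show "cat_module_iso K C (quot_module N T) Q"
    using iso_of_quotient_maps[OF N quot_module_is_module[OF N T] Q quot_module_quotient_map[OF N T]] by blast
qed

text \<open>\<open>T\<close> is the kernel, obtained as the preimage of the zero submodule.\<close>

lemma surj_hom_quotient_map:
  assumes N: "cat_module K C N" and Q: "cat_module K C Q" and h: "cat_module_hom K C N Q p"
    and "\<And>x. x \<in> Ob C \<Longrightarrow> p x ` carrier (Val N x) = carrier (Val Q x)"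
  obtains T where "cat_submodule K C N T" "quotient_map K C N T Q p"
  using that[OF vimage_submodule[OF N h zero_submodule[OF Q]]] assms
  by (simp add: quotient_map_def hom_vimage_def zero_sub_def)

text \<open>The correspondence between submodules of \<open>Q\<close> and submodules of
  \<open>N\<close> containing \<open>T\<close>, by image and preimage. As \<open>Q\<close> is any
  module presented by a quotient map, simplicity can be moved between a concrete module and the
  \<open>quot_module\<close> with the same kernel.\<close>

lemma simple_quotient_iff:
  assumes N: "cat_module K C N" and T: "cat_submodule K C N T" and Q: "cat_module K C Q"
    and p: "quotient_map K C N T Q p"
  shows "simple_module K C Q \<longleftrightarrow> (\<exists>x\<in>Ob C. T x \<noteq> carrier (Val N x)) \<and>
    (\<forall>T'. cat_submodule K C N T' \<and> (\<forall>x\<in>Ob C. T x \<subseteq> T' x) \<longrightarrow>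
      (\<forall>x\<in>Ob C. T' x = T x) \<or> (\<forall>x\<in>Ob C. T' x = carrier (Val N x)))"
proof -
  interpret N: cat_module K C N by fact
  interpret Q: cat_module K C Q by fact
  have h: "cat_module_hom K C N Q p" using p by (simp add: quotient_map_def)
  have c: "carrier (Val Q x) = p x ` carrier (Val N x)" if "x \<in> Ob C" for x
    using p that by (simp add: quotient_map_def)
  have k: "p x v = \<zero>\<^bsub>Val Q x\<^esub> \<longleftrightarrow> v \<in> T x" if "x \<in> Ob C" "v \<in> carrier (Val N x)" for x v
    using p that by (simp add: quotient_map_def)
  note t = cat_submoduleD[OF T]
  have nz: "carrier (Val Q x) \<noteq> {\<zero>\<^bsub>Val Q x\<^esub>} \<longleftrightarrow> T x \<noteq> carrier (Val N x)" if "x \<in> Ob C" for x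
  proof -
    have "carrier (Val Q x) = {\<zero>\<^bsub>Val Q x\<^esub>} \<longleftrightarrow> (\<forall>v\<in>carrier (Val N x). p x v = \<zero>\<^bsub>Val Q x\<^esub>)"
      using N.Val_zero_closed[OF that] unfolding c[OF that] by (auto simp: image_iff)
    then show ?thesis using k[OF that] t(2)[OF that] by auto
  qed
  have im: "hom_image C p T' x = {\<zero>\<^bsub>Val Q x\<^esub>} \<longleftrightarrow> T' x = T x"
      "hom_image C p T' x = carrier (Val Q x) \<longleftrightarrow> T' x = carrier (Val N x)"
    if T': "cat_submodule K C N T'" and sub: "T x \<subseteq> T' x" and x: "x \<in> Ob C" for x T'
  proof -
    interpret V: vectorspace K "Val N x" using N.Val_space x by blast
    note t' = cat_submoduleD[OF T']
    show "hom_image C p T' x = {\<zero>\<^bsub>Val Q x\<^esub>} \<longleftrightarrow> T' x = T x"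
    proof -
      have "hom_image C p T' x = {\<zero>\<^bsub>Val Q x\<^esub>} \<longleftrightarrow> (\<forall>v\<in>T' x. p x v = \<zero>\<^bsub>Val Q x\<^esub>)"
        using t'(3)[OF x] x by (auto simp: hom_image_def image_iff)
      also have "\<dots> \<longleftrightarrow> T' x \<subseteq> T x" using k[OF x] t'(2)[OF x] by (auto simp: subset_iff)
      finally show ?thesis using sub by blast
    qed
    have "v \<in> T' x" if "hom_image C p T' x = carrier (Val Q x)" "v \<in> carrier (Val N x)" for v
    proof -
      have "p x v \<in> p x ` T' x" using that x by (auto simp: c hom_image_def)
      then obtain u where u: "u \<in> T' x" "p x u = p x v" by fastforce
      have uc: "u \<in> carrier (Val N x)" using u t'(2)[OF x] by blast
      \<comment> \<open>Elements with equal image differ by an element of \<open>T x\<close>, which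
        is contained in \<open>T' x\<close>.\<close>
      have "v \<ominus>\<^bsub>Val N x\<^esub> u \<in> T' x" using quotient_map_eq_iff[OF N Q p x that(2) uc] u sub by auto
      then have "(v \<ominus>\<^bsub>Val N x\<^esub> u) \<oplus>\<^bsub>Val N x\<^esub> u \<in> T' x"
        using vs_subspaceD(3)[OF t'(1)[OF x]] u by blast
      then show ?thesis using that uc by (simp add: V.minus_eq V.M.a_assoc V.M.l_neg)
    qed
    then show "hom_image C p T' x = carrier (Val Q x) \<longleftrightarrow> T' x = carrier (Val N x)"
      using t'(2)[OF x] x by (auto simp: hom_image_def c)
  qed
  have iv: "hom_image C p (hom_vimage C N p S) x = S x" if "cat_submodule K C Q S" for S x
    using cat_submoduleD(2,5)[OF that, of x] c[of x]
    by (auto simp: hom_image_def hom_vimage_def image_def)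
  have subv: "T x \<subseteq> hom_vimage C N p S x" if "cat_submodule K C Q S" "x \<in> Ob C" for S x
  proof
    fix v assume v: "v \<in> T x"
    then have vc: "v \<in> carrier (Val N x)" using t(2)[OF that(2)] by blast
    then have "p x v = \<zero>\<^bsub>Val Q x\<^esub>" using k[OF that(2)] v by simp
    then show "v \<in> hom_vimage C N p S x" using cat_submoduleD(3)[OF that] that(2) vc by (simp add: hom_vimage_def)
  qed
  have "(\<forall>S. cat_submodule K C Q S \<longrightarrow>
      (\<forall>x\<in>Ob C. S x = {\<zero>\<^bsub>Val Q x\<^esub>}) \<or> (\<forall>x\<in>Ob C. S x = carrier (Val Q x))) \<longleftrightarrow>
    (\<forall>T'. cat_submodule K C N T' \<and> (\<forall>x\<in>Ob C. T x \<subseteq> T' x) \<longrightarrow>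
      (\<forall>x\<in>Ob C. T' x = T x) \<or> (\<forall>x\<in>Ob C. T' x = carrier (Val N x)))" (is "?L \<longleftrightarrow> ?R")
  proof
    assume L: ?L
    show ?R
    proof (intro allI impI)
      fix T' assume T': "cat_submodule K C N T' \<and> (\<forall>x\<in>Ob C. T x \<subseteq> T' x)"
      then have "cat_submodule K C Q (hom_image C p T')" using image_submodule[OF Q h] by blast
      then have "(\<forall>x\<in>Ob C. hom_image C p T' x = {\<zero>\<^bsub>Val Q x\<^esub>}) \<or>
          (\<forall>x\<in>Ob C. hom_image C p T' x = carrier (Val Q x))"
        using L by blast
      then show "(\<forall>x\<in>Ob C. T' x = T x) \<or> (\<forall>x\<in>Ob C. T' x = carrier (Val N x))"
        using im[of T'] T' by auto
    qed
  next
    assume R: ?R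
    show ?L
    proof (intro allI impI)
      fix S assume S: "cat_submodule K C Q S"
      have v: "cat_submodule K C N (hom_vimage C N p S)" using vimage_submodule[OF N h S] .
      then show "(\<forall>x\<in>Ob C. S x = {\<zero>\<^bsub>Val Q x\<^esub>}) \<or> (\<forall>x\<in>Ob C. S x = carrier (Val Q x))"
      proof -
        have "(\<forall>x\<in>Ob C. hom_vimage C N p S x = T x) \<or> (\<forall>x\<in>Ob C. hom_vimage C N p S x = carrier (Val N x))"
          using R v subv[OF S] by blast
        then show ?thesis
        proof
          assume "\<forall>x\<in>Ob C. hom_vimage C N p S x = T x"
          then show ?thesis using im(1)[OF v subv[OF S]] iv[OF S] by simp
        next
          assume "\<forall>x\<in>Ob C. hom_vimage C N p S x = carrier (Val N x)"
          then show ?thesis using im(2)[OF v subv[OF S]] iv[OF S] by simp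
        qed
      qed
    qed
  qed
  moreover have "(\<exists>x\<in>Ob C. carrier (Val Q x) \<noteq> {\<zero>\<^bsub>Val Q x\<^esub>}) \<longleftrightarrow> (\<exists>x\<in>Ob C. T x \<noteq> carrier (Val N x))"
    using nz by simp
  ultimately show ?thesis unfolding simple_module_def using Q by simp
qed

subsection \<open>Subspaces and projections\<close>

text \<open>The intersection is taken inside \<open>carrier V\<close>, so that the empty family is
  covered as well.\<close>

lemma subspace_Inter:
  assumes "vectorspace K V" "\<And>W. W \<in> \<W> \<Longrightarrow> VectorSpace.subspace K W V"
  shows "VectorSpace.subspace K {v \<in> carrier V. \<forall>W\<in>\<W>. v \<in> W} V"
proof -
  interpret V: vectorspace K V by fact
  show ?thesis
    by (rule vs_subspaceI[OF assms(1)]) (simp_all add: vs_subspaceD(2,3,4)[OF assms(2)])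
qed

lemma subspace_finsum:
  assumes "VectorSpace.subspace K S V" "\<And>a. a \<in> A \<Longrightarrow> f a \<in> S"
  shows "finsum V f A \<in> S"
proof -
  interpret V: vectorspace K V using assms by (simp add: VectorSpace.subspace_def)
  note s = vs_subspaceD[OF assms(1)]
  show ?thesis
  proof (cases "finite A")
    case True
    then show ?thesis using assms(2)
    proof (induction A)
      case (insert a A)
      have "f \<in> A \<rightarrow> carrier V" "f a \<in> carrier V" using insert s(1) by blast+
      then show ?case using insert s(3) by simp
    qed (simp add: s)
  qed (simp add: s)
qed

lemma quot_proj_hom:
  assumes "VectorSpace.subspace K W V"
  shows "(\<lambda>v. W +>\<^bsub>V\<^esub> v) \<in> module_hom K V (quot_space V W)"
  unfolding module_hom_def
  by (auto simp: quot_space_carrier quot_space_add[OF assms] quot_space_smult[OF assms])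

lemma zero_module_hom:
  assumes "vectorspace K W" shows "(\<lambda>v. \<zero>\<^bsub>W\<^esub>) \<in> module_hom K V W"
proof -
  interpret W: vectorspace K W by fact
  show ?thesis by (auto simp: module_hom_def)
qed

lemma mem_iff_coset_zero:
  assumes W: "VectorSpace.subspace K W V" and v: "v \<in> carrier V"
  shows "W +>\<^bsub>V\<^esub> v = \<zero>\<^bsub>quot_space V W\<^esub> \<longleftrightarrow> v \<in> W"
proof -
  interpret V: vectorspace K V using W by (simp add: VectorSpace.subspace_def)
  have "v \<ominus>\<^bsub>V\<^esub> \<zero>\<^bsub>V\<^esub> = v"
    using v by (metis V.M.add.inv_one V.M.r_zero V.minus_eq a_inv_def)
  then show ?thesis
    using coset_eq_iff[OF W v V.M.zero_closed] quot_space_zero[OF W] by simp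
qed

text \<open>Modulo \<open>W\<close> the projection and the zero map agree on pure tensors, hence
  everywhere, because linear maps out of a tensor product are determined there.\<close>

lemma (in tensor_setup) tensor_span:
  assumes W: "VectorSpace.subspace K W T"
    and pt: "\<And>x p n. \<lbrakk>x \<in> Ob C; p \<in> carrier (Val P x); n \<in> carrier (Val N x)\<rbrakk> \<Longrightarrow> pt (x, p, n) \<in> W"
    and t: "t \<in> carrier T"
  shows "t \<in> W"
proof -
  have Q: "vectorspace K (quot_space T W)" by (rule quot_space_vectorspace[OF W])
  have "W +>\<^bsub>T\<^esub> t = \<zero>\<^bsub>quot_space T W\<^esub>"
  proof (rule tensor_hom_ext[OF Q quot_proj_hom[OF W] zero_module_hom[OF Q] _ t])
    fix x p n assume "x \<in> Ob C" "p \<in> carrier (Val P x)" "n \<in> carrier (Val N x)"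
    then show "W +>\<^bsub>T\<^esub> pt (x, p, n) = \<zero>\<^bsub>quot_space T W\<^esub>"
      using mem_iff_coset_zero[OF W] pt pt_closed by blast
  qed
  then show ?thesis using mem_iff_coset_zero[OF W t] by simp
qed

lemma subspace_sum:
  assumes A: "VectorSpace.subspace K A V" and B: "VectorSpace.subspace K B V"
  shows "VectorSpace.subspace K {a \<oplus>\<^bsub>V\<^esub> b | a b. a \<in> A \<and> b \<in> B} V"
proof -
  interpret V: vectorspace K V using A by (simp add: VectorSpace.subspace_def)
  have "V.submodule_sum A B = {a \<oplus>\<^bsub>V\<^esub> b | a b. a \<in> A \<and> b \<in> B}"
    by (auto simp: V.submodule_sum_def)
  then show ?thesis using V.sum_is_subspace[OF A B] by simp
qed

text \<open>The component in \<open>A\<close> is chosen by \<open>SOME\<close>; since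
  \<open>A\<close> and \<open>B\<close> meet only in zero, the choice is forced and therefore
  linear. The target is \<open>V\<close> with restricted carrier, which is the form of the Hom
  spaces of a subcategory.\<close>

lemma subspace_projection:
  assumes A: "VectorSpace.subspace K A V" and B: "VectorSpace.subspace K B V"
    and int: "A \<inter> B \<subseteq> {\<zero>\<^bsub>V\<^esub>}"
    and sum: "\<And>v. v \<in> carrier V \<Longrightarrow> \<exists>a\<in>A. \<exists>b\<in>B. v = a \<oplus>\<^bsub>V\<^esub> b"
  obtains \<pi> where "\<pi> \<in> module_hom K V (V\<lparr>carrier := A\<rparr>)" "\<And>a b. \<lbrakk>a \<in> A; b \<in> B\<rbrakk> \<Longrightarrow> \<pi> (a \<oplus>\<^bsub>V\<^esub> b) = a"
proof -
  interpret V: vectorspace K V using A by (simp add: VectorSpace.subspace_def)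
  note a = vs_subspaceD[OF A] and b = vs_subspaceD[OF B]
  define \<pi> where "\<pi> v = (SOME x. x \<in> A \<and> (\<exists>y\<in>B. v = x \<oplus>\<^bsub>V\<^esub> y))" for v
  have uniq: "x = x'" if "x \<in> A" "x' \<in> A" "y \<in> B" "y' \<in> B" "x \<oplus>\<^bsub>V\<^esub> y = x' \<oplus>\<^bsub>V\<^esub> y'" for x x' y y'
  proof -
    have c: "x \<in> carrier V" "x' \<in> carrier V" "y \<in> carrier V" "y' \<in> carrier V" using that a(1) b(1) by blast+
    have "x \<ominus>\<^bsub>V\<^esub> x' = ((x \<oplus>\<^bsub>V\<^esub> y) \<ominus>\<^bsub>V\<^esub> y) \<ominus>\<^bsub>V\<^esub> x'"
      using c by (simp add: V.minus_eq V.M.a_assoc V.M.r_neg)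
    also have "\<dots> = y' \<ominus>\<^bsub>V\<^esub> y"
    proof -
      have "x' \<oplus>\<^bsub>V\<^esub> y' \<oplus>\<^bsub>V\<^esub> \<ominus>\<^bsub>V\<^esub> y \<oplus>\<^bsub>V\<^esub> \<ominus>\<^bsub>V\<^esub> x' = (x' \<oplus>\<^bsub>V\<^esub> \<ominus>\<^bsub>V\<^esub> x') \<oplus>\<^bsub>V\<^esub> (y' \<oplus>\<^bsub>V\<^esub> \<ominus>\<^bsub>V\<^esub> y)"
        using c by (simp add: V.M.a_ac)
      then show ?thesis unfolding that(5) using c by (simp add: V.minus_eq V.M.r_neg)
    qed
    finally have "x \<ominus>\<^bsub>V\<^esub> x' \<in> A \<inter> B"
      using subspace_minus_closed[OF A that(1,2)] subspace_minus_closed[OF B that(4,3)] by simp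
    then show ?thesis using int minus_eq_zero_iff[OF _ c(1,2)] V.vectorspace_axioms by blast
  qed
  have \<pi>: "\<pi> (x \<oplus>\<^bsub>V\<^esub> y) = x" if "x \<in> A" "y \<in> B" for x y
    unfolding \<pi>_def by (rule some_equality) (use uniq that in blast)+
  have "\<pi> \<in> module_hom K V (V\<lparr>carrier := A\<rparr>)"
    unfolding module_hom_def
  proof (intro CollectI conjI allI impI)
    show "\<pi> \<in> carrier V \<rightarrow> carrier (V\<lparr>carrier := A\<rparr>)" using sum \<pi> by fastforce
  next
    fix v w assume "v \<in> carrier V \<and> w \<in> carrier V"
    then obtain x y x' y' where *: "x \<in> A" "y \<in> B" "v = x \<oplus>\<^bsub>V\<^esub> y" "x' \<in> A" "y' \<in> B" "w = x' \<oplus>\<^bsub>V\<^esub> y'"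
      using sum by meson
    have c: "x \<in> carrier V" "x' \<in> carrier V" "y \<in> carrier V" "y' \<in> carrier V" using * a(1) b(1) by blast+
    have "v \<oplus>\<^bsub>V\<^esub> w = (x \<oplus>\<^bsub>V\<^esub> x') \<oplus>\<^bsub>V\<^esub> (y \<oplus>\<^bsub>V\<^esub> y')" using * c by (simp add: V.M.a_ac)
    then show "\<pi> (v \<oplus>\<^bsub>V\<^esub> w) = \<pi> v \<oplus>\<^bsub>V\<lparr>carrier := A\<rparr>\<^esub> \<pi> w" using \<pi> * a(3) b(3) by simp
  next
    fix r v assume r: "r \<in> carrier K \<and> v \<in> carrier V"
    then obtain x y where *: "x \<in> A" "y \<in> B" "v = x \<oplus>\<^bsub>V\<^esub> y" using sum by meson
    have c: "x \<in> carrier V" "y \<in> carrier V" using * a(1) b(1) by blast+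
    have "r \<odot>\<^bsub>V\<^esub> v = (r \<odot>\<^bsub>V\<^esub> x) \<oplus>\<^bsub>V\<^esub> (r \<odot>\<^bsub>V\<^esub> y)" using * c r by (simp add: V.smult_r_distr)
    then show "\<pi> (r \<odot>\<^bsub>V\<^esub> v) = r \<odot>\<^bsub>V\<lparr>carrier := A\<rparr>\<^esub> \<pi> v" using \<pi> * a(4) b(4) r by simp
  qed
  then show thesis using that \<pi> by blast
qed

text \<open>A strictly larger subspace contains a strictly larger linearly independent set.\<close>

lemma (in vectorspace) minimal_subspace_exists:
  assumes fd: fin_dim and ne: "\<S> \<noteq> {}" and sub: "\<And>S. S \<in> \<S> \<Longrightarrow> VectorSpace.subspace K S V"
  shows "\<exists>S\<in>\<S>. \<forall>S'\<in>\<S>. S' \<subseteq> S \<longrightarrow> S' = S"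
proof -
  define ind where "ind S A \<longleftrightarrow> A \<subseteq> S \<and> lin_indpt A" for S A
  \<comment> \<open>This maximum plays the part of the dimension of \<open>S\<close> without making
    \<open>S\<close> a space of its own.\<close>
  define rank where "rank S = Max (card ` {A. ind S A})" for S
  have ind: "finite A" "card A \<le> dim" if "S \<in> \<S>" "ind S A" for S A
    using li_le_dim[OF fd, of A] that vs_subspaceD(1)[OF sub] by (auto simp: ind_def)
  have fin: "finite (card ` {A. ind S A})" if "S \<in> \<S>" for S
    by (rule finite_subset[of _ "{..dim}"]) (use ind[OF that] in auto)
  have "ind S {}" for S by (simp add: ind_def lin_dep_def)
  then have ne': "card ` {A. ind S A} \<noteq> {}" for S by blast
  obtain S where S: "S \<in> \<S>" and min: "\<And>S'. S' \<in> \<S> \<Longrightarrow> rank S \<le> rank S'"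
    using ex_has_least_nat[of "\<lambda>S. S \<in> \<S>" _ rank] ne by blast
  have "S' = S" if S': "S' \<in> \<S>" "S' \<subseteq> S" for S'
  proof (rule ccontr)
    assume "S' \<noteq> S"
    then obtain v where v: "v \<in> S" "v \<notin> S'" using S' by blast
    obtain A where A: "ind S' A" "card A = rank S'"
      using Max_in[OF fin[OF S'(1)] ne'] unfolding rank_def by force
    have sub': "submodule K S' V" using sub[OF S'(1)] by (simp add: VectorSpace.subspace_def)
    have c: "A \<subseteq> carrier V" "v \<in> carrier V" using A v S' vs_subspaceD(1)[OF sub] S by (auto simp: ind_def)
    have "span A \<subseteq> S'" using span_is_subset[OF _ sub'] A by (simp add: ind_def)
    then have "v \<notin> span A" using v by blast
    moreover have "v \<notin> A" using v A by (auto simp: ind_def)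
    ultimately have "ind S (A \<union> {v})"
      using lin_dep_iff_in_span[OF c(1) _ c(2)] A v S' by (auto simp: ind_def)
    then have "card (A \<union> {v}) \<le> rank S" unfolding rank_def by (intro Max_ge[OF fin[OF S]]) blast
    moreover have "card (A \<union> {v}) = Suc (card A)" using ind(1)[OF S'(1) A(1)] \<open>v \<notin> A\<close> by simp
    ultimately show False using min[OF S'(1)] A(2) by simp
  qed
  then show ?thesis using S by blast
qed

subsection \<open>Submodules and isomorphic objects\<close>

text \<open>An element at \<open>y\<close> is carried to \<open>x\<close> by the inverse
  isomorphism, compared there, and carried back. So an inclusion needs to be checked at only one
  object of each class.\<close>

lemma submodule_mono_iso:
  assumes N: "cat_module K C N" and T: "cat_submodule K C N T" and T': "cat_submodule K C N T'"
    and le: "T x \<subseteq> T' x" and iso: "iso_ob C x y"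
  shows "T y \<subseteq> T' y"
proof
  interpret N: cat_module K C N by fact
  fix a assume a: "a \<in> T y"
  obtain s s' where s: "x \<in> Ob C" "y \<in> Ob C" "s \<in> carrier (Hom C x y)" "s' \<in> carrier (Hom C y x)"
    "Comp C y x y s s' = Id C y"
    using iso unfolding iso_ob_def by blast
  have ac: "a \<in> carrier (Val N y)" using cat_submoduleD(2)[OF T s(2)] a by blast
  have "Act N y x s' a \<in> T' x" using cat_submoduleD(4)[OF T s(2,1,4) a] le by blast
  then have "Act N x y s (Act N y x s' a) \<in> T' y" using cat_submoduleD(4)[OF T' s(1,2,3)] by blast
  moreover have "Act N x y s (Act N y x s' a) = a"
    using N.Act_Comp[OF s(2,1,2,4,3) ac] N.Act_Id[OF s(2) ac] s(5) by simp
  ultimately show "a \<in> T' y" by simp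
qed

lemma zero_iso:
  assumes N: "cat_module K C N" and iso: "iso_ob C x y" and z: "carrier (Val N x) = {\<zero>\<^bsub>Val N x\<^esub>}"
  shows "carrier (Val N y) = {\<zero>\<^bsub>Val N y\<^esub>}"
proof -
  interpret N: cat_module K C N by fact
  have "x \<in> Ob C" "y \<in> Ob C" using iso by (auto simp: iso_ob_def)
  then show ?thesis
    using submodule_mono_iso[OF N full_submodule[OF N] zero_submodule[OF N] _ iso] z N.Val_zero_closed
    by (auto simp: full_sub_def zero_sub_def)
qed

text \<open>The submodule generated by the single vector \<open>v\<close> at \<open>x\<close>: every
  morphism out of \<open>x\<close> is applied once, and no sums are needed because the action is
  linear in the morphism.\<close>

definition cyclic_sub :: "('o, 'm, 'k) lin_category \<Rightarrow> ('o, 'm, 'k, 'v) lin_functor \<Rightarrow> 'o \<Rightarrow> 'v \<Rightarrow> 'o \<Rightarrow> 'v set" where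
  "cyclic_sub C N x v y = (if y \<in> Ob C then (\<lambda>f. Act N x y f v) ` carrier (Hom C x y) else {})"

lemma cyclic_submodule:
  assumes N: "cat_module K C N" and x: "x \<in> Ob C" and v: "v \<in> carrier (Val N x)"
  shows "cat_submodule K C N (cyclic_sub C N x v)" "v \<in> cyclic_sub C N x v x"
proof -
  interpret N: cat_module K C N by fact
  show "cat_submodule K C N (cyclic_sub C N x v)"
    unfolding cat_submodule_def
  proof (intro conjI ballI allI impI)
    fix y assume y: "y \<in> Ob C"
    show "VectorSpace.subspace K (cyclic_sub C N x v y) (Val N y)"
      using module_hom_image_subspace[OF N.Val_space[OF y] N.Act_linear[OF x y v]
          subspace_carrier[OF N.Hom_space[OF x y]]] y by (simp add: cyclic_sub_def)
    fix z g u assume *: "z \<in> Ob C" "g \<in> carrier (Hom C y z)" "u \<in> cyclic_sub C N x v y"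
    then obtain f where f: "f \<in> carrier (Hom C x y)" "u = Act N x y f v" using y by (auto simp: cyclic_sub_def)
    then have "Act N y z g u = Act N x z (Comp C x y z g f) v"
      using N.Act_Comp[OF x y *(1) f(1) *(2) v] by simp
    then show "Act N y z g u \<in> cyclic_sub C N x v z"
      using N.Comp_closed[OF x y *(1) f(1) *(2)] * by (simp add: cyclic_sub_def)
  qed (simp add: cyclic_sub_def)
  show "v \<in> cyclic_sub C N x v x"
    using N.Act_Id[OF x v] N.Id_closed[OF x] x by (force simp: cyclic_sub_def)
qed

lemma simple_sub_module_iff:
  assumes N: "cat_module K C N" and T: "cat_submodule K C N T"
  shows "simple_module K C (sub_module N T) \<longleftrightarrow> (\<exists>x\<in>Ob C. T x \<noteq> {\<zero>\<^bsub>Val N x\<^esub>}) \<and>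
    (\<forall>T'. cat_submodule K C N T' \<and> (\<forall>x\<in>Ob C. T' x \<subseteq> T x) \<longrightarrow>
      (\<forall>x\<in>Ob C. T' x = {\<zero>\<^bsub>Val N x\<^esub>}) \<or> (\<forall>x\<in>Ob C. T' x = T x))"
  unfolding simple_module_def cat_submodule_sub_module[OF T N]
  using sub_module_is_module[OF N T] by simp

subsection \<open>Multiplicities\<close>

text \<open>The filtration with terms zero, \<open>T\<close> and \<open>N\<close> has
  \<open>T\<close> itself as its first factor.\<close>

lemma multiplicity_pos:
  assumes N: "cat_module K C N" and T: "cat_submodule K C N T"
    and iso: "cat_module_iso K C (sub_module N T) S" and S: "cat_module K C S"
  shows "1 \<le> multiplicity_in K C S N"
proof -
  \<comment> \<open>All indices from 2 on give the whole module; only 0, 1 and 2 are used.\<close>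
  let ?F = "\<lambda>i::nat. if i = 0 then zero_sub C N else if i = 1 then T else full_sub C N"
  note t = cat_submoduleD[OF T]
  have F: "filtration K C N 2 ?F"
    unfolding filtration_def using T zero_submodule[OF N] full_submodule[OF N] t(2,3)
    by (auto simp: zero_sub_def full_sub_def)
  note sub = sub_module_is_module[OF N T]
  have z: "cat_submodule K C (sub_module N T) (zero_sub C N)"
    using cat_submodule_sub_module[OF T N] zero_submodule[OF N] t(3) by (auto simp: zero_sub_def)
  obtain \<phi> where \<phi>: "cat_module_hom K C (sub_module N T) S \<phi>"
    and b: "\<forall>x\<in>Ob C. bij_betw (\<phi> x) (carrier (Val (sub_module N T) x)) (carrier (Val S x))"
    using iso unfolding cat_module_iso_def by blast
  have id: "quotient_map K C (sub_module N T) (zero_sub C N) (sub_module N T) (\<lambda>x v. v)"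
    by (auto simp: quotient_map_def cat_module_hom_def module_hom_id zero_sub_def)
  have "cat_module_iso K C (quot_module (sub_module N (?F (Suc 0))) (?F 0)) S"
    using quotient_map_compose_iso[OF sub S id \<phi> b] iso_quot_module_iff[OF sub z S] by auto
  then have "{0} \<subseteq> {i. i < 2 \<and> cat_module_iso K C (quot_module (sub_module N (?F (Suc i))) (?F i)) S}"
    by simp
  from card_mono[OF _ this] have
    "(1::enat) \<le> enat (card {i. i < 2 \<and> cat_module_iso K C (quot_module (sub_module N (?F (Suc i))) (?F i)) S})"
    by (simp add: one_enat_def)
  also have "\<dots> \<le> multiplicity_in K C S N"
    unfolding multiplicity_in_def
    using F by (intro SUP_upper2[where i = "(2, ?F)"]) simp_all
  finally show ?thesis .
qed

lemma filtration_mono: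
  assumes F: "filtration K C N n F" and "i \<le> j" "j \<le> n" "x \<in> Ob C"
  shows "F i x \<subseteq> F j x"
  using assms(2,3)
proof (induction j rule: dec_induct)
  case (step j)
  then have "F j x \<subseteq> F (Suc j) x" using F assms(4) by (simp add: filtration_def)
  then show ?case using step by auto
qed simp

lemma filtration_factor:
  assumes N: "cat_module K C N" and F: "filtration K C N n F" and i: "i < n" and S: "cat_module K C S"
  shows "cat_module_iso K C (quot_module (sub_module N (F (Suc i))) (F i)) S \<longleftrightarrow>
    (\<exists>p. quotient_map K C (sub_module N (F (Suc i))) (F i) S p)"
proof -
  have s: "cat_submodule K C N (F (Suc i))" "cat_submodule K C N (F i)" "\<forall>x\<in>Ob C. F i x \<subseteq> F (Suc i) x"
    using F i by (auto simp: filtration_def)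
  show ?thesis
    by (rule iso_quot_module_iff[OF sub_module_is_module[OF N s(1)] _ S])
      (use cat_submodule_sub_module[OF s(1) N] s in blast)
qed

text \<open>If no filtration had a factor isomorphic to \<open>S\<close>, every term of the supremum
  would be zero.\<close>

lemma multiplicity_nonzeroE:
  assumes N: "cat_module K C N" and S: "cat_module K C S" and m: "multiplicity_in K C S N \<noteq> 0"
  obtains T T' p where "cat_submodule K C N T" "cat_submodule K C N T'" "\<forall>x\<in>Ob C. T' x \<subseteq> T x"
    "quotient_map K C (sub_module N T) T' S p"
proof -
  define A where "A n F = {i. i < n \<and>
        cat_module_iso K C (quot_module (sub_module N (F (Suc i))) (F i)) S}" for n F
  have "\<exists>n F. filtration K C N n F \<and> A n F \<noteq> {}"
  proof (rule ccontr)
    assume "\<not> ?thesis"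
    then have "multiplicity_in K C S N \<le> 0"
      unfolding multiplicity_in_def A_def[symmetric]
      by (intro SUP_least) (auto simp: zero_enat_def)
    then show False using m by simp
  qed
  then obtain n F i where F: "filtration K C N n F" and i: "i < n"
    "cat_module_iso K C (quot_module (sub_module N (F (Suc i))) (F i)) S"
    unfolding A_def by blast
  then obtain p where "quotient_map K C (sub_module N (F (Suc i))) (F i) S p"
    using filtration_factor[OF N F i(1) S] by blast
  then show thesis using that[of "F (Suc i)" "F i" p] F i by (auto simp: filtration_def)
qed

text \<open>A filtration can jump only once at \<open>x\<close>, and each factor isomorphic to \<open>S\<close> jumps there.\<close>

lemma multiplicity_le_one:
  assumes N: "cat_module K C N" and S: "cat_module K C S" and x: "x \<in> Ob C"
    and nz: "carrier (Val S x) \<noteq> {\<zero>\<^bsub>Val S x\<^esub>}"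
    and triv: "\<And>T. cat_submodule K C N T \<Longrightarrow> T x = {\<zero>\<^bsub>Val N x\<^esub>} \<or> T x = carrier (Val N x)"
  shows "multiplicity_in K C S N \<le> 1"
  unfolding multiplicity_in_def
proof (rule SUP_least, clarify)
  fix n F assume F: "filtration K C N n F"
  interpret N: cat_module K C N by fact
  let ?A = "{i. i < n \<and> cat_module_iso K C (quot_module (sub_module N (F (Suc i))) (F i)) S}"
  have jump: "F i x = {\<zero>\<^bsub>Val N x\<^esub>} \<and> F (Suc i) x \<noteq> {\<zero>\<^bsub>Val N x\<^esub>}" if i: "i \<in> ?A" for i
  proof -
    obtain p where p: "quotient_map K C (sub_module N (F (Suc i))) (F i) S p"
      using filtration_factor[OF N F _ S] i by blast
    then have im: "p x ` F (Suc i) x = carrier (Val S x)"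
      and k: "\<And>v. v \<in> F (Suc i) x \<Longrightarrow> p x v = \<zero>\<^bsub>Val S x\<^esub> \<longleftrightarrow> v \<in> F i x"
      using x by (auto simp: quotient_map_def)
    have sub: "cat_submodule K C N (F i)" "cat_submodule K C N (F (Suc i))" "F i x \<subseteq> F (Suc i) x"
      using F i x by (auto simp: filtration_def)
    have ne: "F i x \<noteq> F (Suc i) x"
    proof
      assume "F i x = F (Suc i) x"
      then have "carrier (Val S x) \<subseteq> {\<zero>\<^bsub>Val S x\<^esub>}" using im k by force
      then show False using nz cat_module.Val_zero_closed[OF S x] by blast
    qed
    then show ?thesis
      using triv[OF sub(1)] triv[OF sub(2)] sub(3) cat_submoduleD(2)[OF sub(2) x] cat_submoduleD(3)[OF sub(1) x]
      by blast
  qed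
  have "i = j" if "i \<in> ?A" "j \<in> ?A" "i \<le> j" for i j
  proof (rule ccontr)
    assume "i \<noteq> j"
    then have "F (Suc i) x \<subseteq> F j x" using filtration_mono[OF F, of "Suc i" j x] that x by auto
    then have "F (Suc i) x \<subseteq> {\<zero>\<^bsub>Val N x\<^esub>}" using jump[OF that(2)] by blast
    moreover have "\<zero>\<^bsub>Val N x\<^esub> \<in> F (Suc i) x"
      using F that x cat_submoduleD(3)[of K C N "F (Suc i)" x] by (auto simp: filtration_def)
    ultimately show False using jump[OF that(1)] by blast
  qed
  note le = this
  have eq: "i = j" if "i \<in> ?A" "j \<in> ?A" for i j
    by (rule linorder_le_cases[of i j]) (rule le[OF that], assumption, rule le[OF that(2,1), symmetric], assumption)
  have "finite ?A" by simp
  then have "card ?A \<le> Suc 0" using eq by (subst card_le_Suc0_iff_eq) blast+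
  then have "card ?A \<le> 1" by (simp only: One_nat_def)
  then show "enat (card ?A) \<le> 1" by (simp add: one_enat_def)
qed

subsection \<open>Categories without morphisms between non-isomorphic objects\<close>

text \<open>The form of the middle category: a module over it splits into independent pieces, one
  for each isomorphism class.\<close>

locale block_category = linear_category K C
  for K :: "'k ring" (structure) and C :: "('o, 'm, 'k) lin_category" +
  assumes Hom_iso: "\<lbrakk>x \<in> Ob C; y \<in> Ob C; f \<in> carrier (Hom C x y); f \<noteq> \<zero>\<^bsub>Hom C x y\<^esub>\<rbrakk> \<Longrightarrow> iso_ob C x y"
begin

lemma Act_not_iso:
  assumes "cat_module K C N" "x \<in> Ob C" "y \<in> Ob C" "\<not> iso_ob C x y" "f \<in> carrier (Hom C x y)" "v \<in> carrier (Val N x)"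
  shows "Act N x y f v = \<zero>\<^bsub>Val N y\<^esub>"
  using cat_module.zero_Act[OF assms(1-3,6)] Hom_iso[OF assms(2,3,5)] assms(4) by metis

definition class_part :: "('o, 'm, 'k, 'v) lin_functor \<Rightarrow> 'o set \<Rightarrow> 'o \<Rightarrow> 'v set" where
  "class_part N Y x = (if x \<in> Ob C then if x \<in> Y then carrier (Val N x) else {\<zero>\<^bsub>Val N x\<^esub>} else {})"

text \<open>Morphisms that enter or leave \<open>Y\<close> are zero, so cutting a module down to
  \<open>Y\<close> commutes with the action.\<close>

lemma class_part_submodule:
  assumes N: "cat_module K C N" and Y: "Y \<in> iso_classes C"
  shows "cat_submodule K C N (class_part N Y)"
  unfolding cat_submodule_def
proof (intro conjI ballI allI impI)
  interpret N: cat_module K C N by fact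
  fix x assume x: "x \<in> Ob C"
  show "VectorSpace.subspace K (class_part N Y x) (Val N x)"
    using x subspace_carrier[OF N.Val_space[OF x]] subspace_zero[OF N.Val_space[OF x]] by (simp add: class_part_def)
  fix y f v assume *: "y \<in> Ob C" "f \<in> carrier (Hom C x y)" "v \<in> class_part N Y x"
  have v: "v \<in> carrier (Val N x)" using * x N.Val_zero_closed by (auto simp: class_part_def split: if_splits)
  show "Act N x y f v \<in> class_part N Y y"
  proof (cases "y \<in> Y")
    case True
    then show ?thesis using N.Act_closed x * v by (simp add: class_part_def)
  next
    case False
    have "Act N x y f v = \<zero>\<^bsub>Val N y\<^esub>"
    proof (cases "x \<in> Y")
      case True
      then show ?thesis using Act_not_iso[OF N x *(1) _ *(2) v] iso_classes_iso[OF Y True] False by blast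
    next
      case False
      then show ?thesis using * x N.Act_zero by (simp add: class_part_def)
    qed
    then show ?thesis using * False by (simp add: class_part_def)
  qed
qed (simp add: class_part_def)

text \<open>The part of \<open>S\<close> on the class of a point where \<open>S\<close> is non-zero
  is a non-zero submodule, hence all of \<open>S\<close>.\<close>

lemma simple_support:
  assumes S: "simple_module K C S"
  obtains Y where "Y \<in> iso_classes C" "\<And>x. x \<in> Ob C \<Longrightarrow> carrier (Val S x) \<noteq> {\<zero>\<^bsub>Val S x\<^esub>} \<longleftrightarrow> x \<in> Y"
proof -
  have m: "cat_module K C S" using S by (simp add: simple_module_def)
  obtain x where x: "x \<in> Ob C" "carrier (Val S x) \<noteq> {\<zero>\<^bsub>Val S x\<^esub>}" using S by (auto simp: simple_module_def)
  let ?Y = "iso_class C x"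
  have Y: "?Y \<in> iso_classes C" "x \<in> ?Y" using x iso_class_in iso_class_self by auto
  have "class_part S ?Y x \<noteq> {\<zero>\<^bsub>Val S x\<^esub>}" using x Y by (simp add: class_part_def)
  then have "\<forall>y\<in>Ob C. class_part S ?Y y = carrier (Val S y)"
    using S class_part_submodule[OF m Y(1)] x(1) unfolding simple_module_def by blast
  then have "carrier (Val S y) = {\<zero>\<^bsub>Val S y\<^esub>}" if "y \<in> Ob C" "y \<notin> ?Y" for y
    using that unfolding class_part_def by metis
  moreover have "carrier (Val S y) \<noteq> {\<zero>\<^bsub>Val S y\<^esub>}" if "y \<in> ?Y" for y
    using that x zero_iso[OF m, of y x] iso_ob_sym by (auto simp: iso_class_def)
  ultimately show thesis using that[OF Y(1)] by blast
qed

text \<open>\<open>Val N x\<close> may be infinite-dimensional, so the minimum condition is imposed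
  on subspaces of \<open>Hom C x x\<close> instead. It reaches \<open>N\<close> through the cyclic
  submodule generated by one vector \<open>v\<close>, whose value at \<open>x\<close> is an image of
  \<open>Hom C x x\<close>.\<close>

lemma simple_submodule_exists:
  assumes N: "cat_module K C N" and x: "x \<in> Ob C"
    and artinian: "\<And>\<S>. \<lbrakk>\<S> \<noteq> {}; \<And>S. S \<in> \<S> \<Longrightarrow> VectorSpace.subspace K S (Hom C x x)\<rbrakk>
      \<Longrightarrow> \<exists>S\<in>\<S>. \<forall>S'\<in>\<S>. S' \<subseteq> S \<longrightarrow> S' = S"
    and nz: "carrier (Val N x) \<noteq> {\<zero>\<^bsub>Val N x\<^esub>}"
  obtains T where "cat_submodule K C N T" "simple_module K C (sub_module N T)" "T x \<noteq> {\<zero>\<^bsub>Val N x\<^esub>}"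
proof -
  interpret N: cat_module K C N by fact
  obtain v where v: "v \<in> carrier (Val N x)" "v \<noteq> \<zero>\<^bsub>Val N x\<^esub>" using nz N.Val_zero_closed[OF x] by blast
  let ?P = "cyclic_sub C N x v"
  note P = cyclic_submodule[OF N x v(1)]
  \<comment> \<open>A submodule is replaced by the endomorphisms that carry \<open>v\<close> into
    it; this translates minimality to \<open>Hom C x x\<close>.\<close>
  define L where "L T = {f \<in> carrier (Hom C x x). Act N x x f v \<in> T x}" for T
  define adm where "adm T \<longleftrightarrow> cat_submodule K C N T \<and> (\<forall>y\<in>Ob C. T y \<subseteq> ?P y) \<and> T x \<noteq> {\<zero>\<^bsub>Val N x\<^esub>}" for T
  have "adm ?P" using P v by (auto simp: adm_def)
  moreover have "VectorSpace.subspace K (L T) (Hom C x x)" if "adm T" for T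
    unfolding L_def using module_hom_vimage_subspace[OF Hom_space[OF x x] N.Act_linear[OF x x v(1)]]
      cat_submoduleD(1)[of K C N T x] that x by (simp add: adm_def)
  ultimately obtain T where T: "adm T" and min: "\<And>T'. \<lbrakk>adm T'; L T' \<subseteq> L T\<rbrakk> \<Longrightarrow> L T' = L T"
  proof -
    assume P: "adm ?P" and L: "\<And>T. adm T \<Longrightarrow> VectorSpace.subspace K (L T) (Hom C x x)"
      and *: "\<And>T. \<lbrakk>adm T; \<And>T'. \<lbrakk>adm T'; L T' \<subseteq> L T\<rbrakk> \<Longrightarrow> L T' = L T\<rbrakk> \<Longrightarrow> thesis"
    have "\<exists>S\<in>L ` Collect adm. \<forall>S'\<in>L ` Collect adm. S' \<subseteq> S \<longrightarrow> S' = S"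
    proof (rule artinian)
      show "L ` Collect adm \<noteq> {}" using P by blast
      show "VectorSpace.subspace K S (Hom C x x)" if "S \<in> L ` Collect adm" for S
        using L that by blast
    qed
    then obtain S where S: "S \<in> L ` Collect adm" "\<forall>S'\<in>L ` Collect adm. S' \<subseteq> S \<longrightarrow> S' = S" ..
    obtain T where T: "adm T" "S = L T" using S(1) by blast
    show thesis by (rule *[OF T(1)]) (use S(2) T(2) in blast)
  qed
  have Ts: "cat_submodule K C N T" using T by (simp add: adm_def)
  \<comment> \<open>Away from the class of \<open>x\<close> the cyclic submodule already vanishes,
    so only the value at \<open>x\<close> has to be compared.\<close>
  have off: "T' y = {\<zero>\<^bsub>Val N y\<^esub>}"
    if "cat_submodule K C N T'" "\<forall>y\<in>Ob C. T' y \<subseteq> T y" "y \<in> Ob C" "\<not> iso_ob C x y" for T' y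
  proof -
    have "?P y \<subseteq> {\<zero>\<^bsub>Val N y\<^esub>}" using Act_not_iso[OF N x that(3,4) _ v(1)] by (auto simp: cyclic_sub_def)
    then show ?thesis using that T cat_submoduleD(3)[OF that(1,3)] unfolding adm_def by blast
  qed
  have "(\<forall>y\<in>Ob C. T' y = {\<zero>\<^bsub>Val N y\<^esub>}) \<or> (\<forall>y\<in>Ob C. T' y = T y)"
    if T': "cat_submodule K C N T'" "\<forall>y\<in>Ob C. T' y \<subseteq> T y" for T'
  proof (cases "T' x = {\<zero>\<^bsub>Val N x\<^esub>}")
    case True
    have "T' y = {\<zero>\<^bsub>Val N y\<^esub>}" if y: "y \<in> Ob C" for y
    proof (cases "iso_ob C x y")
      case iso: True
      have "T' y \<subseteq> zero_sub C N y"
        by (rule submodule_mono_iso[OF N T'(1) zero_submodule[OF N] _ iso]) (simp add: True zero_sub_def x)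
      then show ?thesis using cat_submoduleD(3)[OF T'(1) y] y by (auto simp: zero_sub_def)
    qed (use off T' y in blast)
    then show ?thesis by blast
  next
    case False
    then have "adm T'" using T T' by (auto simp: adm_def)
    moreover have "L T' \<subseteq> L T" using T'(2) x by (auto simp: L_def)
    ultimately have eq: "L T' = L T" by (rule min)
    \<comment> \<open>Inside the cyclic submodule, \<open>T x\<close> is recovered from
      \<open>L T\<close> as the set of all \<open>f v\<close>.\<close>
    have "T x \<subseteq> T' x"
    proof
      fix w assume w: "w \<in> T x"
      then have "w \<in> ?P x" using T x by (auto simp: adm_def)
      then obtain f where "f \<in> carrier (Hom C x x)" "w = Act N x x f v" using x by (auto simp: cyclic_sub_def)
      then show "w \<in> T' x" using w eq by (auto simp: L_def)
    qed
    then have "T y \<subseteq> T' y" if "y \<in> Ob C" for y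
      using submodule_mono_iso[OF N Ts T'(1)] off[OF Ts _ that] off[OF T' that] by (cases "iso_ob C x y") auto
    then show ?thesis using T'(2) by blast
  qed
  moreover have "\<exists>x\<in>Ob C. T x \<noteq> {\<zero>\<^bsub>Val N x\<^esub>}" using T x by (auto simp: adm_def)
  ultimately have "simple_module K C (sub_module N T)" using simple_sub_module_iff[OF N Ts] by blast
  then show thesis using that Ts T by (simp add: adm_def)
qed

end

subsection \<open>Wide subcategories\<close>

lemma sub_cat_simps [simp]:
  "Ob (sub_cat C W) = Ob C" "carrier (Hom (sub_cat C W) x y) = W x y"
  "Comp (sub_cat C W) = Comp C" "Id (sub_cat C W) = Id C"
  "add (Hom (sub_cat C W) x y) = add (Hom C x y)" "smult (Hom (sub_cat C W) x y) = smult (Hom C x y)"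
  "zero (Hom (sub_cat C W) x y) = zero (Hom C x y)"
  by (simp_all add: sub_cat_def)

lemma Hom_sub_cat: "Hom (sub_cat C W) x y = (Hom C x y)\<lparr>carrier := W x y\<rparr>"
  by (simp add: sub_cat_def)

lemma wide_subcategoryD:
  assumes "wide_subcategory K C W"
  shows "\<lbrakk>x \<in> Ob C; y \<in> Ob C\<rbrakk> \<Longrightarrow> VectorSpace.subspace K (W x y) (Hom C x y)"
    and "\<lbrakk>x \<in> Ob C; y \<in> Ob C; f \<in> W x y\<rbrakk> \<Longrightarrow> f \<in> carrier (Hom C x y)"
    and "\<lbrakk>x \<in> Ob C; y \<in> Ob C\<rbrakk> \<Longrightarrow> \<zero>\<^bsub>Hom C x y\<^esub> \<in> W x y"
    and "x \<in> Ob C \<Longrightarrow> Id C x \<in> W x x"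
    and "\<lbrakk>x \<in> Ob C; y \<in> Ob C; z \<in> Ob C; f \<in> W x y; g \<in> W y z\<rbrakk> \<Longrightarrow> Comp C x y z g f \<in> W x z"
  using assms vs_subspaceD(1,2)[of K "W x y" "Hom C x y"] unfolding wide_subcategory_def by blast+

context linear_category
begin

lemma sub_cat_linear:
  assumes W: "wide_subcategory K C W" shows "linear_category K (sub_cat C W)"
proof -
  note w = wide_subcategoryD[OF W]
  have restr: "f \<in> module_hom K (V\<lparr>carrier := A\<rparr>) (V'\<lparr>carrier := A'\<rparr>)"
    if "f \<in> module_hom K V V'" "A \<subseteq> carrier V" "\<And>v. v \<in> A \<Longrightarrow> f v \<in> A'"
    for f :: "'m \<Rightarrow> 'm" and V V' :: "('k, 'm) module" and A A'
    using that by (auto simp: module_hom_def subset_iff)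
  have sub: "W x y \<subseteq> carrier (Hom C x y)" if "x \<in> Ob C" "y \<in> Ob C" for x y
    using w(2) that by blast
  show ?thesis
  proof (intro linear_category.intro linear_category_axioms.intro field_axioms)
    fix x y assume "x \<in> Ob (sub_cat C W)" "y \<in> Ob (sub_cat C W)"
    then have xy: "x \<in> Ob C" "y \<in> Ob C" by simp_all
    interpret H: vectorspace K "Hom C x y" using Hom_space xy by blast
    show "vectorspace K (Hom (sub_cat C W) x y)"
      unfolding Hom_sub_cat by (rule H.subspace_is_vs[OF w(1)[OF xy]])
  next
    fix x y z f assume *: "x \<in> Ob (sub_cat C W)" "y \<in> Ob (sub_cat C W)" "z \<in> Ob (sub_cat C W)"
      "f \<in> carrier (Hom (sub_cat C W) x y)"
    show "(\<lambda>g. Comp (sub_cat C W) x y z g f) \<in> module_hom K (Hom (sub_cat C W) y z) (Hom (sub_cat C W) x z)"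
      unfolding Hom_sub_cat sub_cat_simps
      by (rule restr[OF Comp_linear_left]) (use * w sub in auto)
  next
    fix x y z g assume *: "x \<in> Ob (sub_cat C W)" "y \<in> Ob (sub_cat C W)" "z \<in> Ob (sub_cat C W)"
      "g \<in> carrier (Hom (sub_cat C W) y z)"
    show "(\<lambda>f. Comp (sub_cat C W) x y z g f) \<in> module_hom K (Hom (sub_cat C W) x y) (Hom (sub_cat C W) x z)"
      unfolding Hom_sub_cat sub_cat_simps
      by (rule restr[OF Comp_linear_right]) (use * w sub in auto)
  qed (use w in \<open>simp_all add: Comp_assoc Id_left Id_right\<close>)
qed

lemma restrict_module:
  assumes W: "wide_subcategory K C W" and N: "cat_module K C N"
  shows "cat_module K (sub_cat C W) N"
proof -
  interpret N: cat_module K C N by fact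
  note w = wide_subcategoryD[OF W]
  show ?thesis
  proof (intro cat_module.intro cat_module_axioms.intro sub_cat_linear[OF W])
    fix x y v assume *: "x \<in> Ob (sub_cat C W)" "y \<in> Ob (sub_cat C W)" "v \<in> carrier (Val N x)"
    then show "(\<lambda>f. Act N x y f v) \<in> module_hom K (Hom (sub_cat C W) x y) (Val N y)"
      using N.Act_linear[of x y v] w(2) by (auto simp: module_hom_def)
  qed (use w(2) in \<open>simp_all add: N.Val_space N.Act_hom N.Act_Id N.Act_Comp\<close>)
qed

end

lemma restrict_hom:
  assumes "wide_subcategory K C W" "cat_module_hom K C N N' \<phi>"
  shows "cat_module_hom K (sub_cat C W) N N' \<phi>"
  using assms(2) wide_subcategoryD(2)[OF assms(1)] unfolding cat_module_hom_def by simp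

lemma restrict_submodule:
  assumes "wide_subcategory K C W" "cat_submodule K C N T"
  shows "cat_submodule K (sub_cat C W) N T"
  using assms(2) wide_subcategoryD(2)[OF assms(1)] unfolding cat_submodule_def by simp

subsection \<open>Triangular categories\<close>

text \<open>\<open>T2\<close> only provides some admissible order, whereas lowest weights refer to a
  given one.\<close>

locale ordered_triangular_category = triangular_category K G U D
  for K :: "'k ring" (structure) and G :: "('o, 'm, 'k) lin_category" and U D +
  fixes r :: "'o set rel"
  assumes adm: "admissible_order G U D r"
begin

abbreviation "Mid \<equiv> mid_cat G U D"
abbreviation "M x y \<equiv> U x y \<inter> D x y"

lemma U_sub: "\<lbrakk>x \<in> Ob G; y \<in> Ob G; f \<in> U x y\<rbrakk> \<Longrightarrow> f \<in> carrier (Hom G x y)"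
  and D_sub: "\<lbrakk>x \<in> Ob G; y \<in> Ob G; f \<in> D x y\<rbrakk> \<Longrightarrow> f \<in> carrier (Hom G x y)"
  using wide_subcategoryD(2)[OF wide_U] wide_subcategoryD(2)[OF wide_D] by blast+

lemma U_comp: "\<lbrakk>x \<in> Ob G; y \<in> Ob G; z \<in> Ob G; f \<in> U x y; g \<in> U y z\<rbrakk> \<Longrightarrow> Comp G x y z g f \<in> U x z"
  and D_comp: "\<lbrakk>x \<in> Ob G; y \<in> Ob G; z \<in> Ob G; f \<in> D x y; g \<in> D y z\<rbrakk> \<Longrightarrow> Comp G x y z g f \<in> D x z"
  using wide_subcategoryD(5)[OF wide_U] wide_subcategoryD(5)[OF wide_D] by blast+

lemma wide_M: "wide_subcategory K G (\<lambda>x y. M x y)"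
proof -
  note u = wide_subcategoryD[OF wide_U] and d = wide_subcategoryD[OF wide_D]
  have "VectorSpace.subspace K (M x y) (Hom G x y)" if "x \<in> Ob G" "y \<in> Ob G" for x y
    using vs_subspaceD[OF u(1)[OF that]] vs_subspaceD[OF d(1)[OF that]]
    by (intro vs_subspaceI[OF Hom_space[OF that]]) auto
  then show ?thesis unfolding wide_subcategory_def using u(4,5) d(4,5) by blast
qed

lemma Mid_eq: "Mid = sub_cat G (\<lambda>x y. M x y)"
  by (simp add: mid_cat_def)

lemma Mid_simps [simp]:
  "Ob Mid = Ob G" "carrier (Hom Mid x y) = M x y" "Comp Mid = Comp G" "Id Mid = Id G"
  "zero (Hom Mid x y) = zero (Hom G x y)"
  by (simp_all add: Mid_eq)

lemma Mid_linear: "linear_category K Mid"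
  unfolding Mid_eq by (rule sub_cat_linear[OF wide_M])

lemma Mid_module: "cat_module K G N \<Longrightarrow> cat_module K Mid N"
  unfolding Mid_eq by (rule restrict_module[OF wide_M])

lemma Mid_hom: "cat_module_hom K G N N' \<phi> \<Longrightarrow> cat_module_hom K Mid N N' \<phi>"
  unfolding Mid_eq by (rule restrict_hom[OF wide_M])

lemma Mid_submodule: "cat_submodule K G N T \<Longrightarrow> cat_submodule K Mid N T"
  unfolding Mid_eq by (rule restrict_submodule[OF wide_M])

lemma r_order: "partial_order_on (iso_classes G) r"
  using adm by (simp add: admissible_order_def)

lemma r_refl: "Y \<in> iso_classes G \<Longrightarrow> (Y, Y) \<in> r"
  using r_order by (auto simp: partial_order_on_def preorder_on_def refl_on_def)

lemma r_antisym: "\<lbrakk>(Y, Z) \<in> r; (Z, Y) \<in> r\<rbrakk> \<Longrightarrow> Y = Z"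
  using r_order by (auto simp: partial_order_on_def antisym_def)

lemma r_trans: "\<lbrakk>(Y, Z) \<in> r; (Z, Z') \<in> r\<rbrakk> \<Longrightarrow> (Y, Z') \<in> r"
  using r_order unfolding partial_order_on_def preorder_on_def by (meson transD)

lemma U_le: "\<lbrakk>x \<in> Ob G; y \<in> Ob G; f \<in> U x y; f \<noteq> \<zero>\<^bsub>Hom G x y\<^esub>\<rbrakk> \<Longrightarrow> (iso_class G x, iso_class G y) \<in> r"
  and D_le: "\<lbrakk>x \<in> Ob G; y \<in> Ob G; f \<in> D x y; f \<noteq> \<zero>\<^bsub>Hom G x y\<^esub>\<rbrakk> \<Longrightarrow> (iso_class G y, iso_class G x) \<in> r"
  using adm unfolding admissible_order_def by blast+

lemma iso_of_le: "\<lbrakk>x \<in> Ob G; y \<in> Ob G; (iso_class G x, iso_class G y) \<in> r; (iso_class G y, iso_class G x) \<in> r\<rbrakk>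
    \<Longrightarrow> iso_ob G x y"
  using r_antisym iso_class_eq_iff by blast

lemma iso_Mid_iff: "iso_ob Mid x y \<longleftrightarrow> iso_ob G x y"
proof
  assume "iso_ob Mid x y"
  then show "iso_ob G x y" unfolding iso_ob_def Mid_simps using wide_subcategoryD(2)[OF wide_M] by blast
qed (rule iso_mid)

lemma iso_Mid [simp]: "iso_class Mid = iso_class G" "iso_classes Mid = iso_classes G"
  by (simp_all add: iso_class_def iso_classes_def iso_Mid_iff fun_eq_iff)

text \<open>A non-zero morphism of both \<open>U\<close> and \<open>D\<close> makes each end point
  at most the other, and antisymmetry makes their classes equal.\<close>

lemma Mid_block: "block_category K Mid"
proof (intro block_category.intro block_category_axioms.intro Mid_linear)
  fix x y f assume *: "x \<in> Ob Mid" "y \<in> Ob Mid" "f \<in> carrier (Hom Mid x y)" "f \<noteq> \<zero>\<^bsub>Hom Mid x y\<^esub>"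
  then have "iso_ob G x y" using U_le[of x y f] D_le[of x y f] iso_of_le by simp
  then show "iso_ob Mid x y" by (rule iso_mid)
qed

lemma isoE:
  assumes "iso_ob G x y"
  obtains s s' where "x \<in> Ob G" "y \<in> Ob G" "s \<in> M x y" "s' \<in> M y x" "s \<in> carrier (Hom G x y)"
    "s' \<in> carrier (Hom G y x)" "Comp G x y x s' s = Id G x" "Comp G y x y s s' = Id G y"
proof -
  have "iso_ob Mid x y" by (rule iso_mid[OF assms])
  then show thesis using that U_sub unfolding iso_ob_def Mid_simps by blast
qed

text \<open>Transports the equality of endomorphism rings in \<open>T1\<close> along a middle
  isomorphism \<open>s\<close>, by writing \<open>f = s (s' f)\<close> with \<open>s' f\<close> an
  endomorphism of \<open>x\<close>. It turns morphisms of \<open>U\<close> or \<open>D\<close>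
  between isomorphic objects into middle morphisms.\<close>

lemma UD_iso:
  assumes "iso_ob G x y" shows "U x y = D x y"
proof -
  obtain s s' where s: "x \<in> Ob G" "y \<in> Ob G" "s \<in> M x y" "s' \<in> M y x" "s \<in> carrier (Hom G x y)"
    "s' \<in> carrier (Hom G y x)" "Comp G x y x s' s = Id G x" "Comp G y x y s s' = Id G y"
    using isoE[OF assms] by blast
  have xx: "U x x = D x x" using T1 s by blast
  have "f = Comp G x x y s (Comp G x y x s' f)" if "f \<in> carrier (Hom G x y)" for f
    using Comp_assoc[OF s(1,2,1,2) that s(6,5)] s that by (simp add: Id_left)
  then show ?thesis
    using U_comp[of x y x _ s'] D_comp[of x y x _ s'] U_comp[of x x y _ s] D_comp[of x x y _ s] s xx U_sub D_sub
    by (metis IntD1 IntD2 subsetI subset_antisym)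
qed

section \<open>The middle component of a morphism and its off-diagonal complement\<close>

definition triangle_gens :: "'o \<Rightarrow> 'o \<Rightarrow> ('o \<Rightarrow> bool) \<Rightarrow> 'm set" where
  "triangle_gens x z P = {Comp G x y z u d | y u d. y \<in> Ob G \<and> P y \<and> u \<in> U y z \<and> d \<in> D x y}"

text \<open>The span of the composites \<open>u d\<close> whose middle object is not isomorphic to
  \<open>x\<close>. Taking an intersection of subspaces gives the minimality in
  \<open>off_diag_least\<close> at once, so that stability properties need checking on composites
  only.\<close>

definition off_diag :: "'o \<Rightarrow> 'o \<Rightarrow> 'm set" where
  "off_diag x z = {g \<in> carrier (Hom G x z). \<forall>W\<in>{W. VectorSpace.subspace K W (Hom G x z) \<and>
     triangle_gens x z (\<lambda>y. \<not> iso_ob G x y) \<subseteq> W}. g \<in> W}"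

lemma triangle_gens_closed:
  "\<lbrakk>x \<in> Ob G; z \<in> Ob G\<rbrakk> \<Longrightarrow> triangle_gens x z P \<subseteq> carrier (Hom G x z)"
  using Comp_closed U_sub D_sub by (auto simp: triangle_gens_def)

lemma off_diag_subspace:
  "\<lbrakk>x \<in> Ob G; z \<in> Ob G\<rbrakk> \<Longrightarrow> VectorSpace.subspace K (off_diag x z) (Hom G x z)"
  unfolding off_diag_def by (rule subspace_Inter[OF Hom_space]) auto

lemma off_diag_gens:
  "\<lbrakk>x \<in> Ob G; z \<in> Ob G\<rbrakk> \<Longrightarrow> triangle_gens x z (\<lambda>y. \<not> iso_ob G x y) \<subseteq> off_diag x z"
  unfolding off_diag_def using triangle_gens_closed by blast

lemma off_diag_least:
  "\<lbrakk>VectorSpace.subspace K W (Hom G x z); triangle_gens x z (\<lambda>y. \<not> iso_ob G x y) \<subseteq> W\<rbrakk> \<Longrightarrow> off_diag x z \<subseteq> W"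
  unfolding off_diag_def by blast

context
  fixes x z assumes x: "x \<in> Ob G" and z: "z \<in> Ob G"
begin

abbreviation "Uy y \<equiv> (sub_cat G U)\<lparr>Ob := {y}\<rparr>"
abbreviation "lift \<equiv> tensor_lift K (Hom G x z) (\<lambda>(y, u, d). Comp G x y z u d)"
abbreviation "mt Y \<equiv> middle_tensor K G U D x (class_rep Y) z"
abbreviation "pure y u d \<equiv> pure_tensor K (Uy y) (hom_to (sub_cat G U) z) (hom_from (sub_cat G D) x) (y, u, d)"
abbreviation "trisum \<equiv> triangular_sum K G U D x z"
abbreviation "tri \<equiv> triangular_map K G U D x z"

text \<open>\<open>End\<close> of \<open>y\<close> in \<open>U\<close> acts on morphisms of
  \<open>D\<close> into \<open>y\<close> because \<open>T1\<close> identifies it with the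
  endomorphism ring in \<open>D\<close>.\<close>

lemma middle_setup:
  assumes y: "y \<in> Ob G"
  shows "tensor_setup K (Uy y) (hom_to (sub_cat G U) z) (hom_from (sub_cat G D) x)"
proof -
  have "Comp G x y y f n \<in> D x y" if "f \<in> U y y" "n \<in> D x y" for f n
    using D_comp[OF x y y that(2)] that(1) T1[OF y] by blast
  then show ?thesis
    unfolding tensor_setup_def tensor_setup_axioms_def
    using field_axioms linear_category.Hom_space[OF sub_cat_linear[OF wide_U], of y z]
      linear_category.Hom_space[OF sub_cat_linear[OF wide_D], of x y] U_comp[OF y y z] x y z
    by (auto simp: hom_to_def hom_from_def)
qed

lemma middle_balanced:
  assumes y: "y \<in> Ob G"
  shows "balanced_map K (Uy y) (hom_to (sub_cat G U) z) (hom_from (sub_cat G D) x) (Hom G x z)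
    (\<lambda>(y, u, d). Comp G x y z u d)"
proof -
  have 1: "(\<lambda>u. Comp G x y z u d) \<in> module_hom K (Hom (sub_cat G U) y z) (Hom G x z)" if "d \<in> D x y" for d
    using Comp_linear_left[OF x y z D_sub[OF x y that]] U_sub[OF y z] by (auto simp: module_hom_def)
  have 2: "(\<lambda>d. Comp G x y z u d) \<in> module_hom K (Hom (sub_cat G D) x y) (Hom G x z)" if "u \<in> U y z" for u
    using Comp_linear_right[OF x y z U_sub[OF y z that]] D_sub[OF x y] by (auto simp: module_hom_def)
  show ?thesis unfolding balanced_map_def
    using 1 2 Comp_assoc[OF x y y z] D_sub[OF x y] U_sub[OF y z] U_sub[OF y y]
    by (simp add: hom_to_def hom_from_def)
qed

lemma lift_hom:
  assumes y: "y \<in> Ob G"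
  shows "lift \<in> module_hom K (middle_tensor K G U D x y z) (Hom G x z)"
  unfolding middle_tensor_def
  by (rule tensor_setup.tensor_lift_hom[OF middle_setup[OF y] Hom_space[OF x z] middle_balanced[OF y]])

lemma lift_pure:
  assumes "y \<in> Ob G" "u \<in> U y z" "d \<in> D x y"
  shows "lift (pure y u d) = Comp G x y z u d" "pure y u d \<in> carrier (middle_tensor K G U D x y z)"
  using tensor_setup.tensor_lift_pt[OF middle_setup[OF assms(1)] Hom_space[OF x z] middle_balanced[OF assms(1)], of y u d]
    tensor_setup.pt_closed[OF middle_setup[OF assms(1)], of y u d] assms(2,3)
  by (simp_all add: hom_to_def hom_from_def middle_tensor_def)

lemma mt_space: "y \<in> Ob G \<Longrightarrow> vectorspace K (middle_tensor K G U D x y z)"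
  unfolding middle_tensor_def by (rule tensor_setup.T_vs[OF middle_setup])

lemma rep_Ob: "Y \<in> iso_classes G \<Longrightarrow> class_rep Y \<in> Ob G"
  using iso_classes_Ob class_rep_in by blast

lemma S_simps:
  "carrier trisum = {f \<in> \<Pi>\<^sub>E Y\<in>iso_classes G. carrier (mt Y). finite {Y \<in> iso_classes G. f Y \<noteq> \<zero>\<^bsub>mt Y\<^esub>}}"
  "\<zero>\<^bsub>trisum\<^esub> = (\<lambda>Y\<in>iso_classes G. \<zero>\<^bsub>mt Y\<^esub>)"
  "f \<oplus>\<^bsub>trisum\<^esub> g = (\<lambda>Y\<in>iso_classes G. f Y \<oplus>\<^bsub>mt Y\<^esub> g Y)"
  "a \<odot>\<^bsub>trisum\<^esub> f = (\<lambda>Y\<in>iso_classes G. a \<odot>\<^bsub>mt Y\<^esub> f Y)"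
  by (simp_all add: triangular_sum_def direct_sum_space_def)

lemma tri_hom: "tri \<in> module_hom K trisum (Hom G x z)"
  and tri_bij: "bij_betw tri (carrier trisum) (carrier (Hom G x z))"
  using T3[OF x z] by auto

lemma lift_in_span:
  assumes W: "VectorSpace.subspace K W (Hom G x z)"
    and y: "y \<in> Ob G" and gen: "\<And>u d. \<lbrakk>u \<in> U y z; d \<in> D x y\<rbrakk> \<Longrightarrow> Comp G x y z u d \<in> W"
    and t: "t \<in> carrier (middle_tensor K G U D x y z)"
  shows "lift t \<in> W"
proof -
  have "t \<in> {v \<in> carrier (middle_tensor K G U D x y z). lift v \<in> W}"
    unfolding middle_tensor_def
  proof (rule tensor_setup.tensor_span[OF middle_setup[OF y]])
    show "VectorSpace.subspace K {v \<in> carrier (tensor K (Uy y) (hom_to (sub_cat G U) z) (hom_from (sub_cat G D) x)).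
        lift v \<in> W} (tensor K (Uy y) (hom_to (sub_cat G U) z) (hom_from (sub_cat G D) x))"
      using module_hom_vimage_subspace[OF mt_space[OF y] lift_hom[OF y] W] by (simp add: middle_tensor_def)
  qed (use t lift_pure[OF y] gen in \<open>auto simp: hom_to_def hom_from_def middle_tensor_def\<close>)
  then show ?thesis by simp
qed

text \<open>The surjectivity half of \<open>T3\<close>: a morphism is a finite sum of terms, each in
  the span of composites \<open>u d\<close>.\<close>

lemma Hom_span:
  assumes W: "VectorSpace.subspace K W (Hom G x z)" and gen: "triangle_gens x z (\<lambda>y. True) \<subseteq> W"
    and g: "g \<in> carrier (Hom G x z)"
  shows "g \<in> W"
proof -
  obtain \<theta> where \<theta>: "\<theta> \<in> carrier trisum" "g = tri \<theta>" using tri_bij g unfolding bij_betw_def by blast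
  show ?thesis unfolding \<theta>(2) triangular_map_def
  proof (rule subspace_finsum[OF W])
    fix Y assume Y: "Y \<in> {Y \<in> iso_classes G. \<theta> Y \<noteq> \<zero>\<^bsub>mt Y\<^esub>}"
    then have y: "class_rep Y \<in> Ob G" using rep_Ob by blast
    show "lift (\<theta> Y) \<in> W"
      by (rule lift_in_span[OF W y]) (use gen Y y \<theta>(1) in \<open>auto simp: triangle_gens_def S_simps PiE_iff\<close>)
  qed
qed

text \<open>The element of the direct sum with \<open>t\<close> in place \<open>Y\<close> and zero
  elsewhere. Injectivity in \<open>T3\<close> is exploited by comparing such elements with families
  that vanish in place \<open>Y\<close>.\<close>

definition single :: "'o set \<Rightarrow> ('o \<times> 'm \<times> 'm \<Rightarrow> 'k) set \<Rightarrow> 'o set \<Rightarrow> ('o \<times> 'm \<times> 'm \<Rightarrow> 'k) set" where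
  "single Y t = (\<lambda>Z\<in>iso_classes G. if Z = Y then t else \<zero>\<^bsub>mt Z\<^esub>)"

lemma mt_zero: "Y \<in> iso_classes G \<Longrightarrow> \<zero>\<^bsub>mt Y\<^esub> \<in> carrier (mt Y)"
  using vs_subspaceD(2)[OF subspace_carrier[OF mt_space[OF rep_Ob]]] .

lemma single_closed:
  assumes "Y \<in> iso_classes G" "t \<in> carrier (mt Y)" shows "single Y t \<in> carrier trisum"
proof -
  have "{Z \<in> iso_classes G. single Y t Z \<noteq> \<zero>\<^bsub>mt Z\<^esub>} \<subseteq> {Y}" by (auto simp: single_def)
  then have "finite {Z \<in> iso_classes G. single Y t Z \<noteq> \<zero>\<^bsub>mt Z\<^esub>}" by (rule finite_subset) simp
  then show ?thesis using assms mt_zero by (auto simp: S_simps single_def)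
qed

lemma tri_single:
  assumes Y: "Y \<in> iso_classes G" and t: "t \<in> carrier (mt Y)" shows "tri (single Y t) = lift t"
proof -
  interpret H: vectorspace K "Hom G x z" using Hom_space x z by blast
  note lh = lift_hom[OF rep_Ob[OF Y]]
  have lt: "lift t \<in> carrier (Hom G x z)" using module_hom_closed[OF lh] t by blast
  show ?thesis
  proof (cases "t = \<zero>\<^bsub>mt Y\<^esub>")
    case True
    then have e: "{Z \<in> iso_classes G. single Y t Z \<noteq> \<zero>\<^bsub>mt Z\<^esub>} = {}" by (auto simp: single_def)
    have "lift t = \<zero>\<^bsub>Hom G x z\<^esub>"
      using module_hom_zero[OF mt_space[OF rep_Ob[OF Y]] Hom_space[OF x z] lh] True by simp
    then show ?thesis unfolding triangular_map_def e by simp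
  next
    case False
    then have e: "{Z \<in> iso_classes G. single Y t Z \<noteq> \<zero>\<^bsub>mt Z\<^esub>} = {Y}" using Y by (auto simp: single_def)
    have "single Y t Y = t" using Y by (simp add: single_def)
    then show ?thesis unfolding triangular_map_def e using lt by simp
  qed
qed

text \<open>Moves the middle object of a composite to the chosen representative of its class.\<close>

lemma Comp_single:
  assumes y: "y \<in> Ob G" and u: "u \<in> U y z" and d: "d \<in> D x y"
  obtains t where "t \<in> carrier (mt (iso_class G y))" "tri (single (iso_class G y) t) = Comp G x y z u d"
proof -
  let ?Y = "iso_class G y"
  have Y: "?Y \<in> iso_classes G" using y by (rule iso_class_in)
  have "iso_ob G y (class_rep ?Y)" using class_rep_in[OF Y] by (simp add: iso_class_def)
  then obtain s s' where s: "class_rep ?Y \<in> Ob G" "s \<in> M y (class_rep ?Y)" "s' \<in> M (class_rep ?Y) y"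
     "s \<in> carrier (Hom G y (class_rep ?Y))" "s' \<in> carrier (Hom G (class_rep ?Y) y)"
     "Comp G y (class_rep ?Y) y s' s = Id G y"
    using isoE by metis
  let ?w = "class_rep ?Y"
  have us: "Comp G ?w y z u s' \<in> U ?w z" using U_comp[OF s(1) y z _ u] s by blast
  have sd: "Comp G x y ?w s d \<in> D x ?w" using D_comp[OF x y s(1) d] s by blast
  have d': "d \<in> carrier (Hom G x y)" and u': "u \<in> carrier (Hom G y z)" using D_sub U_sub x y z d u by blast+
  have "Comp G x ?w z (Comp G ?w y z u s') (Comp G x y ?w s d) = Comp G x y z u d"
    using Comp_assoc[OF x s(1) y z _ s(5) u', of "Comp G x y ?w s d"] Comp_assoc[OF x y s(1) y d' s(4,5)]
      Comp_closed[OF x y s(1) d' s(4)] s(6) Id_left[OF x y d'] by simp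
  then show thesis
    using that[OF lift_pure(2)[OF s(1) us sd]] tri_single[OF Y lift_pure(2)[OF s(1) us sd]] lift_pure(1)[OF s(1) us sd]
    by simp
qed

text \<open>The injectivity half of \<open>T3\<close>: a middle morphism comes from the summand of
  the class of \<open>x\<close>, an off-diagonal one from the other summands.\<close>

lemma M_off_diag:
  assumes iso: "iso_ob G x z"
  shows "M x z \<inter> off_diag x z \<subseteq> {\<zero>\<^bsub>Hom G x z\<^esub>}"
proof
  fix f assume f: "f \<in> M x z \<inter> off_diag x z"
  let ?Y = "iso_class G x"
  have Y: "?Y \<in> iso_classes G" using x by (rule iso_class_in)
  \<comment> \<open>The images of families without component at the class of \<open>x\<close>. This
    subspace contains the generators of \<open>off_diag x z\<close>, hence all of it.\<close>
  let ?A = "tri ` {\<theta> \<in> carrier trisum. \<theta> ?Y = \<zero>\<^bsub>mt ?Y\<^esub>}"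
  have A: "VectorSpace.subspace K ?A (Hom G x z)"
  proof (rule vs_subspaceI[OF Hom_space[OF x z]])
    show "?A \<subseteq> carrier (Hom G x z)" using tri_bij unfolding bij_betw_def by blast
    have "\<zero>\<^bsub>trisum\<^esub> \<in> carrier trisum" using mt_zero by (auto simp: S_simps cong: conj_cong)
    moreover have "tri \<zero>\<^bsub>trisum\<^esub> = \<zero>\<^bsub>Hom G x z\<^esub>"
    proof -
      interpret H: vectorspace K "Hom G x z" using Hom_space x z by blast
      have "{Z \<in> iso_classes G. \<zero>\<^bsub>trisum\<^esub> Z \<noteq> \<zero>\<^bsub>mt Z\<^esub>} = {}" by (auto simp: S_simps)
      then show ?thesis unfolding triangular_map_def by (simp only: H.M.finsum_empty)
    qed
    moreover have "\<zero>\<^bsub>trisum\<^esub> ?Y = \<zero>\<^bsub>mt ?Y\<^esub>" using Y by (simp add: S_simps)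
    ultimately show "\<zero>\<^bsub>Hom G x z\<^esub> \<in> ?A" by force
  next
    fix u v assume "u \<in> ?A" "v \<in> ?A"
    then obtain \<theta> \<eta> where *: "\<theta> \<in> carrier trisum" "\<theta> ?Y = \<zero>\<^bsub>mt ?Y\<^esub>" "u = tri \<theta>"
      "\<eta> \<in> carrier trisum" "\<eta> ?Y = \<zero>\<^bsub>mt ?Y\<^esub>" "v = tri \<eta>" by blast
    have "(\<theta> \<oplus>\<^bsub>trisum\<^esub> \<eta>) \<in> carrier trisum"
    proof -
      have "{Z \<in> iso_classes G. (\<theta> \<oplus>\<^bsub>trisum\<^esub> \<eta>) Z \<noteq> \<zero>\<^bsub>mt Z\<^esub>} \<subseteq>
          {Z \<in> iso_classes G. \<theta> Z \<noteq> \<zero>\<^bsub>mt Z\<^esub>} \<union> {Z \<in> iso_classes G. \<eta> Z \<noteq> \<zero>\<^bsub>mt Z\<^esub>}"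
      proof
        fix Z assume "Z \<in> {Z \<in> iso_classes G. (\<theta> \<oplus>\<^bsub>trisum\<^esub> \<eta>) Z \<noteq> \<zero>\<^bsub>mt Z\<^esub>}"
        then have Z: "Z \<in> iso_classes G" "(\<theta> \<oplus>\<^bsub>trisum\<^esub> \<eta>) Z \<noteq> \<zero>\<^bsub>mt Z\<^esub>" by simp_all
        interpret V: vectorspace K "mt Z" by (rule mt_space[OF rep_Ob[OF Z(1)]])
        show "Z \<in> {Z \<in> iso_classes G. \<theta> Z \<noteq> \<zero>\<^bsub>mt Z\<^esub>} \<union> {Z \<in> iso_classes G. \<eta> Z \<noteq> \<zero>\<^bsub>mt Z\<^esub>}"
          using Z by (auto simp: S_simps(3))
      qed
      moreover have "finite ({Z \<in> iso_classes G. \<theta> Z \<noteq> \<zero>\<^bsub>mt Z\<^esub>} \<union> {Z \<in> iso_classes G. \<eta> Z \<noteq> \<zero>\<^bsub>mt Z\<^esub>})"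
        using * by (simp add: S_simps(1))
      ultimately have "finite {Z \<in> iso_classes G. (\<theta> \<oplus>\<^bsub>trisum\<^esub> \<eta>) Z \<noteq> \<zero>\<^bsub>mt Z\<^esub>}" by (rule finite_subset)
      moreover have "\<theta> Z \<oplus>\<^bsub>mt Z\<^esub> \<eta> Z \<in> carrier (mt Z)" if "Z \<in> iso_classes G" for Z
        using vs_subspaceD(3)[OF subspace_carrier[OF mt_space[OF rep_Ob[OF that]]]] * that
        by (auto simp: S_simps(1) PiE_iff)
      ultimately show ?thesis by (simp add: S_simps(1,3))
    qed
    moreover have "(\<theta> \<oplus>\<^bsub>trisum\<^esub> \<eta>) ?Y = \<zero>\<^bsub>mt ?Y\<^esub>"
    proof -
      interpret V: vectorspace K "mt ?Y" by (rule mt_space[OF rep_Ob[OF Y]])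
      show ?thesis using * Y by (simp add: S_simps(3))
    qed
    moreover have "tri (\<theta> \<oplus>\<^bsub>trisum\<^esub> \<eta>) = u \<oplus>\<^bsub>Hom G x z\<^esub> v" using module_hom_add[OF tri_hom *(1,4)] * by simp
    ultimately show "u \<oplus>\<^bsub>Hom G x z\<^esub> v \<in> ?A" by (metis (mono_tags, lifting) imageI mem_Collect_eq)
  next
    fix a u assume a: "a \<in> carrier K" and "u \<in> ?A"
    then obtain \<theta> where *: "\<theta> \<in> carrier trisum" "\<theta> ?Y = \<zero>\<^bsub>mt ?Y\<^esub>" "u = tri \<theta>" by blast
    have "a \<odot>\<^bsub>trisum\<^esub> \<theta> \<in> carrier trisum"
    proof -
      have "{Z \<in> iso_classes G. (a \<odot>\<^bsub>trisum\<^esub> \<theta>) Z \<noteq> \<zero>\<^bsub>mt Z\<^esub>} \<subseteq> {Z \<in> iso_classes G. \<theta> Z \<noteq> \<zero>\<^bsub>mt Z\<^esub>}"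
      proof clarify
        fix Z assume Z: "Z \<in> iso_classes G" "(a \<odot>\<^bsub>trisum\<^esub> \<theta>) Z \<noteq> \<zero>\<^bsub>mt Z\<^esub>" "\<theta> Z = \<zero>\<^bsub>mt Z\<^esub>"
        interpret V: vectorspace K "mt Z" by (rule mt_space[OF rep_Ob[OF Z(1)]])
        show False using Z a by (simp add: S_simps(4))
      qed
      moreover have "finite {Z \<in> iso_classes G. \<theta> Z \<noteq> \<zero>\<^bsub>mt Z\<^esub>}"
        using * by (simp add: S_simps(1))
      ultimately have "finite {Z \<in> iso_classes G. (a \<odot>\<^bsub>trisum\<^esub> \<theta>) Z \<noteq> \<zero>\<^bsub>mt Z\<^esub>}" by (rule finite_subset)
      moreover have "a \<odot>\<^bsub>mt Z\<^esub> \<theta> Z \<in> carrier (mt Z)" if "Z \<in> iso_classes G" for Z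
        using vs_subspaceD(4)[OF subspace_carrier[OF mt_space[OF rep_Ob[OF that]]] a] * that
        by (auto simp: S_simps(1))
      ultimately show ?thesis by (simp add: S_simps(1,4))
    qed
    moreover have "(a \<odot>\<^bsub>trisum\<^esub> \<theta>) ?Y = \<zero>\<^bsub>mt ?Y\<^esub>"
    proof -
      interpret V: vectorspace K "mt ?Y" by (rule mt_space[OF rep_Ob[OF Y]])
      show ?thesis using * Y a by (simp add: S_simps(4))
    qed
    moreover have "tri (a \<odot>\<^bsub>trisum\<^esub> \<theta>) = a \<odot>\<^bsub>Hom G x z\<^esub> u" using module_hom_smult[OF tri_hom a *(1)] * by simp
    ultimately show "a \<odot>\<^bsub>Hom G x z\<^esub> u \<in> ?A" by (metis (mono_tags, lifting) imageI mem_Collect_eq)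
  qed
  have "triangle_gens x z (\<lambda>y. \<not> iso_ob G x y) \<subseteq> ?A"
  proof
    fix g assume "g \<in> triangle_gens x z (\<lambda>y. \<not> iso_ob G x y)"
    then obtain y u d where *: "y \<in> Ob G" "\<not> iso_ob G x y" "u \<in> U y z" "d \<in> D x y" "g = Comp G x y z u d"
      by (auto simp: triangle_gens_def)
    obtain t where t: "t \<in> carrier (mt (iso_class G y))" "tri (single (iso_class G y) t) = g"
      using Comp_single[OF *(1,3,4)] *(5) by metis
    have "?Y \<noteq> iso_class G y" using * iso_class_eq_iff[OF x *(1)] by simp
    then have "single (iso_class G y) t ?Y = \<zero>\<^bsub>mt ?Y\<^esub>" using Y by (simp add: single_def)
    then show "g \<in> ?A" using t single_closed[OF iso_class_in[OF *(1)] t(1)] by force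
  qed
  then have "off_diag x z \<subseteq> ?A" by (rule off_diag_least[OF A])
  then obtain \<theta> where \<theta>: "\<theta> \<in> carrier trisum" "\<theta> ?Y = \<zero>\<^bsub>mt ?Y\<^esub>" "f = tri \<theta>" using f by blast
  have fc: "f \<in> U x z" "f \<in> carrier (Hom G x z)" using f U_sub x z by blast+
  \<comment> \<open>Writing \<open>f\<close> as \<open>f\<close> after the identity of
    \<open>x\<close>, with \<open>f\<close> in \<open>U\<close> and the identity in
    \<open>D\<close>, places it in the summand of the class of \<open>x\<close>.\<close>
  obtain t where t: "t \<in> carrier (mt ?Y)" "tri (single ?Y t) = Comp G x x z f (Id G x)"
    using Comp_single[OF x fc(1) wide_subcategoryD(4)[OF wide_D x]] by metis
  then have eq: "tri (single ?Y t) = tri \<theta>" using Id_right[OF x z fc(2)] \<theta>(3) by simp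
  have "single ?Y t = \<theta>"
    using inj_onD[OF bij_betw_imp_inj_on[OF tri_bij] eq single_closed[OF Y t(1)] \<theta>(1)] .
  moreover have "single ?Y t ?Y = t" using Y by (simp add: single_def)
  ultimately have "t = \<zero>\<^bsub>mt ?Y\<^esub>" using \<theta>(2) by simp
  then have "lift t = \<zero>\<^bsub>Hom G x z\<^esub>"
    using module_hom_zero[OF mt_space[OF rep_Ob[OF Y]] Hom_space[OF x z] lift_hom[OF rep_Ob[OF Y]]] by simp
  then show "f \<in> {\<zero>\<^bsub>Hom G x z\<^esub>}" using tri_single[OF Y t(1)] eq \<theta>(3) by simp
qed

text \<open>A composite \<open>u d\<close> through the class of \<open>x\<close> has both factors
  between isomorphic objects, so both lie in the middle category by \<open>UD_iso\<close>; any other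
  composite is off-diagonal by definition.\<close>

lemma diag_sum:
  assumes iso: "iso_ob G x z" and g: "g \<in> carrier (Hom G x z)"
  shows "\<exists>a\<in>M x z. \<exists>b\<in>off_diag x z. g = a \<oplus>\<^bsub>Hom G x z\<^esub> b"
proof -
  interpret H: vectorspace K "Hom G x z" using Hom_space x z by blast
  let ?B = "off_diag x z"
  have M: "VectorSpace.subspace K (M x z) (Hom G x z)" by (rule wide_subcategoryD(1)[OF wide_M x z])
  note B = off_diag_subspace[OF x z]
  let ?W = "{a \<oplus>\<^bsub>Hom G x z\<^esub> b | a b. a \<in> M x z \<and> b \<in> ?B}"
  have "triangle_gens x z (\<lambda>y. True) \<subseteq> ?W"
  proof
    fix g assume "g \<in> triangle_gens x z (\<lambda>y. True)"
    then obtain y u d where *: "y \<in> Ob G" "u \<in> U y z" "d \<in> D x y" "g = Comp G x y z u d"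
      by (auto simp: triangle_gens_def)
    have gc: "g \<in> carrier (Hom G x z)"
      using Comp_closed[OF x *(1) z D_sub[OF x *(1,3)] U_sub[OF *(1) z *(2)]] * by simp
    show "g \<in> ?W"
    proof (cases "iso_ob G x y")
      case True
      then have "iso_ob G y z" using iso iso_ob_sym iso_ob_trans by blast
      then have "g \<in> M x z"
        using * UD_iso[OF True] UD_iso[of y z] U_comp[OF x *(1) z] D_comp[OF x *(1) z] by blast
      then show ?thesis using gc vs_subspaceD(2)[OF B] H.M.r_zero[OF gc, symmetric] by blast
    next
      case False
      then have "g \<in> ?B" using off_diag_gens[OF x z] * by (auto simp: triangle_gens_def)
      then show ?thesis using gc vs_subspaceD(2)[OF M] H.M.l_zero[OF gc, symmetric] by blast
    qed
  qed
  then show ?thesis using Hom_span[OF subspace_sum[OF M B] _ g] by blast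
qed

lemma diag_projection:
  assumes iso: "iso_ob G x z"
  obtains \<pi> where "\<pi> \<in> module_hom K (Hom G x z) (Hom Mid x z)"
    "\<And>a b. \<lbrakk>a \<in> M x z; b \<in> off_diag x z\<rbrakk> \<Longrightarrow> \<pi> (a \<oplus>\<^bsub>Hom G x z\<^esub> b) = a"
proof -
  have M: "VectorSpace.subspace K (M x z) (Hom G x z)" by (rule wide_subcategoryD(1)[OF wide_M x z])
  note B = off_diag_subspace[OF x z]
  obtain \<pi> where "\<pi> \<in> module_hom K (Hom G x z) ((Hom G x z)\<lparr>carrier := M x z\<rparr>)"
    "\<And>a b. \<lbrakk>a \<in> M x z; b \<in> off_diag x z\<rbrakk> \<Longrightarrow> \<pi> (a \<oplus>\<^bsub>Hom G x z\<^esub> b) = a"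
    using subspace_projection[OF M B M_off_diag[OF iso] diag_sum[OF iso]] by blast
  then show thesis using that by (simp add: Mid_eq Hom_sub_cat)
qed

end

text \<open>Fixes one projection for each pair of objects. It is specified only for isomorphic
  \<open>x\<close> and \<open>z\<close>; for other pairs the value is arbitrary, and later uses
  guard against this case.\<close>

definition proj :: "'o \<Rightarrow> 'o \<Rightarrow> 'm \<Rightarrow> 'm" where
  "proj x z = (SOME \<pi>. \<pi> \<in> module_hom K (Hom G x z) (Hom Mid x z) \<and>
    (\<forall>a\<in>M x z. \<forall>b\<in>off_diag x z. \<pi> (a \<oplus>\<^bsub>Hom G x z\<^esub> b) = a))"

lemma proj:
  assumes "iso_ob G x z"
  shows proj_hom: "proj x z \<in> module_hom K (Hom G x z) (Hom Mid x z)"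
    and proj_eq: "\<And>a b. \<lbrakk>a \<in> M x z; b \<in> off_diag x z\<rbrakk> \<Longrightarrow> proj x z (a \<oplus>\<^bsub>Hom G x z\<^esub> b) = a"
proof -
  have x: "x \<in> Ob G" "z \<in> Ob G" using assms by (auto simp: iso_ob_def)
  have "\<exists>\<pi>. \<pi> \<in> module_hom K (Hom G x z) (Hom Mid x z) \<and>
    (\<forall>a\<in>M x z. \<forall>b\<in>off_diag x z. \<pi> (a \<oplus>\<^bsub>Hom G x z\<^esub> b) = a)"
    using diag_projection[OF x assms] by metis
  from someI_ex[OF this, folded proj_def]
  show "proj x z \<in> module_hom K (Hom G x z) (Hom Mid x z)"
    "\<And>a b. \<lbrakk>a \<in> M x z; b \<in> off_diag x z\<rbrakk> \<Longrightarrow> proj x z (a \<oplus>\<^bsub>Hom G x z\<^esub> b) = a" by blast+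
qed

lemma proj_M:
  assumes iso: "iso_ob G x z" and f: "f \<in> M x z" shows "proj x z f = f"
proof -
  have x: "x \<in> Ob G" "z \<in> Ob G" using iso by (auto simp: iso_ob_def)
  interpret H: vectorspace K "Hom G x z" using Hom_space x by blast
  have "f \<oplus>\<^bsub>Hom G x z\<^esub> \<zero>\<^bsub>Hom G x z\<^esub> = f" using f U_sub x by simp
  then show ?thesis using proj_eq[OF iso f vs_subspaceD(2)[OF off_diag_subspace[OF x]]] by simp
qed

lemma proj_off_diag:
  assumes iso: "iso_ob G x z" and f: "f \<in> off_diag x z" shows "proj x z f = \<zero>\<^bsub>Hom G x z\<^esub>"
proof -
  have x: "x \<in> Ob G" "z \<in> Ob G" using iso by (auto simp: iso_ob_def)
  interpret H: vectorspace K "Hom G x z" using Hom_space x by blast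
  have "\<zero>\<^bsub>Hom G x z\<^esub> \<oplus>\<^bsub>Hom G x z\<^esub> f = f" using f vs_subspaceD(1)[OF off_diag_subspace[OF x]] by auto
  then show ?thesis using proj_eq[OF iso wide_subcategoryD(3)[OF wide_M x] f] by simp
qed

text \<open>Precomposing \<open>u d\<close> with \<open>f\<close> changes only the factor
  \<open>d\<close> and keeps the middle object, and being isomorphic to \<open>x\<close> is the same
  as being isomorphic to \<open>x'\<close>.\<close>

lemma off_diag_comp_M:
  assumes x: "x \<in> Ob G" and iso: "iso_ob G x x'" and z: "z \<in> Ob G" and f: "f \<in> M x x'"
    and g: "g \<in> off_diag x' z"
  shows "Comp G x x' z g f \<in> off_diag x z"
proof -
  have x': "x' \<in> Ob G" using iso by (auto simp: iso_ob_def)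
  have fc: "f \<in> carrier (Hom G x x')" using U_sub x x' f by blast
  have "off_diag x' z \<subseteq> {g \<in> carrier (Hom G x' z). Comp G x x' z g f \<in> off_diag x z}"
  proof (rule off_diag_least)
    show "VectorSpace.subspace K {g \<in> carrier (Hom G x' z). Comp G x x' z g f \<in> off_diag x z} (Hom G x' z)"
      by (rule module_hom_vimage_subspace[OF Hom_space[OF x' z] Comp_linear_left[OF x x' z fc] off_diag_subspace[OF x z]])
    show "triangle_gens x' z (\<lambda>y. \<not> iso_ob G x' y) \<subseteq> {g \<in> carrier (Hom G x' z). Comp G x x' z g f \<in> off_diag x z}"
    proof
      fix g assume g': "g \<in> triangle_gens x' z (\<lambda>y. \<not> iso_ob G x' y)"
      then obtain y u d where *: "y \<in> Ob G" "\<not> iso_ob G x' y" "u \<in> U y z" "d \<in> D x' y" "g = Comp G x' y z u d"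
        by (auto simp: triangle_gens_def)
      have "\<not> iso_ob G x y" using * iso iso_ob_sym iso_ob_trans by blast
      moreover have "Comp G x x' y d f \<in> D x y" using D_comp[OF x x' *(1)] f * by blast
      moreover have "Comp G x x' z g f = Comp G x y z u (Comp G x x' y d f)"
        using Comp_assoc[OF x x' *(1) z fc D_sub[OF x' *(1,4)] U_sub[OF *(1) z *(3)]] * by simp
      ultimately have "Comp G x x' z g f \<in> triangle_gens x z (\<lambda>y. \<not> iso_ob G x y)"
        using * by (auto simp: triangle_gens_def)
      then show "g \<in> {g \<in> carrier (Hom G x' z). Comp G x x' z g f \<in> off_diag x z}"
        using off_diag_gens[OF x z] g' triangle_gens_closed[OF x' z] by auto
    qed
  qed
  then show ?thesis using g by blast
qed

lemma Hom_decomp: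
  assumes iso: "iso_ob G x z" and g: "g \<in> carrier (Hom G x z)"
  obtains b where "b \<in> off_diag x z" "proj x z g \<in> M x z" "g = proj x z g \<oplus>\<^bsub>Hom G x z\<^esub> b"
proof -
  have x: "x \<in> Ob G" "z \<in> Ob G" using iso by (auto simp: iso_ob_def)
  obtain a b where "a \<in> M x z" "b \<in> off_diag x z" "g = a \<oplus>\<^bsub>Hom G x z\<^esub> b"
    using diag_sum[OF x iso g] by blast
  then show thesis using that[of b] proj_eq[OF iso] by simp
qed

text \<open>The half of balancedness that concerns isomorphic objects: both summands of
  \<open>Hom G x' z\<close> are carried to the corresponding summands by precomposition with
  \<open>f\<close>.\<close>

lemma proj_comp_M:
  assumes iso: "iso_ob G x x'" and iso': "iso_ob G x' z" and f: "f \<in> M x x'" and g: "g \<in> carrier (Hom G x' z)"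
  shows "proj x z (Comp G x x' z g f) = Comp G x x' z (proj x' z g) f"
proof -
  have x: "x \<in> Ob G" "x' \<in> Ob G" "z \<in> Ob G" using iso iso' by (auto simp: iso_ob_def)
  obtain b where b: "b \<in> off_diag x' z" "proj x' z g \<in> M x' z" "g = proj x' z g \<oplus>\<^bsub>Hom G x' z\<^esub> b"
    using Hom_decomp[OF iso' g] by blast
  have c: "proj x' z g \<in> carrier (Hom G x' z)" "b \<in> carrier (Hom G x' z)" "f \<in> carrier (Hom G x x')"
    using b f U_sub x vs_subspaceD(1)[OF off_diag_subspace[OF x(2,3)]] by blast+
  have "Comp G x x' z g f = Comp G x x' z (proj x' z g) f \<oplus>\<^bsub>Hom G x z\<^esub> Comp G x x' z b f"
    by (subst b(3)) (rule module_hom_add[OF Comp_linear_left[OF x c(3)] c(1,2)])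
  moreover have "Comp G x x' z (proj x' z g) f \<in> M x z"
    using wide_subcategoryD(5)[OF wide_M x f] b(2) by blast
  moreover have "Comp G x x' z b f \<in> off_diag x z" by (rule off_diag_comp_M[OF x(1) iso x(3) f b(1)])
  ultimately show ?thesis using proj_eq[OF iso_ob_trans[OF iso iso']] by simp
qed

text \<open>The half of balancedness that concerns non-isomorphic objects, where \<open>f\<close>
  acts by zero on the extended simple module: its composites must have no middle component.\<close>

lemma comp_D_off_diag:
  assumes x: "x \<in> Ob G" and x': "x' \<in> Ob G" and z: "z \<in> Ob G" and ni: "\<not> iso_ob G x x'"
    and f: "f \<in> D x x'" and g: "g \<in> carrier (Hom G x' z)"
  shows "Comp G x x' z g f \<in> off_diag x z"
proof -
  have fc: "f \<in> carrier (Hom G x x')" using D_sub x x' f by blast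
  have "g \<in> {g \<in> carrier (Hom G x' z). Comp G x x' z g f \<in> off_diag x z}"
  proof (rule Hom_span[OF x' z _ _ g])
    show "VectorSpace.subspace K {g \<in> carrier (Hom G x' z). Comp G x x' z g f \<in> off_diag x z} (Hom G x' z)"
      by (rule module_hom_vimage_subspace[OF Hom_space[OF x' z] Comp_linear_left[OF x x' z fc] off_diag_subspace[OF x z]])
    show "triangle_gens x' z (\<lambda>y. True) \<subseteq> {g \<in> carrier (Hom G x' z). Comp G x x' z g f \<in> off_diag x z}"
    proof
      fix g assume g': "g \<in> triangle_gens x' z (\<lambda>y. True)"
      then obtain y u d where *: "y \<in> Ob G" "u \<in> U y z" "d \<in> D x' y" "g = Comp G x' y z u d"
        by (auto simp: triangle_gens_def)
      have df: "Comp G x x' y d f \<in> D x y" using D_comp[OF x x' *(1) f *(3)] .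
      have eq: "Comp G x x' z g f = Comp G x y z u (Comp G x x' y d f)"
        using Comp_assoc[OF x x' *(1) z fc D_sub[OF x' *(1,3)] U_sub[OF *(1) z *(2)]] * by simp
      have "Comp G x x' z g f \<in> off_diag x z"
      proof (cases "iso_ob G x y")
        case False
        then have "Comp G x x' z g f \<in> triangle_gens x z (\<lambda>y. \<not> iso_ob G x y)"
          using * df eq by (auto simp: triangle_gens_def)
        then show ?thesis using off_diag_gens[OF x z] by blast
      next
        case True
        \<comment> \<open>Otherwise \<open>x'\<close> would lie below \<open>x\<close> and above
          \<open>y\<close>, whose class is that of \<open>x\<close>, and antisymmetry would make
          \<open>x'\<close> isomorphic to \<open>x\<close>.\<close>
        have "Comp G x x' y d f = \<zero>\<^bsub>Hom G x y\<^esub>"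
        proof (rule ccontr)
          assume nz: "Comp G x x' y d f \<noteq> \<zero>\<^bsub>Hom G x y\<^esub>"
          then have "f \<noteq> \<zero>\<^bsub>Hom G x x'\<^esub>" "d \<noteq> \<zero>\<^bsub>Hom G x' y\<^esub>"
            using Comp_zero_right[OF x x' *(1) D_sub[OF x' *(1,3)]] Comp_zero_left[OF x x' *(1) fc] by auto
          then have "(iso_class G x', iso_class G x) \<in> r" "(iso_class G y, iso_class G x') \<in> r"
            using D_le[OF x x' f] D_le[OF x' *(1,3)] by auto
          moreover have "iso_class G x = iso_class G y" using iso_class_eq_iff[OF x *(1)] True by simp
          ultimately show False using iso_of_le[OF x x'] ni by simp
        qed
        then have "Comp G x x' z g f = \<zero>\<^bsub>Hom G x z\<^esub>"
          using eq Comp_zero_right[OF x *(1) z U_sub[OF *(1) z *(2)]] by simp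
        then show ?thesis using vs_subspaceD(2)[OF off_diag_subspace[OF x z]] by simp
      qed
      then show "g \<in> {g \<in> carrier (Hom G x' z). Comp G x x' z g f \<in> off_diag x z}"
        using g' triangle_gens_closed[OF x' z] by auto
    qed
  qed
  then show ?thesis by simp
qed

end

lemma cat_module_iso_on:
  assumes "cat_module K C N" "cat_module K C N'" "cat_module_hom K C N N' \<phi>"
    and "\<And>x. \<lbrakk>x \<in> Ob C; x \<in> Y\<rbrakk> \<Longrightarrow> bij_betw (\<phi> x) (carrier (Val N x)) (carrier (Val N' x))"
    and "\<And>x. \<lbrakk>x \<in> Ob C; x \<notin> Y\<rbrakk> \<Longrightarrow> carrier (Val N x) = {\<zero>\<^bsub>Val N x\<^esub>}"
    and "\<And>x. \<lbrakk>x \<in> Ob C; x \<notin> Y\<rbrakk> \<Longrightarrow> carrier (Val N' x) = {\<zero>\<^bsub>Val N' x\<^esub>}"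
  shows "cat_module_iso K C N N'"
proof -
  interpret N: cat_module K C N by fact
  interpret N': cat_module K C N' by fact
  have "bij_betw (\<phi> x) (carrier (Val N x)) (carrier (Val N' x))" if "x \<in> Ob C" for x
  proof (cases "x \<in> Y")
    case False
    have "\<phi> x \<zero>\<^bsub>Val N x\<^esub> = \<zero>\<^bsub>Val N' x\<^esub>"
      using module_hom_zero[OF N.Val_space N'.Val_space cat_module_homD(1)[OF assms(3)]] that by blast
    then show ?thesis using assms(5,6)[OF that False] by (simp add: bij_betw_def)
  qed (use assms(4) that in blast)
  then show ?thesis unfolding cat_module_iso_def using assms(3) by blast
qed

context ordered_triangular_category
begin

subsection \<open>Weights\<close>

lemma weight_rep_properties:
  assumes "l \<in> weights K G U D"
  shows weight_rep_simple: "simple_module K Mid (weight_rep l)"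
    and weight_mem_iff: "S \<in> l \<longleftrightarrow> simple_module K Mid S \<and> cat_module_iso K Mid (weight_rep l) S"
proof -
  let ?A = "{S. simple_module K Mid S} :: ('o, 'm, 'k, 'm set) lin_functor set"
  let ?R = "{(S, S'). S \<in> ?A \<and> S' \<in> ?A \<and> cat_module_iso K Mid S S'}"
  have "l \<in> ?A // ?R" using assms by (simp add: weights_def Let_def)
  then obtain S where S: "S \<in> ?A" "l = ?R `` {S}" by (rule quotientE)
  have l: "S' \<in> l \<longleftrightarrow> simple_module K Mid S' \<and> cat_module_iso K Mid S S'" for S'
    using S by auto
  have "S \<in> l" using l S cat_module_iso_refl by blast
  then have rep: "weight_rep l \<in> l" unfolding weight_rep_def by (rule someI)
  then show simple: "simple_module K Mid (weight_rep l)" using l by blast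
  have iso: "cat_module_iso K Mid S (weight_rep l)" using l rep by blast
  then have "cat_module_iso K Mid (weight_rep l) S"
    using cat_module_iso_sym S(1) by (auto simp: simple_module_def)
  then show "S' \<in> l \<longleftrightarrow> simple_module K Mid S' \<and> cat_module_iso K Mid (weight_rep l) S'" for S'
    using l iso cat_module_iso_trans by metis
qed

lemma weight_rep_module: "l \<in> weights K G U D \<Longrightarrow> cat_module K Mid (weight_rep l)"
  using weight_rep_simple by (simp add: simple_module_def)

lemma weight_eqI:
  assumes "l \<in> weights K G U D" "m \<in> weights K G U D" "cat_module_iso K Mid (weight_rep l) (weight_rep m)"
  shows "l = m"
proof -
  have "cat_module_iso K Mid (weight_rep m) (weight_rep l)"
    using cat_module_iso_sym[OF weight_rep_module[OF assms(1)] assms(3)] .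
  then show ?thesis
    using weight_mem_iff[OF assms(1)] weight_mem_iff[OF assms(2)] assms(3) cat_module_iso_trans by blast
qed

text \<open>\<open>N\<close> may have vectors of any type; \<open>simple_module_universe\<close>
  moves it into the type in which weights live.\<close>

lemma weight_exists:
  fixes N :: "('o, 'm, 'k, 'v) lin_functor"
  assumes "simple_module K Mid N"
  obtains l where "l \<in> weights K G U D" "cat_module_iso K Mid N (weight_rep l)"
proof -
  obtain S :: "('o, 'm, 'k, 'm set) lin_functor"
    where S: "simple_module K Mid S" "cat_module_iso K Mid N S"
    using simple_module_universe[OF assms] by blast
  let ?A = "{S. simple_module K Mid S} :: ('o, 'm, 'k, 'm set) lin_functor set"
  let ?R = "{(S, S'). S \<in> ?A \<and> S' \<in> ?A \<and> cat_module_iso K Mid S S'}"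
  have l: "?R `` {S} \<in> weights K G U D"
    using S(1) quotientI[of S ?A ?R] by (simp add: weights_def Let_def)
  have "S \<in> ?R `` {S}" using S(1) cat_module_iso_refl by blast
  then have "cat_module_iso K Mid (weight_rep (?R `` {S})) S" using weight_mem_iff[OF l] by blast
  then have "cat_module_iso K Mid S (weight_rep (?R `` {S}))"
    using cat_module_iso_sym[OF weight_rep_module[OF l]] by blast
  then show thesis using that[OF l] S(2) cat_module_iso_trans by blast
qed

lemma supp:
  assumes l: "l \<in> weights K G U D"
  shows supp_class: "supp G l \<in> iso_classes G"
    and supp_iff: "x \<in> Ob G \<Longrightarrow> carrier (Val (weight_rep l) x) \<noteq> {\<zero>\<^bsub>Val (weight_rep l) x\<^esub>} \<longleftrightarrow> x \<in> supp G l"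
proof -
  interpret B: block_category K Mid by (rule Mid_block)
  obtain Y where Y: "Y \<in> iso_classes G"
    "\<And>x. x \<in> Ob G \<Longrightarrow> carrier (Val (weight_rep l) x) \<noteq> {\<zero>\<^bsub>Val (weight_rep l) x\<^esub>} \<longleftrightarrow> x \<in> Y"
    using B.simple_support[OF weight_rep_simple[OF l]] by auto
  have "supp G l = Y"
    unfolding supp_def
  proof (rule the_equality)
    have "class_rep Y \<in> Y" "class_rep Y \<in> Ob G" using class_rep_in[OF Y(1)] iso_classes_Ob[OF Y(1)] by blast+
    then show "Y \<in> iso_classes G \<and> (\<exists>x\<in>Y. carrier (Val (weight_rep l) x) \<noteq> {\<zero>\<^bsub>Val (weight_rep l) x\<^esub>})"
      using Y by blast
    fix Z assume Z: "Z \<in> iso_classes G \<and> (\<exists>x\<in>Z. carrier (Val (weight_rep l) x) \<noteq> {\<zero>\<^bsub>Val (weight_rep l) x\<^esub>})"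
    then obtain x where "x \<in> Z" "x \<in> Y" using Y(2) iso_classes_Ob by blast
    then show "Z = Y" using Z Y(1) iso_classes_eq by metis
  qed
  then show "supp G l \<in> iso_classes G"
    "x \<in> Ob G \<Longrightarrow> carrier (Val (weight_rep l) x) \<noteq> {\<zero>\<^bsub>Val (weight_rep l) x\<^esub>} \<longleftrightarrow> x \<in> supp G l"
    using Y by auto
qed

lemma supp_Ob: "\<lbrakk>l \<in> weights K G U D; x \<in> supp G l\<rbrakk> \<Longrightarrow> x \<in> Ob G"
  using supp_class iso_classes_Ob by blast

lemma supp_eq: "\<lbrakk>l \<in> weights K G U D; x \<in> supp G l\<rbrakk> \<Longrightarrow> supp G l = iso_class G x"
  using supp_class iso_classes_eq by blast

lemma supp_nonempty: "l \<in> weights K G U D \<Longrightarrow> \<exists>x. x \<in> supp G l"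
  using supp_class class_rep_in by blast

lemma off_supp: "\<lbrakk>l \<in> weights K G U D; x \<in> Ob G; x \<notin> supp G l\<rbrakk>
    \<Longrightarrow> carrier (Val (weight_rep l) x) = {\<zero>\<^bsub>Val (weight_rep l) x\<^esub>}"
  using supp_iff by blast

subsection \<open>Modules with a given lowest part\<close>

text \<open>What a standard module and its simple quotient have in common: nothing outside the part
  above the support, and exactly \<open>S\<^sub>\<lambda>\<close> on it. Bijectivity of
  \<open>\<sigma>\<close> is asked for on the support alone, since the source vanishes at the other
  objects.\<close>

definition has_bottom :: "('o, 'm, 'k) weight \<Rightarrow> ('o, 'm, 'k, 'v) lin_functor \<Rightarrow> bool" where
  "has_bottom l N \<longleftrightarrow> cat_module K G N \<and>
    (\<forall>y\<in>Ob G. carrier (Val N y) \<noteq> {\<zero>\<^bsub>Val N y\<^esub>} \<longrightarrow> (supp G l, iso_class G y) \<in> r) \<and>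
    (\<exists>\<sigma>. cat_module_hom K Mid (weight_rep l) N \<sigma> \<and>
      (\<forall>y\<in>supp G l. bij_betw (\<sigma> y) (carrier (Val (weight_rep l) y)) (carrier (Val N y))))"

definition bottom_generates :: "('o, 'm, 'k) weight \<Rightarrow> ('o, 'm, 'k, 'v) lin_functor \<Rightarrow> bool" where
  "bottom_generates l N \<longleftrightarrow> (\<forall>T. cat_submodule K G N T \<and> (\<forall>y\<in>supp G l. T y = carrier (Val N y)) \<longrightarrow>
    (\<forall>y\<in>Ob G. T y = carrier (Val N y)))"

lemma has_bottom_module: "has_bottom l N \<Longrightarrow> cat_module K G N"
  by (simp add: has_bottom_def)

lemma bottom_le:
  assumes "has_bottom l N" "y \<in> Ob G" "carrier (Val N y) \<noteq> {\<zero>\<^bsub>Val N y\<^esub>}"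
  shows "(supp G l, iso_class G y) \<in> r"
  using assms by (simp add: has_bottom_def)

text \<open>The preimage of \<open>T\<close> under \<open>\<sigma>\<close> is a submodule of a
  simple module. Only stability under middle morphisms is required of \<open>T\<close>, so this
  serves filtrations over the middle category as well as submodules over \<open>G\<close>.\<close>

lemma bottom_irreducible:
  assumes l: "l \<in> weights K G U D" and N: "has_bottom l N" and T: "cat_submodule K Mid N T"
  shows "(\<forall>y\<in>supp G l. T y = {\<zero>\<^bsub>Val N y\<^esub>}) \<or> (\<forall>y\<in>supp G l. T y = carrier (Val N y))"
proof -
  let ?S = "weight_rep l"
  note m = weight_rep_module[OF l]
  interpret S: cat_module K Mid ?S by (rule m)
  interpret N: cat_module K G N by (rule has_bottom_module[OF N])
  obtain \<sigma> where \<sigma>: "cat_module_hom K Mid ?S N \<sigma>"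
    and b: "\<And>y. y \<in> supp G l \<Longrightarrow> bij_betw (\<sigma> y) (carrier (Val ?S y)) (carrier (Val N y))"
    using N by (auto simp: has_bottom_def)
  have v: "cat_submodule K Mid ?S (hom_vimage Mid ?S \<sigma> T)" by (rule vimage_submodule[OF m \<sigma> T])
  have sv: "T y = \<sigma> y ` hom_vimage Mid ?S \<sigma> T y" if y: "y \<in> supp G l" for y
  proof -
    have "y \<in> Ob G" using supp_Ob[OF l y] .
    moreover then have "T y \<subseteq> \<sigma> y ` carrier (Val ?S y)"
      using b[OF y] cat_submoduleD(2)[OF T] unfolding bij_betw_def by simp
    ultimately show ?thesis by (auto simp: hom_vimage_def)
  qed
  have "(\<forall>y\<in>Ob Mid. hom_vimage Mid ?S \<sigma> T y = {\<zero>\<^bsub>Val ?S y\<^esub>}) \<or>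
      (\<forall>y\<in>Ob Mid. hom_vimage Mid ?S \<sigma> T y = carrier (Val ?S y))"
    using weight_rep_simple[OF l] v unfolding simple_module_def by blast
  then show ?thesis
  proof
    assume *: "\<forall>y\<in>Ob Mid. hom_vimage Mid ?S \<sigma> T y = {\<zero>\<^bsub>Val ?S y\<^esub>}"
    have "T y = {\<zero>\<^bsub>Val N y\<^esub>}" if y: "y \<in> supp G l" for y
      using sv[OF y] * supp_Ob[OF l y] module_hom_zero[OF S.Val_space N.Val_space cat_module_homD(1)[OF \<sigma>], of y] by simp
    then show ?thesis by blast
  next
    assume *: "\<forall>y\<in>Ob Mid. hom_vimage Mid ?S \<sigma> T y = carrier (Val ?S y)"
    have "T y = carrier (Val N y)" if y: "y \<in> supp G l" for y
      using sv[OF y] * supp_Ob[OF l y] b[OF y] by (simp add: bij_betw_def)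
    then show ?thesis by blast
  qed
qed

lemma bottom_nonzero:
  assumes l: "l \<in> weights K G U D" and N: "has_bottom l N" and y: "y \<in> supp G l"
  shows "carrier (Val N y) \<noteq> {\<zero>\<^bsub>Val N y\<^esub>}"
proof
  let ?S = "weight_rep l"
  assume z: "carrier (Val N y) = {\<zero>\<^bsub>Val N y\<^esub>}"
  interpret S: cat_module K Mid ?S by (rule weight_rep_module[OF l])
  obtain \<sigma> where "bij_betw (\<sigma> y) (carrier (Val ?S y)) (carrier (Val N y))"
    using N y by (auto simp: has_bottom_def)
  \<comment> \<open>Cardinality one characterizes the zero space and is visible to a mere
    bijection.\<close>
  then have "card (carrier (Val ?S y)) = 1" using z bij_betw_same_card by fastforce
  then have "carrier (Val ?S y) = {\<zero>\<^bsub>Val ?S y\<^esub>}"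
    using S.Val_zero_closed[of y] supp_Ob[OF l y] by (auto simp: card_1_singleton_iff)
  then show False using supp_iff[OF l supp_Ob[OF l y]] y by simp
qed

text \<open>Serves both for the quotient by the radical, which is injective on the support, and for
  isomorphisms between simple heads.\<close>

lemma bottom_transport:
  assumes l: "l \<in> weights K G U D" and N: "has_bottom l N" and N': "cat_module K G N'"
    and h: "cat_module_hom K G N N' \<phi>"
    and surj: "\<And>y. y \<in> Ob G \<Longrightarrow> \<phi> y ` carrier (Val N y) = carrier (Val N' y)"
    and inj: "\<And>y. y \<in> supp G l \<Longrightarrow> inj_on (\<phi> y) (carrier (Val N y))"
  shows "has_bottom l N'"
proof -
  interpret N: cat_module K G N by (rule has_bottom_module[OF N])
  interpret N': cat_module K G N' by (rule N')
  obtain \<sigma> where \<sigma>: "cat_module_hom K Mid (weight_rep l) N \<sigma>"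
    and b: "\<And>y. y \<in> supp G l \<Longrightarrow> bij_betw (\<sigma> y) (carrier (Val (weight_rep l) y)) (carrier (Val N y))"
    using N by (auto simp: has_bottom_def)
  have "bij_betw (\<lambda>v. \<phi> y (\<sigma> y v)) (carrier (Val (weight_rep l) y)) (carrier (Val N' y))"
    if y: "y \<in> supp G l" for y
    using bij_betw_trans[OF b[OF y], of "\<phi> y" "carrier (Val N' y)"] inj[OF y] surj[OF supp_Ob[OF l y]]
    by (simp add: bij_betw_def comp_def)
  moreover have "carrier (Val N y) \<noteq> {\<zero>\<^bsub>Val N y\<^esub>}"
    if "y \<in> Ob G" "carrier (Val N' y) \<noteq> {\<zero>\<^bsub>Val N' y\<^esub>}" for y
    using surj[OF that(1)] that(2)
      module_hom_zero[OF N.Val_space[OF that(1)] N'.Val_space[OF that(1)] cat_module_homD(1)[OF h that(1)]] by auto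
  ultimately show ?thesis
    unfolding has_bottom_def using N' bottom_le[OF N] cat_module_hom_comp[OF \<sigma> Mid_hom[OF h]] by blast
qed

lemma class_part_iso:
  assumes l: "l \<in> weights K G U D" and N: "has_bottom l N"
  shows "cat_submodule K Mid N (block_category.class_part Mid N (supp G l))"
    and "cat_module_iso K Mid (weight_rep l) (sub_module N (block_category.class_part Mid N (supp G l)))"
proof -
  interpret B: block_category K Mid by (rule Mid_block)
  let ?P = "B.class_part N (supp G l)" and ?S = "weight_rep l"
  note Nm = Mid_module[OF has_bottom_module[OF N]]
  interpret N: cat_module K Mid N by (rule Nm)
  interpret S: cat_module K Mid ?S by (rule weight_rep_module[OF l])
  show P: "cat_submodule K Mid N ?P"
    by (rule B.class_part_submodule[OF Nm]) (use supp_class[OF l] in simp)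
  obtain \<sigma> where \<sigma>: "cat_module_hom K Mid ?S N \<sigma>"
    and b: "\<And>y. y \<in> supp G l \<Longrightarrow> bij_betw (\<sigma> y) (carrier (Val ?S y)) (carrier (Val N y))"
    using N by (auto simp: has_bottom_def)
  have cl: "\<sigma> y v \<in> ?P y" if "y \<in> Ob G" "v \<in> carrier (Val ?S y)" for y v
    using that cat_module_homD(2)[OF \<sigma>, of y v] off_supp[OF l that(1)]
      module_hom_zero[OF S.Val_space N.Val_space cat_module_homD(1)[OF \<sigma>], of y]
    by (auto simp: B.class_part_def)
  have h: "cat_module_hom K Mid ?S (sub_module N ?P) \<sigma>"
    using \<sigma> cl unfolding cat_module_hom_def module_hom_def by auto
  show "cat_module_iso K Mid ?S (sub_module N ?P)"
  proof (rule cat_module_iso_on[OF S.cat_module_axioms sub_module_is_module[OF Nm P] h, where Y = "supp G l"])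
    show "bij_betw (\<sigma> x) (carrier (Val ?S x)) (carrier (Val (sub_module N ?P) x))"
      if "x \<in> Ob Mid" "x \<in> supp G l" for x
      using b that by (simp add: B.class_part_def)
  qed (use off_supp[OF l] in \<open>simp_all add: B.class_part_def\<close>)
qed

text \<open>Each support lies below the other, so they coincide; then both simple modules are
  isomorphic to the same part of \<open>N\<close>.\<close>

lemma bottom_unique:
  assumes l: "l \<in> weights K G U D" and m: "m \<in> weights K G U D"
    and Nl: "has_bottom l N" and Nm: "has_bottom m N"
  shows "l = m"
proof -
  obtain x y where x: "x \<in> supp G l" and y: "y \<in> supp G m" using supp_nonempty l m by blast
  have "(supp G m, supp G l) \<in> r" "(supp G l, supp G m) \<in> r"
    using bottom_le[OF Nm supp_Ob[OF l x] bottom_nonzero[OF l Nl x]]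
      bottom_le[OF Nl supp_Ob[OF m y] bottom_nonzero[OF m Nm y]] supp_eq[OF l x] supp_eq[OF m y] by simp_all
  then have "supp G l = supp G m" using r_antisym by blast
  then have "cat_module_iso K Mid (weight_rep l) (weight_rep m)"
    using class_part_iso(2)[OF l Nl] class_part_iso(2)[OF m Nm]
      cat_module_iso_sym[OF weight_rep_module[OF m]] cat_module_iso_trans by metis
  then show ?thesis by (rule weight_eqI[OF l m])
qed

text \<open>Multiplicity one and uniqueness of the copy both come from irreducibility on the
  support; the bound on the other weights comes from the position of the support of
  \<open>N\<close>.\<close>

theorem bottom_lowest_weight:
  assumes l: "l \<in> weights K G U D" and N: "has_bottom l N" and gen: "bottom_generates l N"
  shows "lowest_weight_module K G U D r l N"
proof -
  interpret B: block_category K Mid by (rule Mid_block)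
  let ?P = "B.class_part N (supp G l)" and ?S = "weight_rep l"
  note GN = has_bottom_module[OF N]
  note Nm = Mid_module[OF GN]
  interpret N: cat_module K Mid N by (rule Nm)
  note Sm = weight_rep_module[OF l]
  interpret S: cat_module K Mid ?S by (rule Sm)
  note P = class_part_iso[OF l N]
  have PS: "cat_module_iso K Mid (sub_module N ?P) ?S" by (rule cat_module_iso_sym[OF Sm P(2)])
  obtain x where x: "x \<in> supp G l" using supp_nonempty[OF l] by blast
  have xO: "x \<in> Ob G" by (rule supp_Ob[OF l x])
  have irr: "T y = {\<zero>\<^bsub>Val N y\<^esub>} \<or> T y = carrier (Val N y)"
    if "cat_submodule K Mid N T" "y \<in> supp G l" for T y
    using bottom_irreducible[OF l N that(1)] that(2) by blast
  have "multiplicity_in K Mid ?S N \<le> 1"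
    by (rule multiplicity_le_one[OF Nm Sm, of x]) (use irr x xO supp_iff[OF l xO] in auto)
  then have mult: "weight_mult K G U D l N = 1"
    using multiplicity_pos[OF Nm P(1) PS Sm] by (simp add: weight_mult_def)
  \<comment> \<open>A copy of the simple module is zero off the support and non-zero on it, hence by
    irreducibility everything there.\<close>
  have "T = ?P" if "weight_copy K G U D l N T" for T
  proof -
    have T: "cat_submodule K Mid N T" and iso: "cat_module_iso K Mid (sub_module N T) ?S"
      using that by (simp_all add: weight_copy_def)
    obtain \<phi> where b: "\<And>y. y \<in> Ob G \<Longrightarrow> bij_betw (\<phi> y) (T y) (carrier (Val ?S y))"
      using iso unfolding cat_module_iso_def by auto
    have zero: "T y = {\<zero>\<^bsub>Val N y\<^esub>} \<longleftrightarrow> y \<notin> supp G l" if y: "y \<in> Ob G" for y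
    proof -
      have "T y = {\<zero>\<^bsub>Val N y\<^esub>} \<longleftrightarrow> card (T y) = 1"
        using cat_submoduleD(3)[OF T, of y] y by (auto simp: card_1_singleton_iff)
      also have "\<dots> \<longleftrightarrow> card (carrier (Val ?S y)) = 1" using bij_betw_same_card[OF b[OF y]] by simp
      also have "\<dots> \<longleftrightarrow> carrier (Val ?S y) = {\<zero>\<^bsub>Val ?S y\<^esub>}"
        using S.Val_zero_closed[of y] y by (auto simp: card_1_singleton_iff)
      finally show ?thesis using supp_iff[OF l y] by blast
    qed
    show ?thesis
    proof
      fix y
      show "T y = ?P y"
        using zero[of y] irr[OF T, of y] cat_submoduleD(5)[OF T, of y] by (auto simp: B.class_part_def)
    qed
  qed
  moreover have "weight_copy K G U D l N ?P" using P(1) PS by (simp add: weight_copy_def)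
  ultimately have copy: "{T. weight_copy K G U D l N T} = {?P}" by blast
  have "generated_by K G N ?P"
    unfolding generated_by_def
  proof (intro allI impI)
    fix T assume T: "cat_submodule K G N T \<and> (\<forall>y\<in>Ob G. ?P y \<subseteq> T y)"
    have "T y = carrier (Val N y)" if "y \<in> supp G l" for y
    proof -
      have "?P y \<subseteq> T y" using T supp_Ob[OF l that] by simp
      moreover have "T y \<subseteq> carrier (Val N y)"
        by (rule cat_submoduleD(2)[OF conjunct1[OF T] supp_Ob[OF l that]])
      ultimately
      show ?thesis using supp_Ob[OF l that] that by (simp add: B.class_part_def)
    qed
    then show "\<forall>y\<in>Ob G. T y = carrier (Val N y)" using gen T unfolding bottom_generates_def by blast
  qed
  moreover have "weight_le G r l m"
    if m: "m \<in> weights K G U D" and nz: "weight_mult K G U D m N \<noteq> 0" for m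
  proof -
    let ?S' = "weight_rep m"
    note Sm' = weight_rep_module[OF m]
    interpret S': cat_module K Mid ?S' by (rule Sm')
    obtain T T' p where T: "cat_submodule K Mid N T" "cat_submodule K Mid N T'" "\<forall>y\<in>Ob Mid. T' y \<subseteq> T y"
      and p: "quotient_map K Mid (sub_module N T) T' ?S' p"
      using multiplicity_nonzeroE[OF Nm Sm' nz[unfolded weight_mult_def]] by blast
    note Tm = sub_module_is_module[OF Nm T(1)]
    have ph: "cat_module_hom K Mid (sub_module N T) ?S' p" using p by (simp add: quotient_map_def)
    have pim: "p y ` T y = carrier (Val ?S' y)" if "y \<in> Ob G" for y
      using p that by (simp add: quotient_map_def)
    have pk: "p y v = \<zero>\<^bsub>Val ?S' y\<^esub> \<longleftrightarrow> v \<in> T' y" if "y \<in> Ob G" "v \<in> T y" for y v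
      using p that by (simp add: quotient_map_def)
    have T_nz: "T' y \<noteq> T y" if y: "y \<in> supp G m" for y
    proof
      assume "T' y = T y"
      then have "carrier (Val ?S' y) \<subseteq> {\<zero>\<^bsub>Val ?S' y\<^esub>}"
        unfolding pim[OF supp_Ob[OF m y], symmetric] using pk[OF supp_Ob[OF m y]] by auto
      then show False
        using supp_iff[OF m supp_Ob[OF m y]] y S'.Val_zero_closed[of y] supp_Ob[OF m y] by auto
    qed
    obtain y where y: "y \<in> supp G m" using supp_nonempty[OF m] by blast
    have yO: "y \<in> Ob G" by (rule supp_Ob[OF m y])
    have "carrier (Val N y) \<noteq> {\<zero>\<^bsub>Val N y\<^esub>}"
      using T_nz[OF y] cat_submoduleD(2)[OF T(1), of y] cat_submoduleD(2,3)[OF T(2), of y]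
        cat_submoduleD(3)[OF T(1), of y] yO by auto
    then have le: "(supp G l, supp G m) \<in> r" using bottom_le[OF N yO] supp_eq[OF m y] by simp
    show ?thesis
    proof (cases "supp G l = supp G m")
      case False
      then show ?thesis using le by (simp add: weight_le_def weight_less_def)
    next
      case True
      \<comment> \<open>A factor \<open>T / T'\<close> that is non-zero on the support must be all
        of \<open>N\<close> there. So the simple module of \<open>l\<close> maps bijectively,
        through \<open>N\<close>, onto that of \<open>m\<close>.\<close>
      have full: "T z = carrier (Val N z)" "T' z = {\<zero>\<^bsub>Val N z\<^esub>}" if z: "z \<in> supp G l" for z
        using irr[OF T(1) z] irr[OF T(2) z] T_nz[of z] z True T(3) supp_Ob[OF l z]
          cat_submoduleD(2)[OF T(1), of z] cat_submoduleD(3)[OF T(1), of z] cat_submoduleD(3)[OF T(2), of z] by auto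
      obtain \<sigma> where \<sigma>: "cat_module_hom K Mid ?S N \<sigma>"
        and b: "\<And>y. y \<in> supp G l \<Longrightarrow> bij_betw (\<sigma> y) (carrier (Val ?S y)) (carrier (Val N y))"
        using N by (auto simp: has_bottom_def)
      have "\<sigma> z v \<in> T z" if "z \<in> Ob G" "v \<in> carrier (Val ?S z)" for z v
      proof (cases "z \<in> supp G l")
        case True
        then show ?thesis using full(1) cat_module_homD(2)[OF \<sigma>, of z v] that by simp
      next
        case False
        then have "v = \<zero>\<^bsub>Val ?S z\<^esub>" using off_supp[OF l that(1)] that by simp
        then show ?thesis
          using module_hom_zero[OF S.Val_space N.Val_space cat_module_homD(1)[OF \<sigma>], of z]
            cat_submoduleD(3)[OF T(1), of z] that(1) by simp
      qed
      then have "cat_module_hom K Mid ?S (sub_module N T) \<sigma>"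
        using \<sigma> unfolding cat_module_hom_def module_hom_def by auto
      from cat_module_hom_comp[OF this ph]
      have h: "cat_module_hom K Mid ?S ?S' (\<lambda>z v. p z (\<sigma> z v))" .
      have "cat_module_iso K Mid ?S ?S'"
      proof (rule cat_module_iso_on[OF Sm Sm' h, where Y = "supp G l"])
        fix z assume "z \<in> Ob Mid" and z: "z \<in> supp G l"
        then have zO: "z \<in> Ob G" by simp
        have "inj_on (p z) (T z)"
        proof (rule inj_onI)
          fix u v assume uv: "u \<in> T z" "v \<in> T z" "p z u = p z v"
          have "u \<ominus>\<^bsub>Val (sub_module N T) z\<^esub> v \<in> T' z"
            using quotient_map_eq_iff[OF Tm Sm' p, of z u v] uv zO by simp
          then have "u \<ominus>\<^bsub>Val (sub_module N T) z\<^esub> v = \<zero>\<^bsub>Val (sub_module N T) z\<^esub>"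
            using full(2)[OF z] by simp
          then show "u = v"
            using minus_eq_zero_iff[OF cat_module.Val_space[OF Tm], of z u v] uv zO by simp
        qed
        then have "bij_betw (p z) (carrier (Val N z)) (carrier (Val ?S' z))"
          using pim[OF zO] full(1)[OF z] by (simp add: bij_betw_def)
        then show "bij_betw (\<lambda>v. p z (\<sigma> z v)) (carrier (Val ?S z)) (carrier (Val ?S' z))"
          using bij_betw_trans[OF b[OF z]] by (auto simp: comp_def)
      qed (use off_supp[OF l] off_supp[OF m] True in simp_all)
      then show ?thesis using weight_eqI[OF l m] by (simp add: weight_le_def)
    qed
  qed
  ultimately show ?thesis unfolding lowest_weight_module_def using GN mult copy by blast
qed

subsection \<open>The maximal submodule\<close>

text \<open>The largest submodule vanishing on \<open>Y\<close>: a vector lies in such a submodule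
  exactly if no morphism carries it to something non-zero on \<open>Y\<close>.\<close>

definition radical :: "'o set \<Rightarrow> ('o, 'm, 'k, 'v) lin_functor \<Rightarrow> 'o \<Rightarrow> 'v set" where
  "radical Y N y = {v. y \<in> Ob G \<and> v \<in> carrier (Val N y) \<and>
    (\<forall>x\<in>Y. \<forall>g\<in>carrier (Hom G y x). Act N y x g v = \<zero>\<^bsub>Val N x\<^esub>)}"

lemma radical_submodule:
  assumes N: "cat_module K G N" and Y: "Y \<subseteq> Ob G"
  shows "cat_submodule K G N (radical Y N)"
  unfolding cat_submodule_def
proof (intro conjI ballI allI impI)
  interpret N: cat_module K G N by fact
  fix y assume y: "y \<in> Ob G"
  interpret V: vectorspace K "Val N y" using N.Val_space y by blast
  show "VectorSpace.subspace K (radical Y N y) (Val N y)"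
  proof (rule vs_subspaceI)
    show "\<zero>\<^bsub>Val N y\<^esub> \<in> radical Y N y" using y Y N.Act_zero by (auto simp: radical_def)
  next
    fix u v assume *: "u \<in> radical Y N y" "v \<in> radical Y N y"
    have "Act N y x g (u \<oplus>\<^bsub>Val N y\<^esub> v) = \<zero>\<^bsub>Val N x\<^esub>" if "x \<in> Y" "g \<in> carrier (Hom G y x)" for x g
    proof -
      have xO: "x \<in> Ob G" using that Y by blast
      interpret W: vectorspace K "Val N x" using N.Val_space xO by blast
      show ?thesis using module_hom_add[OF N.Act_hom[OF y xO that(2)]] * that by (simp add: radical_def)
    qed
    then show "u \<oplus>\<^bsub>Val N y\<^esub> v \<in> radical Y N y" using * by (simp add: radical_def)
  next
    fix a v assume *: "a \<in> carrier K" "v \<in> radical Y N y"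
    have "Act N y x g (a \<odot>\<^bsub>Val N y\<^esub> v) = \<zero>\<^bsub>Val N x\<^esub>" if "x \<in> Y" "g \<in> carrier (Hom G y x)" for x g
    proof -
      have xO: "x \<in> Ob G" using that Y by blast
      interpret W: vectorspace K "Val N x" using N.Val_space xO by blast
      show ?thesis using module_hom_smult[OF N.Act_hom[OF y xO that(2)] *(1)] * that by (simp add: radical_def)
    qed
    then show "a \<odot>\<^bsub>Val N y\<^esub> v \<in> radical Y N y" using * by (simp add: radical_def)
  qed (use y N.Val_space in \<open>auto simp: radical_def\<close>)
  fix z f v assume *: "z \<in> Ob G" "f \<in> carrier (Hom G y z)" "v \<in> radical Y N y"
  have "Act N z x g (Act N y z f v) = \<zero>\<^bsub>Val N x\<^esub>" if "x \<in> Y" "g \<in> carrier (Hom G z x)" for x g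
  proof -
    have xO: "x \<in> Ob G" using that Y by blast
    have "v \<in> carrier (Val N y)" using * by (simp add: radical_def)
    then show ?thesis
      using N.Act_Comp[OF y *(1) xO *(2) that(2), of v] Comp_closed[OF y *(1) xO *(2) that(2)] * that
      by (simp add: radical_def)
  qed
  then show "Act N y z f v \<in> radical Y N z" using * N.Act_closed[OF y] by (simp add: radical_def)
qed (simp add: radical_def)

lemma radical_on:
  assumes N: "cat_module K G N" and Y: "Y \<subseteq> Ob G" and x: "x \<in> Y"
  shows "radical Y N x = {\<zero>\<^bsub>Val N x\<^esub>}"
proof -
  interpret N: cat_module K G N by fact
  have xO: "x \<in> Ob G" using x Y by blast
  have "v = \<zero>\<^bsub>Val N x\<^esub>" if "v \<in> radical Y N x" for v
    using that N.Act_Id[OF xO, of v] Id_closed[OF xO] x by (auto simp: radical_def)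
  then show ?thesis using cat_submoduleD(3)[OF radical_submodule[OF N Y] xO] by blast
qed

lemma radical_greatest:
  assumes N: "cat_module K G N" and Y: "Y \<subseteq> Ob G" and T: "cat_submodule K G N T"
    and z: "\<And>x. x \<in> Y \<Longrightarrow> T x = {\<zero>\<^bsub>Val N x\<^esub>}" and y: "y \<in> Ob G"
  shows "T y \<subseteq> radical Y N y"
proof
  fix v assume v: "v \<in> T y"
  have "Act N y x g v = \<zero>\<^bsub>Val N x\<^esub>" if "x \<in> Y" "g \<in> carrier (Hom G y x)" for x g
    using cat_submoduleD(4)[OF T y _ that(2) v] z[OF that(1)] that Y by blast
  then show "v \<in> radical Y N y" using v y cat_submoduleD(2)[OF T y] by (auto simp: radical_def)
qed

lemma simple_quotient_kernel_iff:
  assumes l: "l \<in> weights K G U D" and N: "has_bottom l N" and gen: "bottom_generates l N"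
  shows "simple_quotient_kernel K G N T \<longleftrightarrow> T = radical (supp G l) N"
proof -
  let ?R = "radical (supp G l) N"
  note Nm = has_bottom_module[OF N]
  have Y: "supp G l \<subseteq> Ob G" using supp_Ob[OF l] by blast
  note R = radical_submodule[OF Nm Y]
  obtain x where x: "x \<in> supp G l" using supp_nonempty[OF l] by blast
  have R_ne: "?R x \<noteq> carrier (Val N x)" using radical_on[OF Nm Y x] bottom_nonzero[OF l N x] by simp
  \<comment> \<open>On the support \<open>T\<close> is zero or everything: in the first case it lies
    in the radical, in the second it contains the generators.\<close>
  have dich: "(\<forall>y\<in>Ob G. T y \<subseteq> ?R y) \<or> (\<forall>y\<in>Ob G. T y = carrier (Val N y))" if T: "cat_submodule K G N T" for T
    using bottom_irreducible[OF l N Mid_submodule[OF T]] radical_greatest[OF Nm Y T] gen T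
    unfolding bottom_generates_def by blast
  have quot: "simple_module K G (quot_module N T) \<longleftrightarrow> (\<exists>x\<in>Ob G. T x \<noteq> carrier (Val N x)) \<and>
    (\<forall>T'. cat_submodule K G N T' \<and> (\<forall>x\<in>Ob G. T x \<subseteq> T' x) \<longrightarrow>
      (\<forall>x\<in>Ob G. T' x = T x) \<or> (\<forall>x\<in>Ob G. T' x = carrier (Val N x)))" if T: "cat_submodule K G N T" for T
    by (rule simple_quotient_iff[OF Nm T quot_module_quotient[OF Nm T]])
  show ?thesis
  proof
    assume *: "simple_quotient_kernel K G N T"
    then have T: "cat_submodule K G N T" by (simp add: simple_quotient_kernel_def)
    have s: "(\<exists>x\<in>Ob G. T x \<noteq> carrier (Val N x)) \<and>
      (\<forall>T'. cat_submodule K G N T' \<and> (\<forall>x\<in>Ob G. T x \<subseteq> T' x) \<longrightarrow>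
      (\<forall>x\<in>Ob G. T' x = T x) \<or> (\<forall>x\<in>Ob G. T' x = carrier (Val N x)))"
      using * quot[OF T] by (simp add: simple_quotient_kernel_def)
    then have "\<forall>y\<in>Ob G. T y \<subseteq> ?R y" using dich[OF T] by blast
    then have "(\<forall>y\<in>Ob G. ?R y = T y) \<or> (\<forall>y\<in>Ob G. ?R y = carrier (Val N y))" using s R by blast
    then have "\<forall>y\<in>Ob G. ?R y = T y" using R_ne x Y by blast
    then show "T = ?R" using cat_submoduleD(5)[OF T] cat_submoduleD(5)[OF R] by (metis ext)
  next
    assume T: "T = ?R"
    have "simple_module K G (quot_module N ?R)"
      unfolding quot[OF R]
    proof (intro conjI allI impI)
      show "\<exists>x\<in>Ob G. ?R x \<noteq> carrier (Val N x)" using R_ne x Y by blast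
      fix T' assume T': "cat_submodule K G N T' \<and> (\<forall>x\<in>Ob G. ?R x \<subseteq> T' x)"
      then show "(\<forall>x\<in>Ob G. T' x = ?R x) \<or> (\<forall>x\<in>Ob G. T' x = carrier (Val N x))"
        using dich[of T'] by blast
    qed
    then show "simple_quotient_kernel K G N T" using R T by (simp add: simple_quotient_kernel_def)
  qed
qed

end

subsection \<open>Standard modules\<close>

lemma (in induction_setup) induced_span:
  assumes y: "y \<in> Ob G" and W: "VectorSpace.subspace K W (Val I y)"
    and pt: "\<And>x g n. \<lbrakk>x \<in> Ob G; g \<in> carrier (Hom G x y); n \<in> carrier (Val N x)\<rbrakk> \<Longrightarrow> pt y (x, g, n) \<in> W"
    and t: "t \<in> carrier (Val I y)"
  shows "t \<in> W"
  by (rule tensor_setup.tensor_span[OF tensor_setup[OF y], of W]) (use W pt t in auto)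

lemma (in induction_setup) pt_hom:
  assumes y: "y \<in> Ob G" and x: "x \<in> Ob G" and n: "n \<in> carrier (Val N x)"
  shows "(\<lambda>g. pt y (x, g, n)) \<in> module_hom K (Hom G x y) (Val I y)"
  using tensor_setup.pt_balanced[OF tensor_setup[OF y]] x n unfolding balanced_map_def by simp

lemma (in induction_setup) pt_zero_right:
  assumes y: "y \<in> Ob G" and x: "x \<in> Ob G" and g: "g \<in> carrier (Hom G x y)"
  shows "pt y (x, g, \<zero>\<^bsub>Val N x\<^esub>) = \<zero>\<^bsub>Val I y\<^esub>"
proof -
  have "(\<lambda>n. pt y (x, g, n)) \<in> module_hom K (Val N x) (Val I y)"
    using tensor_setup.pt_balanced[OF tensor_setup[OF y]] x g unfolding balanced_map_def by simp
  then show ?thesis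
    using module_hom_zero[of K "Val N x" "Val I y"] N.Val_space[of x] T_vs[OF y] x by simp
qed

context ordered_triangular_category
begin

lemma extend_by_zero_simps [simp]:
  "Val (extend_by_zero G S) = Val S"
  "Act (extend_by_zero G S) x y f v = (if iso_ob G x y then Act S x y f v else \<zero>\<^bsub>Val S y\<^esub>)"
  by (simp_all add: extend_by_zero_def)

text \<open>Functoriality is in danger only for a path that leaves an isomorphism class and returns
  to it. In \<open>D\<close> the composite of such a path is zero.\<close>

lemma extend_by_zero_module:
  assumes S: "cat_module K Mid S"
  shows "cat_module K (sub_cat G D) (extend_by_zero G S)"
proof -
  interpret S: cat_module K Mid S by fact
  have DM: "f \<in> M x y" if "iso_ob G x y" "f \<in> D x y" for x y f
    using UD_iso[OF that(1)] that(2) by blast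
  have Ac: "Act S x y f v \<in> carrier (Val S y)"
    if "x \<in> Ob G" "y \<in> Ob G" "iso_ob G x y" "f \<in> D x y" "v \<in> carrier (Val S x)" for x y f v
    using S.Act_closed[of x y f v] DM[OF that(3,4)] that by simp
  show ?thesis
  proof (intro cat_module.intro cat_module_axioms.intro sub_cat_linear[OF wide_D])
    fix x assume "x \<in> Ob (sub_cat G D)"
    then show "vectorspace K (Val (extend_by_zero G S) x)" using S.Val_space[of x] by simp
  next
    fix x y f assume *: "x \<in> Ob (sub_cat G D)" "y \<in> Ob (sub_cat G D)" "f \<in> carrier (Hom (sub_cat G D) x y)"
    show "Act (extend_by_zero G S) x y f \<in> module_hom K (Val (extend_by_zero G S) x) (Val (extend_by_zero G S) y)"
    proof (cases "iso_ob G x y")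
      case True
      have "Act (extend_by_zero G S) x y f = Act S x y f" using True by (simp add: fun_eq_iff)
      then show ?thesis using S.Act_hom[of x y f] DM[OF True] * by simp
    next
      case False
      have "Act (extend_by_zero G S) x y f = (\<lambda>v. \<zero>\<^bsub>Val S y\<^esub>)" using False by (simp add: fun_eq_iff)
      then show ?thesis using zero_module_hom[OF S.Val_space[of y]] * by simp
    qed
  next
    fix x y v assume *: "x \<in> Ob (sub_cat G D)" "y \<in> Ob (sub_cat G D)" "v \<in> carrier (Val (extend_by_zero G S) x)"
    show "(\<lambda>f. Act (extend_by_zero G S) x y f v) \<in> module_hom K (Hom (sub_cat G D) x y) (Val (extend_by_zero G S) y)"
    proof (cases "iso_ob G x y")
      case True
      then have "U x y = D x y" by (rule UD_iso)
      then have "Hom Mid x y = Hom (sub_cat G D) x y" by (simp add: Mid_eq Hom_sub_cat)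
      then show ?thesis using S.Act_linear[of x y v] True * by simp
    next
      case False
      then show ?thesis using zero_module_hom[OF S.Val_space[of y]] * by simp
    qed
  next
    fix x v assume "x \<in> Ob (sub_cat G D)" "v \<in> carrier (Val (extend_by_zero G S) x)"
    then show "Act (extend_by_zero G S) x x (Id (sub_cat G D) x) v = v"
      using S.Act_Id[of x v] by (simp add: iso_ob_refl)
  next
    fix x y z f g v assume "x \<in> Ob (sub_cat G D)" "y \<in> Ob (sub_cat G D)" "z \<in> Ob (sub_cat G D)"
      and "f \<in> carrier (Hom (sub_cat G D) x y)" "g \<in> carrier (Hom (sub_cat G D) y z)"
      and "v \<in> carrier (Val (extend_by_zero G S) x)"
    then have x: "x \<in> Ob G" and y: "y \<in> Ob G" and z: "z \<in> Ob G" and f: "f \<in> D x y" and g: "g \<in> D y z"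
      and v: "v \<in> carrier (Val S x)" by simp_all
    let ?E = "extend_by_zero G S"
    have "Act ?E x z (Comp G x y z g f) v = Act ?E y z g (Act ?E x y f v)"
    proof (cases "iso_ob G x y")
      case xy: True
      show ?thesis
      proof (cases "iso_ob G y z")
        case yz: True
        then show ?thesis
          using S.Act_Comp[of x y z f g v] DM[OF xy f] DM[OF yz g] iso_ob_trans[OF xy yz] xy x y z v by simp
      next
        case False
        moreover have "\<not> iso_ob G x z" using False xy iso_ob_sym iso_ob_trans by blast
        ultimately show ?thesis by simp
      qed
    next
      case xy: False
      have rhs: "Act ?E y z g (Act ?E x y f v) = \<zero>\<^bsub>Val S z\<^esub>"
        using xy S.Act_zero[of y z g] DM[of y z g] g y z by simp
      show ?thesis
      proof (cases "iso_ob G x z")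
        case xz: True
        \<comment> \<open>A non-zero composite would put \<open>y\<close> between \<open>x\<close>
          and \<open>z\<close> in the order, hence into their common class.\<close>
        have "Comp G x y z g f = \<zero>\<^bsub>Hom G x z\<^esub>"
        proof (rule ccontr)
          assume "Comp G x y z g f \<noteq> \<zero>\<^bsub>Hom G x z\<^esub>"
          then have "f \<noteq> \<zero>\<^bsub>Hom G x y\<^esub>" "g \<noteq> \<zero>\<^bsub>Hom G y z\<^esub>"
            using Comp_zero_right[OF x y z D_sub[OF y z g]] Comp_zero_left[OF x y z D_sub[OF x y f]] by auto
          then have "(iso_class G y, iso_class G x) \<in> r" "(iso_class G z, iso_class G y) \<in> r"
            using D_le[OF x y f] D_le[OF y z g] by auto
          moreover have "iso_class G x = iso_class G z" using iso_class_eq_iff[OF x z] xz by simp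
          ultimately show False using iso_of_le[OF x y] xy by simp
        qed
        then show ?thesis using rhs xz S.zero_Act[of x z v] x z v by simp
      qed (use rhs in simp)
    qed
    then show "Act ?E x z (Comp (sub_cat G D) x y z g f) v = Act ?E y z g (Act ?E x y f v)" by simp
  qed
qed

lemma standard_setup:
  "l \<in> weights K G U D \<Longrightarrow> induction_setup K G D (extend_by_zero G (weight_rep l))"
  using extend_by_zero_module[OF weight_rep_module] linear_category_axioms wide_D
  by (intro induction_setup.intro induction_setup_axioms.intro) auto

context
  fixes l assumes l: "l \<in> weights K G U D"
begin

abbreviation "rep \<equiv> weight_rep l"
abbreviation "ext \<equiv> extend_by_zero G (weight_rep l)"
abbreviation "Delta \<equiv> standard_module K G D l"

interpretation S: cat_module K Mid rep by (rule weight_rep_module[OF l])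
interpretation E: induction_setup K G D ext by (rule standard_setup[OF l])

lemma Delta_eq: "Delta = induced_module K G D ext"
  by (simp add: standard_module_def)

lemma Delta_module: "cat_module K G Delta"
  unfolding Delta_eq by (rule E.induced_is_module)

interpretation Delta: cat_module K G Delta by (rule Delta_module)

lemma supp_of_nonzero: "\<lbrakk>x \<in> Ob G; n \<in> carrier (Val rep x); n \<noteq> \<zero>\<^bsub>Val rep x\<^esub>\<rbrakk> \<Longrightarrow> x \<in> supp G l"
  using off_supp[OF l] by blast

text \<open>The unit is linear over \<open>D\<close> for the extension by zero. On middle morphisms
  the extension changes nothing, as those between non-isomorphic objects already act by
  zero.\<close>

lemma unit_Mid_hom: "cat_module_hom K Mid rep Delta E.unit"
proof -
  note u = E.unit_hom[folded Delta_eq]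
  note uD = cat_module_homD[OF u]
  show ?thesis
    unfolding cat_module_hom_def
  proof (intro conjI ballI)
    fix x assume "x \<in> Ob Mid"
    then show "E.unit x \<in> module_hom K (Val rep x) (Val Delta x)" using uD(1)[of x] by simp
  next
    fix x y f v assume "x \<in> Ob Mid" "y \<in> Ob Mid" "f \<in> carrier (Hom Mid x y)" and v: "v \<in> carrier (Val rep x)"
    then have x: "x \<in> Ob G" and y: "y \<in> Ob G" and f: "f \<in> M x y" by simp_all
    have "Act ext x y f v = Act rep x y f v"
      using block_category.Act_not_iso[OF Mid_block S.cat_module_axioms, of x y f v] iso_Mid_iff x y f v by auto
    then show "E.unit y (Act rep x y f v) = Act Delta x y f (E.unit x v)"
      using uD(3)[of x y f v] x y f v by simp
  qed
qed

text \<open>By the triangular decomposition it suffices to consider tensors \<open>u d \<otimes> n = u \<otimes> d n\<close>, which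
  vanish unless \<open>d\<close> is an isomorphism in the middle category.\<close>

lemma Delta_span:
  assumes y: "y \<in> Ob G" and W: "VectorSpace.subspace K W (Val Delta y)"
    and gen: "\<And>x u n. \<lbrakk>x \<in> supp G l; u \<in> U x y; n \<in> carrier (Val rep x)\<rbrakk> \<Longrightarrow> E.pt y (x, u, n) \<in> W"
    and t: "t \<in> carrier (Val Delta y)"
  shows "t \<in> W"
proof (rule E.induced_span[OF y W[unfolded Delta_eq] _ t[unfolded Delta_eq]])
  fix x g n assume x: "x \<in> Ob G" and g: "g \<in> carrier (Hom G x y)" and "n \<in> carrier (Val ext x)"
  then have n: "n \<in> carrier (Val rep x)" "n \<in> carrier (Val ext x)" by simp_all
  have "g \<in> {g \<in> carrier (Hom G x y). E.pt y (x, g, n) \<in> W}"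
  proof (rule Hom_span[OF x y _ _ g])
    show "VectorSpace.subspace K {g \<in> carrier (Hom G x y). E.pt y (x, g, n) \<in> W} (Hom G x y)"
      by (rule module_hom_vimage_subspace[OF Hom_space[OF x y] E.pt_hom[OF y x n(2)] W[unfolded Delta_eq]])
    show "triangle_gens x y (\<lambda>w. True) \<subseteq> {g \<in> carrier (Hom G x y). E.pt y (x, g, n) \<in> W}"
    proof
      fix g assume g': "g \<in> triangle_gens x y (\<lambda>w. True)"
      then obtain w u d where *: "w \<in> Ob G" "u \<in> U w y" "d \<in> D x w" "g = Comp G x w y u d"
        by (auto simp: triangle_gens_def)
      have uc: "u \<in> carrier (Hom G w y)" by (rule U_sub[OF *(1) y *(2)])
      have dn: "Act ext x w d n \<in> carrier (Val rep w)" using E.N_act[OF x *(1,3) n(2)] by simp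
      have "E.pt y (x, g, n) = E.pt y (w, u, Act ext x w d n)"
        using tensor_setup.pt_act[OF E.tensor_setup[OF y], of x w d u n] x * uc n by simp
      also have "\<dots> \<in> W"
      proof (cases "Act ext x w d n = \<zero>\<^bsub>Val rep w\<^esub>")
        case True
        then show ?thesis
          using E.pt_zero_right[OF y *(1) uc] vs_subspaceD(2)[OF W] by (simp add: Delta_eq)
      next
        case False
        then show ?thesis using gen[OF supp_of_nonzero[OF *(1) dn False] *(2) dn] by simp
      qed
      finally show "g \<in> {g \<in> carrier (Hom G x y). E.pt y (x, g, n) \<in> W}"
        using g' triangle_gens_closed[OF x y] by auto
    qed
  qed
  then show "E.pt y (x, g, n) \<in> W" by simp
qed

text \<open>A spanning tensor \<open>u \<otimes> n\<close> vanishes unless \<open>u\<close> is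
  non-zero, and a non-zero \<open>u\<close> in \<open>U\<close> that starts in the support ends
  above it.\<close>

lemma Delta_supp:
  assumes y: "y \<in> Ob G" and nz: "carrier (Val Delta y) \<noteq> {\<zero>\<^bsub>Val Delta y\<^esub>}"
  shows "(supp G l, iso_class G y) \<in> r"
proof (rule ccontr)
  assume n: "(supp G l, iso_class G y) \<notin> r"
  have "t \<in> {\<zero>\<^bsub>Val Delta y\<^esub>}" if "t \<in> carrier (Val Delta y)" for t
  proof (rule Delta_span[OF y subspace_zero[OF Delta.Val_space[OF y]] _ that])
    fix x u n' assume *: "x \<in> supp G l" "u \<in> U x y" "n' \<in> carrier (Val rep x)"
    have x: "x \<in> Ob G" by (rule supp_Ob[OF l *(1)])
    have "u = \<zero>\<^bsub>Hom G x y\<^esub>" using U_le[OF x y *(2)] n supp_eq[OF l *(1)] by auto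
    then show "E.pt y (x, u, n') \<in> {\<zero>\<^bsub>Val Delta y\<^esub>}"
      using module_hom_zero[OF Hom_space[OF x y] _ E.pt_hom[OF y x, of n']] E.T_vs[OF y] *(3)
      by (simp add: Delta_eq)
  qed
  then show False using nz Delta.Val_zero_closed[OF y] by blast
qed

text \<open>Over the support, \<open>u\<close> joins isomorphic objects and so also lies in
  \<open>D\<close>; it can be moved across the tensor sign, giving the identity tensored with
  \<open>u n\<close>.\<close>

lemma unit_surj:
  assumes y: "y \<in> supp G l"
  shows "E.unit y ` carrier (Val rep y) = carrier (Val Delta y)"
proof
  have yO: "y \<in> Ob G" by (rule supp_Ob[OF l y])
  note uh = cat_module_homD[OF unit_Mid_hom]
  show "E.unit y ` carrier (Val rep y) \<subseteq> carrier (Val Delta y)" using uh(2)[of y] yO by auto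
  show "carrier (Val Delta y) \<subseteq> E.unit y ` carrier (Val rep y)"
  proof
    fix t assume t: "t \<in> carrier (Val Delta y)"
    show "t \<in> E.unit y ` carrier (Val rep y)"
    proof (rule Delta_span[OF yO _ _ t])
      show "VectorSpace.subspace K (E.unit y ` carrier (Val rep y)) (Val Delta y)"
        by (rule module_hom_image_subspace[OF Delta.Val_space[OF yO] uh(1) subspace_carrier[OF S.Val_space]])
          (simp_all add: yO)
      fix x u n assume *: "x \<in> supp G l" "u \<in> U x y" "n \<in> carrier (Val rep x)"
      have x: "x \<in> Ob G" by (rule supp_Ob[OF l *(1)])
      have iso: "iso_ob G x y" using iso_classes_iso[OF supp_class[OF l] *(1)] y by simp
      then have d: "u \<in> D x y" using UD_iso *(2) by blast
      have uc: "u \<in> carrier (Hom G x y)" by (rule U_sub[OF x yO *(2)])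
      have "E.pt y (x, u, n) = E.pt y (y, Id G y, Act ext x y u n)"
        using tensor_setup.pt_act[OF E.tensor_setup[OF yO], of x y u "Id G y" n] x yO d *(3) uc
        by (simp add: Id_closed Id_left)
      moreover have "Act ext x y u n \<in> carrier (Val rep y)" using E.N_act[OF x yO d, of n] *(3) by simp
      ultimately show "E.pt y (x, u, n) \<in> E.unit y ` carrier (Val rep y)"
        by (simp add: E.unit_def)
    qed
  qed
qed

text \<open>The inverse of the unit at \<open>y\<close> is \<open>g \<otimes> n \<mapsto> g\<^sub>0 n\<close>, where \<open>g\<^sub>0\<close> is the middle component of \<open>g\<close>
  in the triangular decomposition.\<close>

lemma unit_inj:
  assumes y: "y \<in> Ob G"
  shows "inj_on (E.unit y) (carrier (Val rep y))"
proof -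
  \<comment> \<open>The test for isomorphism is needed because the middle component is meaningless
    otherwise.\<close>
  define b where "b = (\<lambda>(x, g, n). if iso_ob G x y then Act rep x y (proj x y g) n else \<zero>\<^bsub>Val rep y\<^esub>)"
  have Vy: "vectorspace K (Val rep y)" using S.Val_space[of y] y by simp
  have pM: "proj x y g \<in> M x y" if "iso_ob G x y" "g \<in> carrier (Hom G x y)" for x g
    using module_hom_closed[OF proj_hom[OF that(1)]] that(2) by auto
  have 1: "(\<lambda>g. b (x, g, n)) \<in> module_hom K (Hom G x y) (Val rep y)"
    if x: "x \<in> Ob G" and n: "n \<in> carrier (Val rep x)" for x n
  proof (cases "iso_ob G x y")
    case True
    then show ?thesis
      using module_hom_compose[OF proj_hom[OF True] S.Act_linear[of x y n]] x y n by (simp add: b_def)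
  qed (simp add: b_def zero_module_hom[OF Vy])
  have 2: "(\<lambda>n. b (x, g, n)) \<in> module_hom K (Val rep x) (Val rep y)"
    if x: "x \<in> Ob G" and g: "g \<in> carrier (Hom G x y)" for x g
  proof (cases "iso_ob G x y")
    case True
    then show ?thesis using S.Act_hom[of x y "proj x y g"] pM[OF True g] x y by (simp add: b_def)
  qed (simp add: b_def zero_module_hom[OF Vy])
  \<comment> \<open>For \<open>f\<close> between isomorphic objects this is compatibility of
    \<open>proj\<close> with middle morphisms. Otherwise both sides vanish, the left one because
    \<open>g f\<close> is off-diagonal.\<close>
  have 3: "b (x, Comp G x x' y g f, n) = b (x', g, Act ext x x' f n)"
    if x: "x \<in> Ob G" and x': "x' \<in> Ob G" and f: "f \<in> D x x'" and g: "g \<in> carrier (Hom G x' y)"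
      and n: "n \<in> carrier (Val rep x)" for x x' f g n
  proof (cases "iso_ob G x x'")
    case xx: True
    then have fM: "f \<in> M x x'" using UD_iso f by blast
    show ?thesis
    proof (cases "iso_ob G x' y")
      case x'y: True
      have "iso_ob G x y" by (rule iso_ob_trans[OF xx x'y])
      then show ?thesis
        using proj_comp_M[OF xx x'y fM g] S.Act_Comp[of x x' y f "proj x' y g" n] pM[OF x'y g] fM x x' y n xx x'y
        by (simp add: b_def)
    next
      case False
      moreover have "\<not> iso_ob G x y" using False xx iso_ob_sym iso_ob_trans by blast
      ultimately show ?thesis by (simp add: b_def)
    qed
  next
    case ni: False
    have lhs: "b (x, Comp G x x' y g f, n) = \<zero>\<^bsub>Val rep y\<^esub>"
    proof (cases "iso_ob G x y")
      case True
      have "proj x y (Comp G x x' y g f) = \<zero>\<^bsub>Hom G x y\<^esub>"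
        by (rule proj_off_diag[OF True comp_D_off_diag[OF x x' y ni f g]])
      then show ?thesis using S.zero_Act[of x y n] x y n by (simp add: b_def)
    qed (simp add: b_def)
    have rhs: "b (x', g, \<zero>\<^bsub>Val rep x'\<^esub>) = \<zero>\<^bsub>Val rep y\<^esub>"
      using module_hom_zero[OF _ Vy 2[OF x' g]] S.Val_space[of x'] x' by simp
    show ?thesis using lhs rhs ni by simp
  qed
  have bal: "balanced_map K (sub_cat G D) (hom_to G y) ext (Val rep y) b"
    unfolding balanced_map_def using 1 2 3 by simp
  have "tensor_lift K (Val rep y) b (E.unit y n) = n" if n: "n \<in> carrier (Val rep y)" for n
  proof -
    have "tensor_lift K (Val rep y) b (E.unit y n) = b (y, Id G y, n)"
      unfolding E.unit_def
      using tensor_setup.tensor_lift_pt[OF E.tensor_setup[OF y] Vy bal, of y "Id G y" n] y n Id_closed by simp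
    also have "\<dots> = n"
      using proj_M[OF iso_ob_refl[OF y], of "Id G y"] wide_subcategoryD(4)[OF wide_M y]
        S.Act_Id[of y n] y n iso_ob_refl[OF y] by (simp add: b_def)
    finally show ?thesis .
  qed
  then show ?thesis by (rule inj_on_inverseI)
qed

lemma Delta_bottom: "has_bottom l Delta"
proof -
  have "bij_betw (E.unit y) (carrier (Val rep y)) (carrier (Val Delta y))" if "y \<in> supp G l" for y
    using unit_inj[OF supp_Ob[OF l that]] unit_surj[OF that] by (simp add: bij_betw_def)
  then show ?thesis unfolding has_bottom_def using Delta_module Delta_supp unit_Mid_hom by auto
qed

text \<open>A spanning tensor \<open>u \<otimes> n\<close> is the result of applying
  \<open>u\<close> to the image of \<open>n\<close> under the unit.\<close>

lemma Delta_generated: "bottom_generates l Delta"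
  unfolding bottom_generates_def
proof (intro allI impI ballI)
  fix T y assume T: "cat_submodule K G Delta T \<and> (\<forall>y\<in>supp G l. T y = carrier (Val Delta y))" and y: "y \<in> Ob G"
  then have Ts: "cat_submodule K G Delta T" by blast
  have "t \<in> T y" if "t \<in> carrier (Val Delta y)" for t
  proof (rule Delta_span[OF y cat_submoduleD(1)[OF Ts y] _ that])
    fix x u n assume *: "x \<in> supp G l" "u \<in> U x y" "n \<in> carrier (Val rep x)"
    have x: "x \<in> Ob G" by (rule supp_Ob[OF l *(1)])
    have uc: "u \<in> carrier (Hom G x y)" by (rule U_sub[OF x y *(2)])
    have "E.unit x n \<in> T x" using T *(1,3) unit_surj[OF *(1)] by blast
    then have "Act Delta x y u (E.unit x n) \<in> T y" by (rule cat_submoduleD(4)[OF Ts x y uc])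
    moreover have "Act Delta x y u (E.unit x n) = E.pt y (x, u, n)"
      using E.Act_I_pt[OF x y uc x Id_closed[OF x], of n] *(3) Id_right[OF x y uc]
      by (simp add: E.unit_def Delta_eq)
    ultimately show "E.pt y (x, u, n) \<in> T y" by simp
  qed
  then show "T y = carrier (Val Delta y)" using cat_submoduleD(2)[OF Ts y] by blast
qed

text \<open>A morphism of \<open>D\<close> from the support to a non-isomorphic object goes strictly
  down, where \<open>N\<close> vanishes by \<open>low\<close>; this is why linearity over the middle
  category suffices. Only images are recorded, because each use goes on to show that
  \<open>\<phi>\<close> is onto.\<close>

lemma Delta_universal:
  fixes N :: "('o, 'm, 'k, 'v) lin_functor" and \<sigma> :: "'o \<Rightarrow> 'm set \<Rightarrow> 'v"
  assumes N: "cat_module K G N" and \<sigma>: "cat_module_hom K Mid rep N \<sigma>"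
    and low: "\<And>y. \<lbrakk>y \<in> Ob G; carrier (Val N y) \<noteq> {\<zero>\<^bsub>Val N y\<^esub>}; (iso_class G y, supp G l) \<in> r\<rbrakk> \<Longrightarrow> y \<in> supp G l"
  obtains \<phi> where "cat_module_hom K G Delta N \<phi>"
    "\<And>x n. \<lbrakk>x \<in> Ob G; n \<in> carrier (Val rep x)\<rbrakk> \<Longrightarrow> \<sigma> x n \<in> \<phi> x ` carrier (Val Delta x)"
proof -
  interpret N: cat_module K G N by fact
  note s = cat_module_homD[OF \<sigma>]
  have sc: "\<sigma> x n \<in> carrier (Val N x)" if "x \<in> Ob G" "n \<in> carrier (Val rep x)" for x n
    using s(2)[of x n] that by simp
  have s0: "\<sigma> x \<zero>\<^bsub>Val rep x\<^esub> = \<zero>\<^bsub>Val N x\<^esub>" if "x \<in> Ob G" for x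
    using module_hom_zero[OF S.Val_space N.Val_space s(1), of x] that by simp
  have "\<sigma> y (Act ext x y f n) = Act N x y f (\<sigma> x n)"
    if x: "x \<in> Ob G" and y: "y \<in> Ob G" and f: "f \<in> D x y" and n: "n \<in> carrier (Val rep x)" for x y f n
  proof (cases "iso_ob G x y")
    case True
    then show ?thesis using s(3)[of x y f n] UD_iso[OF True] x y f n by simp
  next
    case False
    note fc = D_sub[OF x y f]
    have "Act N x y f (\<sigma> x n) = \<zero>\<^bsub>Val N y\<^esub>"
    proof (rule ccontr)
      assume nz: "Act N x y f (\<sigma> x n) \<noteq> \<zero>\<^bsub>Val N y\<^esub>"
      then have "f \<noteq> \<zero>\<^bsub>Hom G x y\<^esub>" "n \<noteq> \<zero>\<^bsub>Val rep x\<^esub>"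
        using N.zero_Act[OF x y sc[OF x n]] N.Act_zero[OF x y fc] s0[OF x] by auto
      then have xs: "x \<in> supp G l" and le: "(iso_class G y, iso_class G x) \<in> r"
        using supp_of_nonzero[OF x n] D_le[OF x y f] by auto
      have "y \<in> supp G l"
        using low[OF y] nz N.Act_closed[OF x y fc sc[OF x n]] le supp_eq[OF l xs] by auto
      then show False using iso_classes_iso[OF supp_class[OF l] xs] False by simp
    qed
    then show ?thesis using False s0[OF y] by simp
  qed
  then have h: "cat_module_hom K (sub_cat G D) ext N \<sigma>"
    using s(1) unfolding cat_module_hom_def by simp
  obtain \<phi> where \<phi>: "cat_module_hom K G Delta N \<phi>"
    "\<And>x n. \<lbrakk>x \<in> Ob G; n \<in> carrier (Val rep x)\<rbrakk> \<Longrightarrow> \<phi> x (E.unit x n) = \<sigma> x n"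
    using E.induced_universal[OF N h] unfolding Delta_eq by auto
  have "\<sigma> x n \<in> \<phi> x ` carrier (Val Delta x)" if "x \<in> Ob G" "n \<in> carrier (Val rep x)" for x n
    using \<phi>(2)[OF that] cat_module_homD(2)[OF unit_Mid_hom, of x n] that by (metis Mid_simps(1) imageI)
  then show thesis using that \<phi>(1) by blast
qed

section \<open>The simple quotient of a standard module\<close>

abbreviation "Rad \<equiv> radical (supp G l) Delta"

lemma Delta_kernel_iff: "simple_quotient_kernel K G Delta T \<longleftrightarrow> T = Rad"
  by (rule simple_quotient_kernel_iff[OF l Delta_bottom Delta_generated])

lemma simple_head_eq: "simple_head K G D l = quot_module Delta Rad"
  unfolding simple_head_def Delta_kernel_iff by simp

lemma Rad_submodule: "cat_submodule K G Delta Rad"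
  and simple_head_simple: "simple_module K G (simple_head K G D l)"
  using Delta_kernel_iff[of Rad] unfolding simple_quotient_kernel_def simple_head_eq by blast+

lemma simple_head_quotient:
  obtains p where "quotient_map K G Delta Rad (simple_head K G D l) p"
  using quot_module_quotient_map[OF Delta_module Rad_submodule] by (simp add: simple_head_eq)

lemma simple_head_module: "cat_module K G (simple_head K G D l)"
  using simple_head_simple by (simp add: simple_module_def)

text \<open>The radical vanishes on the support, so passing to the quotient leaves the bottom part
  intact.\<close>

lemma simple_head_bottom: "has_bottom l (simple_head K G D l)"
proof -
  obtain p where p: "quotient_map K G Delta Rad (simple_head K G D l) p" by (rule simple_head_quotient)
  have Y: "supp G l \<subseteq> Ob G" using supp_Ob[OF l] by blast
  show ?thesis
  proof (rule bottom_transport[OF l Delta_bottom simple_head_module])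
    show "cat_module_hom K G Delta (simple_head K G D l) p"
      "\<And>y. y \<in> Ob G \<Longrightarrow> p y ` carrier (Val Delta y) = carrier (Val (simple_head K G D l) y)"
      using p by (simp_all add: quotient_map_def)
    fix y assume y: "y \<in> supp G l"
    show "inj_on (p y) (carrier (Val Delta y))"
    proof (rule inj_onI)
      fix u v assume uv: "u \<in> carrier (Val Delta y)" "v \<in> carrier (Val Delta y)" "p y u = p y v"
      have yO: "y \<in> Ob G" using y Y by blast
      have "u \<ominus>\<^bsub>Val Delta y\<^esub> v \<in> Rad y"
        using quotient_map_eq_iff[OF Delta_module simple_head_module p yO uv(1,2)] uv(3) by simp
      then have "u \<ominus>\<^bsub>Val Delta y\<^esub> v = \<zero>\<^bsub>Val Delta y\<^esub>" using radical_on[OF Delta_module Y y] by simp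
      then show "u = v" using minus_eq_zero_iff[OF Delta.Val_space[OF yO] uv(1,2)] by simp
    qed
  qed
qed

text \<open>The kernel of a map from the standard module onto a simple module has a simple quotient,
  hence equals the radical.\<close>

lemma simple_quotient_iso_head:
  fixes N :: "('o, 'm, 'k, 'v) lin_functor"
  assumes N: "simple_module K G N" and h: "cat_module_hom K G Delta N \<phi>"
    and surj: "\<And>x. x \<in> Ob G \<Longrightarrow> \<phi> x ` carrier (Val Delta x) = carrier (Val N x)"
  shows "cat_module_iso K G N (simple_head K G D l)"
proof -
  have Nm: "cat_module K G N" using N by (simp add: simple_module_def)
  obtain T where T: "cat_submodule K G Delta T" and q: "quotient_map K G Delta T N \<phi>"
    using surj_hom_quotient_map[OF Delta_module Nm h surj] by blast
  have "simple_module K G (quot_module Delta T)"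
    using simple_quotient_iff[OF Delta_module T Nm q] simple_quotient_iff[OF Delta_module T
        quot_module_quotient[OF Delta_module T]] N by simp
  then have "T = Rad" using T Delta_kernel_iff[of T] by (simp add: simple_quotient_kernel_def)
  then have q': "quotient_map K G Delta Rad N \<phi>" using q by simp
  obtain p where p: "quotient_map K G Delta Rad (simple_head K G D l) p" by (rule simple_head_quotient)
  show ?thesis by (rule iso_of_quotient_maps[OF Delta_module Nm simple_head_module q' p])
qed

end

section \<open>Weights of arbitrary modules, classification of simple modules, and
  constituents\<close>

text \<open>A simple submodule of the restriction of \<open>N\<close>, non-zero at \<open>y\<close>,
  supplies the weight. Its map into \<open>N\<close> serves to build maps from standard modules, its
  multiplicity to apply the lowest weight condition.\<close>

lemma occurring_weight:
  fixes N :: "('o, 'm, 'k, 'v) lin_functor"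
  assumes N: "cat_module K G N" and y: "y \<in> Ob G" and nz: "carrier (Val N y) \<noteq> {\<zero>\<^bsub>Val N y\<^esub>}"
  obtains m and \<sigma> :: "'o \<Rightarrow> 'm set \<Rightarrow> 'v" where "m \<in> weights K G U D" "supp G m = iso_class G y" "weight_mult K G U D m N \<noteq> 0"
    "cat_module_hom K Mid (weight_rep m) N \<sigma>" "\<exists>n\<in>carrier (Val (weight_rep m) y). \<sigma> y n \<noteq> \<zero>\<^bsub>Val N y\<^esub>"
proof -
  interpret B: block_category K Mid by (rule Mid_block)
  note Nm = Mid_module[OF N]
  interpret N: cat_module K Mid N by (rule Nm)
  \<comment> \<open>Subspaces of the middle endomorphisms are subspaces of the finite-dimensional
    \<open>Hom G y y\<close>.\<close>
  have artinian: "\<exists>S\<in>\<S>. \<forall>S'\<in>\<S>. S' \<subseteq> S \<longrightarrow> S' = S"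
    if "\<S> \<noteq> {}" and sub: "\<And>S. S \<in> \<S> \<Longrightarrow> VectorSpace.subspace K S (Hom Mid y y)" for \<S>
  proof (rule vectorspace.minimal_subspace_exists[OF Hom_space[OF y y] T0[OF y y] that(1)])
    fix S assume "S \<in> \<S>"
    note s = vs_subspaceD[OF sub[OF this]]
    show "VectorSpace.subspace K S (Hom G y y)"
      by (rule vs_subspaceI[OF Hom_space[OF y y]])
        (use s U_sub[OF y y] in \<open>auto simp: Mid_eq Hom_sub_cat\<close>)
  qed
  obtain T where T: "cat_submodule K Mid N T" and simple: "simple_module K Mid (sub_module N T)"
    and Ty: "T y \<noteq> {\<zero>\<^bsub>Val N y\<^esub>}"
    using B.simple_submodule_exists[OF Nm _ artinian nz] y by (metis Mid_simps(1))
  obtain m where m: "m \<in> weights K G U D" and iso: "cat_module_iso K Mid (sub_module N T) (weight_rep m)"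
    using weight_exists[OF simple] by blast
  note Tm = sub_module_is_module[OF Nm T] and Sm = weight_rep_module[OF m]
  interpret S: cat_module K Mid "weight_rep m" by (rule Sm)
  obtain \<sigma> where \<sigma>: "cat_module_hom K Mid (weight_rep m) (sub_module N T) \<sigma>"
    and b: "\<And>x. x \<in> Ob G \<Longrightarrow> bij_betw (\<sigma> x) (carrier (Val (weight_rep m) x)) (T x)"
    using cat_module_iso_sym[OF Tm iso] unfolding cat_module_iso_def by auto
  obtain t where t: "t \<in> T y" "t \<noteq> \<zero>\<^bsub>Val N y\<^esub>" using Ty cat_submoduleD(3)[OF T, of y] y by auto
  have "t \<in> \<sigma> y ` carrier (Val (weight_rep m) y)" using t(1) b[OF y] by (simp add: bij_betw_def)
  then obtain n where n: "n \<in> carrier (Val (weight_rep m) y)" "\<sigma> y n = t" by blast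
  have "n \<noteq> \<zero>\<^bsub>Val (weight_rep m) y\<^esub>"
    using module_hom_zero[OF S.Val_space cat_module.Val_space[OF Tm] cat_module_homD(1)[OF \<sigma>], of y] t n y by auto
  then have "y \<in> supp G m" using supp_of_nonzero[OF m y n(1)] by blast
  then have supp: "supp G m = iso_class G y" by (rule supp_eq[OF m])
  have "weight_mult K G U D m N \<noteq> 0"
    using multiplicity_pos[OF Nm T iso Sm] by (auto simp: weight_mult_def)
  then show thesis
    using that[OF m supp _ cat_module_hom_comp[OF \<sigma> sub_module_inclusion[OF T]]] n t by blast
qed

lemma simple_is_head:
  fixes N :: "('o, 'm, 'k, 'v) lin_functor"
  assumes N: "simple_module K G N"
  obtains m where "m \<in> weights K G U D" "cat_module_iso K G N (simple_head K G D m)"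
proof -
  have Nm: "cat_module K G N" using N by (simp add: simple_module_def)
  interpret N: cat_module K G N by (rule Nm)
  define P where "P y \<longleftrightarrow> y \<in> Ob G \<and> carrier (Val N y) \<noteq> {\<zero>\<^bsub>Val N y\<^esub>}" for y
  \<comment> \<open>The size of the finite down-set serves as a measure: it drops when passing to a
    strictly smaller class, so an object that minimizes it is minimal in the order.\<close>
  define below where "below y = {Z. (Z, iso_class G y) \<in> r}" for y
  have fin: "finite (below y)" if "y \<in> Ob G" for y
    using adm iso_class_in[OF that] by (auto simp: admissible_order_def below_def)
  obtain x0 where "P x0" using N by (auto simp: simple_module_def P_def)
  then obtain y where y: "P y" and min: "\<And>z. P z \<Longrightarrow> card (below y) \<le> card (below z)"
    using ex_has_least_nat[of P x0 "\<lambda>z. card (below z)"] by blast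
  have yO: "y \<in> Ob G" using y by (simp add: P_def)
  have low: "iso_ob G y z" if z: "z \<in> Ob G" "carrier (Val N z) \<noteq> {\<zero>\<^bsub>Val N z\<^esub>}"
    "(iso_class G z, iso_class G y) \<in> r" for z
  proof (rule ccontr)
    assume "\<not> iso_ob G y z"
    then have "iso_class G y \<notin> below z" using iso_of_le[OF yO z(1)] z(3) by (auto simp: below_def)
    moreover have "iso_class G y \<in> below y" using r_refl[OF iso_class_in[OF yO]] by (simp add: below_def)
    moreover have "below z \<subseteq> below y" using z(3) r_trans by (auto simp: below_def)
    ultimately have "below z \<subset> below y" by blast
    then have "card (below z) < card (below y)" by (rule psubset_card_mono[OF fin[OF yO]])
    then show False using min[of z] z by (simp add: P_def)
  qed
  obtain m \<sigma> where m: "m \<in> weights K G U D" "supp G m = iso_class G y"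
    and \<sigma>: "cat_module_hom K Mid (weight_rep m) N \<sigma>"
    and nz: "\<exists>n\<in>carrier (Val (weight_rep m) y). \<sigma> y n \<noteq> \<zero>\<^bsub>Val N y\<^esub>"
    using occurring_weight[OF Nm yO] y by (metis P_def)
  obtain \<phi> where \<phi>: "cat_module_hom K G (standard_module K G D m) N \<phi>"
    "\<And>x n. \<lbrakk>x \<in> Ob G; n \<in> carrier (Val (weight_rep m) x)\<rbrakk> \<Longrightarrow>
      \<sigma> x n \<in> \<phi> x ` carrier (Val (standard_module K G D m) x)"
    by (rule Delta_universal[OF m(1) Nm \<sigma>]) (use low m(2) in \<open>auto simp: iso_class_def\<close>)
  let ?im = "hom_image G \<phi> (full_sub G (standard_module K G D m))"
  have im: "cat_submodule K G N ?im"
    by (rule image_submodule[OF Nm \<phi>(1) full_submodule[OF Delta_module[OF m(1)]]])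
  have "?im y \<noteq> {\<zero>\<^bsub>Val N y\<^esub>}" using nz \<phi>(2)[OF yO] yO by (auto simp: hom_image_def full_sub_def)
  then have "\<forall>x\<in>Ob G. ?im x = carrier (Val N x)" using N im yO unfolding simple_module_def by blast
  then have "\<phi> x ` carrier (Val (standard_module K G D m) x) = carrier (Val N x)" if "x \<in> Ob G" for x
    using that by (simp add: hom_image_def full_sub_def)
  then show thesis using that[OF m(1)] simple_quotient_iso_head[OF m(1) N \<phi>(1)] by blast
qed

text \<open>An isomorphism carries the bottom part of one head to the other, which then has both
  weights at its bottom; \<open>bottom_unique\<close> applies.\<close>

lemma head_unique:
  assumes l: "l \<in> weights K G U D" and m: "m \<in> weights K G U D"
    and N: "cat_module K G N"
    and isol: "cat_module_iso K G N (simple_head K G D l)"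
    and isom: "cat_module_iso K G N (simple_head K G D m)"
  shows "l = m"
proof -
  have "cat_module_iso K G (simple_head K G D l) (simple_head K G D m)"
    using cat_module_iso_trans[OF cat_module_iso_sym[OF N isol] isom] .
  then obtain \<phi> where "cat_module_hom K G (simple_head K G D l) (simple_head K G D m) \<phi>"
    and b: "\<And>x. x \<in> Ob G \<Longrightarrow> bij_betw (\<phi> x) (carrier (Val (simple_head K G D l) x)) (carrier (Val (simple_head K G D m) x))"
    unfolding cat_module_iso_def by blast
  then have "has_bottom l (simple_head K G D m)"
    by (intro bottom_transport[OF l simple_head_bottom[OF l] simple_head_module[OF m], of \<phi>])
      (use supp_Ob[OF l] in \<open>auto simp: bij_betw_def\<close>)
  then show ?thesis using bottom_unique[OF l m _ simple_head_bottom[OF m]] by blast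
qed

lemma lowest_weight_is_quotient:
  fixes N :: "('o, 'm, 'k, 'v) lin_functor"
  assumes l: "l \<in> weights K G U D" and N: "lowest_weight_module K G U D r l N"
  shows "is_quotient_of K G N (standard_module K G D l)"
proof -
  have Nm: "cat_module K G N" using N by (simp add: lowest_weight_module_def)
  interpret N: cat_module K G N by (rule Nm)
  note Mm = Mid_module[OF Nm]
  obtain T where "weight_copy K G U D l N T" and gen: "generated_by K G N T"
    using N by (auto simp: lowest_weight_module_def)
  then have T: "cat_submodule K Mid N T" and iso: "cat_module_iso K Mid (sub_module N T) (weight_rep l)"
    by (simp_all add: weight_copy_def)
  obtain \<sigma> where \<sigma>: "cat_module_hom K Mid (weight_rep l) (sub_module N T) \<sigma>"
    and b: "\<And>x. x \<in> Ob G \<Longrightarrow> bij_betw (\<sigma> x) (carrier (Val (weight_rep l) x)) (T x)"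
    using cat_module_iso_sym[OF sub_module_is_module[OF Mm T] iso] unfolding cat_module_iso_def by auto
  have \<sigma>N: "cat_module_hom K Mid (weight_rep l) N \<sigma>"
    using cat_module_hom_comp[OF \<sigma> sub_module_inclusion[OF T]] by simp
  \<comment> \<open>At every object where \<open>N\<close> is non-zero some weight occurs, and its
    support is not strictly below that of \<open>l\<close>.\<close>
  have low: "y \<in> supp G l"
    if y: "y \<in> Ob G" "carrier (Val N y) \<noteq> {\<zero>\<^bsub>Val N y\<^esub>}" "(iso_class G y, supp G l) \<in> r" for y
  proof -
    obtain m where m: "m \<in> weights K G U D" "supp G m = iso_class G y" "weight_mult K G U D m N \<noteq> 0"
      using occurring_weight[OF Nm y(1,2)] by metis
    then have "weight_le G r l m" using N by (simp add: lowest_weight_module_def)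
    then have "supp G l = iso_class G y \<or> (supp G l, iso_class G y) \<in> r"
      using m(2) by (auto simp: weight_le_def weight_less_def)
    then have "supp G l = iso_class G y" using y(3) r_antisym by blast
    then show ?thesis using iso_class_self[OF y(1)] by simp
  qed
  obtain \<phi> where \<phi>: "cat_module_hom K G (standard_module K G D l) N \<phi>"
    "\<And>x n. \<lbrakk>x \<in> Ob G; n \<in> carrier (Val (weight_rep l) x)\<rbrakk> \<Longrightarrow>
      \<sigma> x n \<in> \<phi> x ` carrier (Val (standard_module K G D l) x)"
    using Delta_universal[OF l Nm \<sigma>N low] by metis
  note Dm = Delta_module[OF l]
  let ?im = "hom_image G \<phi> (full_sub G (standard_module K G D l))"
  have im: "cat_submodule K G N ?im" by (rule image_submodule[OF Nm \<phi>(1) full_submodule[OF Dm]])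
  have "T x \<subseteq> ?im x" if x: "x \<in> Ob G" for x
  proof
    fix t assume "t \<in> T x"
    then obtain n where "n \<in> carrier (Val (weight_rep l) x)" "t = \<sigma> x n"
      using b[OF x] unfolding bij_betw_def by blast
    then show "t \<in> ?im x" using \<phi>(2)[OF x] x by (simp add: hom_image_def full_sub_def)
  qed
  then have "\<forall>x\<in>Ob G. ?im x = carrier (Val N x)" using gen im unfolding generated_by_def by blast
  then have "\<phi> x ` carrier (Val (standard_module K G D l) x) = carrier (Val N x)" if "x \<in> Ob G" for x
    using that by (simp add: hom_image_def full_sub_def)
  then obtain T' where T': "cat_submodule K G (standard_module K G D l) T'"
    "quotient_map K G (standard_module K G D l) T' N \<phi>"
    using surj_hom_quotient_map[OF Dm Nm \<phi>(1)] by metis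
  then show ?thesis
    unfolding is_quotient_of_def using iso_quot_module_iff[OF Dm T'(1) Nm] by blast
qed

text \<open>The constituent is some head of weight \<open>m\<close> and is non-zero on the support
  of \<open>m\<close>, which therefore lies above that of \<open>l\<close>. What remains is to
  exclude equal supports.\<close>

lemma constituent_weight:
  fixes N :: "('o, 'm, 'k, 'v) lin_functor"
  assumes l: "l \<in> weights K G U D" and N: "simple_constituent K G N (standard_module K G D l)"
    and ne: "\<not> cat_module_iso K G N (simple_head K G D l)"
  shows "\<exists>m\<in>weights K G U D. weight_less G r l m \<and> cat_module_iso K G N (simple_head K G D m)"
proof -
  let ?D = "standard_module K G D l"
  note Dm = Delta_module[OF l]
  have simple: "simple_module K G N" and sub: "is_subquotient_of K G N ?D"
    using N by (simp_all add: simple_constituent_def)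
  have Nm: "cat_module K G N" using simple by (simp add: simple_module_def)
  obtain m where m: "m \<in> weights K G U D" and iso: "cat_module_iso K G N (simple_head K G D m)"
    using simple_is_head[OF simple] by blast
  obtain T T' where T: "cat_submodule K G ?D T" and T': "cat_submodule K G (sub_module ?D T) T'"
    and q: "cat_module_iso K G (quot_module (sub_module ?D T) T') N"
    using sub by (auto simp: is_subquotient_of_def is_quotient_of_def)
  note Tm = sub_module_is_module[OF Dm T]
  obtain p where p: "quotient_map K G (sub_module ?D T) T' N p"
    using q iso_quot_module_iff[OF Tm T' Nm] by blast
  then have ph: "cat_module_hom K G (sub_module ?D T) N p"
    and pim: "\<And>x. x \<in> Ob G \<Longrightarrow> p x ` T x = carrier (Val N x)"
    by (simp_all add: quotient_map_def)
  interpret N: cat_module K G N by (rule Nm)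
  obtain x where x: "x \<in> supp G m" using supp_nonempty[OF m] by blast
  have xO: "x \<in> Ob G" by (rule supp_Ob[OF m x])
  have "carrier (Val (simple_head K G D m) x) \<noteq> {\<zero>\<^bsub>Val (simple_head K G D m) x\<^esub>}"
    by (rule bottom_nonzero[OF m simple_head_bottom[OF m] x])
  then have Nx: "carrier (Val N x) \<noteq> {\<zero>\<^bsub>Val N x\<^esub>}"
  proof -
    assume nz: "carrier (Val (simple_head K G D m) x) \<noteq> {\<zero>\<^bsub>Val (simple_head K G D m) x\<^esub>}"
    interpret L: cat_module K G "simple_head K G D m" by (rule simple_head_module[OF m])
    obtain \<psi> where h: "cat_module_hom K G N (simple_head K G D m) \<psi>"
      and im: "carrier (Val (simple_head K G D m) x) = \<psi> x ` carrier (Val N x)"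
      using iso xO unfolding cat_module_iso_def bij_betw_def by metis
    show ?thesis
      using nz module_hom_zero[OF N.Val_space[OF xO] L.Val_space[OF xO] cat_module_homD(1)[OF h xO]]
      unfolding im by auto
  qed
  have Tx: "T x \<noteq> {\<zero>\<^bsub>Val ?D x\<^esub>}"
  proof
    assume "T x = {\<zero>\<^bsub>Val ?D x\<^esub>}"
    moreover have "p x \<zero>\<^bsub>Val ?D x\<^esub> = \<zero>\<^bsub>Val N x\<^esub>"
      using module_hom_zero[OF cat_module.Val_space[OF Tm xO] N.Val_space[OF xO] cat_module_homD(1)[OF ph xO]] by simp
    ultimately show False using Nx pim[OF xO] by simp
  qed
  then have "carrier (Val ?D x) \<noteq> {\<zero>\<^bsub>Val ?D x\<^esub>}"
    using cat_submoduleD(2,3)[OF T xO] by auto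
  then have le: "(supp G l, supp G m) \<in> r" using Delta_supp[OF l xO] supp_eq[OF m x] by simp
  show ?thesis
  proof (cases "supp G l = supp G m")
    case False
    then show ?thesis using m iso le by (auto simp: weight_less_def)
  next
    case True
    \<comment> \<open>With equal supports, \<open>T\<close> is non-zero at the bottom and so is the
      whole standard module. Then \<open>N\<close> is a simple quotient of it, hence its head,
      against \<open>ne\<close>.\<close>
    have "\<forall>y\<in>supp G l. T y = carrier (Val ?D y)"
      using bottom_irreducible[OF l Delta_bottom[OF l] Mid_submodule[OF T]] Tx x True by blast
    then have full: "\<forall>y\<in>Ob G. T y = carrier (Val ?D y)"
      using Delta_generated[OF l] T unfolding bottom_generates_def by blast
    have "cat_module_hom K G ?D N p"
      using ph full unfolding cat_module_hom_def module_hom_def by simp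
    then have "cat_module_iso K G N (simple_head K G D l)"
      by (rule simple_quotient_iso_head[OF l simple]) (use pim full in simp)
    then show ?thesis using ne by blast
  qed
qed

end

theorem proposition4p11:
  fixes K :: "'k ring"
    and G :: "('o, 'm, 'k) lin_category"
    and U D :: "'o \<Rightarrow> 'o \<Rightarrow> 'm set"
    and r :: "'o set rel"
    and l :: "('o, 'm, 'k) weight"
  assumes "algebraically_closed K"
    and "triangular_category K G U D"
    and "admissible_order G U D r"
    and "l \<in> weights K G U D"
  shows
    "lowest_weight_module K G U D r l (standard_module K G D l) \<and>
     (\<forall>N :: ('o, 'm, 'k, 'v) lin_functor.
        lowest_weight_module K G U D r l N \<longrightarrow> is_quotient_of K G N (standard_module K G D l)) \<and>
     (\<exists>!T. simple_quotient_kernel K G (standard_module K G D l) T) \<and>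
     (\<forall>N :: ('o, 'm, 'k, 'v) lin_functor.
        simple_module K G N \<longrightarrow>
        (\<exists>!m. m \<in> weights K G U D \<and> cat_module_iso K G N (simple_head K G D m))) \<and>
     (\<forall>N :: ('o, 'm, 'k, 'v) lin_functor.
        simple_constituent K G N (standard_module K G D l) \<and>
        \<not> cat_module_iso K G N (simple_head K G D l) \<longrightarrow>
        (\<exists>m\<in>weights K G U D. weight_less G r l m \<and> cat_module_iso K G N (simple_head K G D m)))"
proof -
  interpret ordered_triangular_category K G U D r
    using assms(2,3) by (simp add: ordered_triangular_category_def ordered_triangular_category_axioms_def)
  note l = assms(4)
  have "\<exists>!m. m \<in> weights K G U D \<and> cat_module_iso K G N (simple_head K G D m)"
    if "simple_module K G N" for N :: "('o, 'm, 'k, 'v) lin_functor"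
    using simple_is_head[OF that] head_unique that unfolding simple_module_def by metis
  moreover have "\<exists>!T. simple_quotient_kernel K G (standard_module K G D l) T"
    unfolding Delta_kernel_iff[OF l] by simp
  moreover have "\<exists>m\<in>weights K G U D. weight_less G r l m \<and> cat_module_iso K G N (simple_head K G D m)"
    if "simple_constituent K G N (standard_module K G D l) \<and> \<not> cat_module_iso K G N (simple_head K G D l)"
    for N :: "('o, 'm, 'k, 'v) lin_functor"
    using constituent_weight[OF l] that by blast
  ultimately show ?thesis
    using bottom_lowest_weight[OF l Delta_bottom[OF l] Delta_generated[OF l]]
      lowest_weight_is_quotient[OF l] by (intro conjI allI impI)
qed

end
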